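(* The algebras $\mathcal R_{[\alpha]}^{\Lambda}(\Gamma)^\sigma$ and $(\mathcal R_{[\alpha]}(\Gamma)^\sigma)^{\Lambda}$ are isomorphic. In particular, the generators $\{e(\gamma)\}_{\gamma\in K^{[\alpha]}_\sigma}\cup\{y_1,\dots,y_n\}\cup\{\psi_1,\dots,\psi_{n-1}\}$ together with the relations (F1)-(F11) and (FC) listed in the context give a presentation of $\mathcal R_{[\alpha]}^{\Lambda}(\Gamma)^\sigma$.
   Context: $n,p$ are positive integers and $F$ is a field whose characteristic does not divide $p$ (in the paper, $F$ contains a primitive $p$-th root of unity). $K$ is a set and $\Gamma$ is a loop-free quiver with vertex set $K$ and without multiple directed edges. For $k,k'\in K$: $k\nleftrightarrow k'$ means $k\ne k'$ and neither $(k,k')$ nor $(k',k)$ is an edge; $k\to k'$ means $(k,k')$ is an edge and $(k',k)$ is not; $k\leftarrow k'$ means $k'\to k$; $k\leftrightarrows k'$ means both are edges. A $K$-composition $\alpha$ of $n$ is a finitely supported tuple $(\alpha_k)_{k\in K}$ of non-negative integers with sum $n$; $K^\alpha\subset K^n$ is the (finite) set of tuples with exactly $\alpha_k$ components equal to $k$ for each $k$. $\mathfrak S_n$ acts on $K^n$ by place permutations, $s_a=(a,a+1)$. $\mathcal R_\alpha(\Gamma)$ is the unital associative $F$-algebra generated by $e(\boldsymbol k)$ ($\boldsymbol k\in K^\alpha$), $y_1,\dots,y_n$, $\psi_1,\dots,\psi_{n-1}$ with relations: $\sum_{\boldsymbol k}e(\boldsymbol k)=1$; $e(\boldsymbol k)e(\boldsymbol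 k')=\delta_{\boldsymbol k,\boldsymbol k'}e(\boldsymbol k)$; $y_ae(\boldsymbol k)=e(\boldsymbol k)y_a$; $\psi_ae(\boldsymbol k)=e(s_a\cdot\boldsymbol k)\psi_a$; $y_ay_b=y_by_a$; $\psi_ay_b=y_b\psi_a$ if $b\ne a,a+1$; $\psi_a\psi_b=\psi_b\psi_a$ if $|a-b|>1$; $\psi_ay_{a+1}e(\boldsymbol k)=(y_a\psi_a+\delta_{k_a,k_{a+1}})e(\boldsymbol k)$; $y_{a+1}\psi_ae(\boldsymbol k)=(\psi_ay_a+\delta_{k_a,k_{a+1}})e(\boldsymbol k)$; $\psi_a^2e(\boldsymbol k)=0$, $e(\boldsymbol k)$, $(y_{a+1}-y_a)e(\boldsymbol k)$, $(y_a-y_{a+1})e(\boldsymbol k)$, $(y_{a+1}-y_a)(y_a-y_{a+1})e(\boldsymbol k)$ according as $k_a=k_{a+1}$, $k_a\nleftrightarrow k_{a+1}$, $k_a\to k_{a+1}$, $k_a\leftarrow k_{a+1}$, $k_a\leftrightarrows k_{a+1}$; and $\psi_{a+1}\psi_a\psi_{a+1}e(\boldsymbol k)=(\psi_a\psi_{a+1}\psi_a+c)e(\boldsymbol k)$ with $c=-1$ if $k_{a+2}=k_a\to k_{a+1}$, $c=1$ if $k_{a+2}=k_a\leftarrow k_{a+1}$, $c=2y_{a+1}-y_a-y_{a+2}$ if $k_{a+2}=k_a\leftrightarrows k_{a+1}$, $c=0$ otherwise. $\sigma:K\to K$ is a bijection mapping edges of $\Gamma$ to edges of $\Gamma$, such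 that $\sigma^{p_1}(k)\ne k=\sigma^p(k)$ for all $k\in K$ and $1\le p_1\le p-1$. It acts componentwise on $K^n$, and on $K$-compositions by $(\sigma\cdot\alpha)_k=\alpha_{\sigma^{-1}(k)}$. Fix a $K$-composition $\alpha$ of $n$; $[\alpha]$ is its $\langle\sigma\rangle$-orbit, $K^{[\alpha]}=\bigsqcup_{\beta\in[\alpha]}K^\beta$, $\mathcal R_{[\alpha]}(\Gamma)=\bigoplus_{\beta\in[\alpha]}\mathcal R_\beta(\Gamma)$. The assignment $e(\boldsymbol k)\mapsto e(\sigma(\boldsymbol k))$, $y_a\mapsto y_a$, $\psi_a\mapsto\psi_a$ defines an automorphism $\sigma$ of $\mathcal R_{[\alpha]}(\Gamma)$. $\Lambda=(\Lambda_k)_{k\in K}$ is a finitely supported tuple of non-negative integers with $\Lambda_{\sigma(k)}=\Lambda_k$ for all $k$. $\mathcal R_{[\alpha]}^\Lambda(\Gamma)$ is the quotient of $\mathcal R_{[\alpha]}(\Gamma)$ by the two-sided ideal generated by $y_1^{\Lambda_{k_1}}e(\boldsymbol k)$, $\boldsymbol k\in K^{[\alpha]}$; $\sigma$ descends to it. The exponent $\sigma$ denotes the subalgebra of fixed points. $K^{[\alpha]}_\sigma$ is the set of $\langle\sigma\rangle$-orbits on $K^{[\alpha]}$. For $\gamma\in K^{[\alpha]}_\sigma$, $e(\gamma)=\sum_{\boldsymbol k\in\gamma}e(\boldsymbol k)$; $s_a\cdot\gamma$ is the orbit of $s_a\cdot\boldsymbol k$, and $\gamma_a=\gamma_b$,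 $\gamma_a\to\gamma_b$, $\gamma_a\nleftrightarrow\gamma_b$, $\Lambda_{\gamma_a}$, etc. are defined through any representative $\boldsymbol k\in\gamma$ (independent of the choice). $(\mathcal R_{[\alpha]}(\Gamma)^\sigma)^\Lambda$ is the quotient of $\mathcal R_{[\alpha]}(\Gamma)^\sigma$ by its two-sided ideal generated by the elements $y_1^{\Lambda_{\gamma_1}}e(\gamma)$, $\gamma\in K^{[\alpha]}_\sigma$. Relations (for all $\gamma,\gamma'$ and all admissible indices): (F1) $\sum_\gamma e(\gamma)=1$; (F2) $e(\gamma)e(\gamma')=\delta_{\gamma,\gamma'}e(\gamma)$; (F3) $y_ae(\gamma)=e(\gamma)y_a$; (F4) $\psi_ae(\gamma)=e(s_a\cdot\gamma)\psi_a$; (F5) $y_ay_b=y_by_a$; (F6) $\psi_ay_b=y_b\psi_a$ if $b\ne a,a+1$; (F7) $\psi_a\psi_b=\psi_b\psi_a$ if $|a-b|>1$; (F8) $\psi_ay_{a+1}e(\gamma)=(y_a\psi_a+1)e(\gamma)$ if $\gamma_a=\gamma_{a+1}$ and $=y_a\psi_ae(\gamma)$ if $\gamma_a\ne\gamma_{a+1}$; (F9) $y_{a+1}\psi_ae(\gamma)=(\psi_ay_a+1)e(\gamma)$ if $\gamma_a=\gamma_{a+1}$ and $=\psi_ay_ae(\gamma)$ if $\gamma_a\neq\gamma_{a+1}$; (F10) $\psi_a^2e(\gamma)=0$, $e(\gamma)$, $(y_{a+1}-y_a)e(\gamma)$, $(y_a-y_{a+1})e(\gamma)$, $(y_{a+1}-y_a)(y_a-y_{a+1})e(\gamma)$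 according as $\gamma_a=\gamma_{a+1}$, $\gamma_a\nleftrightarrow\gamma_{a+1}$, $\gamma_a\to\gamma_{a+1}$, $\gamma_a\leftarrow\gamma_{a+1}$, $\gamma_a\leftrightarrows\gamma_{a+1}$; (F11) $\psi_{a+1}\psi_a\psi_{a+1}e(\gamma)=(\psi_a\psi_{a+1}\psi_a+c)e(\gamma)$ with $c=-1$ if $\gamma_{a+2}=\gamma_a\to\gamma_{a+1}$, $c=1$ if $\gamma_{a+2}=\gamma_a\leftarrow\gamma_{a+1}$, $c=2y_{a+1}-y_a-y_{a+2}$ if $\gamma_{a+2}=\gamma_a\leftrightarrows\gamma_{a+1}$, $c=0$ otherwise; (FC) $y_1^{\Lambda_{\gamma_1}}e(\gamma)=0$. *)

theory Defs
  imports "HOL-Algebra.QuotRing" "HOL-Algebra.Module" "HOL-Library.Poly_Mapping" "HOL-Library.FuncSet"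
begin

section \<open>Algebras over a field and presentations\<close>

text \<open>
  An algebra over the field \<open>'f\<close> is a record \<^typ>\<open>('f, 'a) module\<close>: the ring structure of
  \<^typ>\<open>'a ring\<close>, in general noncommutative, together with scalar multiplication. (The library
  locale \<^locale>\<open>algebra\<close> is about commutative algebras and is not used.)
\<close>

definition alg_iso :: "('f, 'a, 'm) module_scheme \<Rightarrow> ('f, 'b, 'n) module_scheme \<Rightarrow> ('a \<Rightarrow> 'b) set"
  where "alg_iso A B =
    {h \<in> ring_iso A B. \<forall>c. \<forall>x\<in>carrier A. h (c \<odot>\<^bsub>A\<^esub> x) = c \<odot>\<^bsub>B\<^esub> h x}"

definition quot_alg :: "('f, 'a, 'm) module_scheme \<Rightarrow> 'a set \<Rightarrow> ('f, 'a set) module"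
  where "quot_alg A I =
    \<lparr>carrier = carrier (A Quot I), mult = mult (A Quot I), one = one (A Quot I),
     zero = zero (A Quot I), add = add (A Quot I),
     smult = (\<lambda>c C. \<Union>x\<in>C. I +>\<^bsub>A\<^esub> (c \<odot>\<^bsub>A\<^esub> x))\<rparr>"

text \<open>
  The direct sum of a family of algebras; the index set is finite in all uses, so that this is
  the full product, with componentwise unit.
\<close>

definition prod_alg :: "'i set \<Rightarrow> ('i \<Rightarrow> ('f, 'a, 'm) module_scheme) \<Rightarrow> ('f, 'i \<Rightarrow> 'a) module"
  where "prod_alg I A =
    \<lparr>carrier = (\<Pi>\<^sub>E i\<in>I. carrier (A i)),
     mult = (\<lambda>x y. \<lambda>i\<in>I. x i \<otimes>\<^bsub>A i\<^esub> y i), one = (\<lambda>i\<in>I. \<one>\<^bsub>A i\<^esub>),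
     zero = (\<lambda>i\<in>I. \<zero>\<^bsub>A i\<^esub>), add = (\<lambda>x y. \<lambda>i\<in>I. x i \<oplus>\<^bsub>A i\<^esub> y i),
     smult = (\<lambda>c x. \<lambda>i\<in>I. c \<odot>\<^bsub>A i\<^esub> x i)\<rparr>"

definition fixed_subalg :: "('f, 'a) module \<Rightarrow> ('a \<Rightarrow> 'a) \<Rightarrow> ('f, 'a) module"
  where "fixed_subalg A s = A\<lparr>carrier := {x \<in> carrier A. s x = x}\<rparr>"

text \<open>
  Words form a monoid under concatenation, so that \<^typ>\<open>'g list \<Rightarrow>\<^sub>0 'f\<close> carries the
  multiplication of the free unital associative algebra on \<open>'g\<close>.
\<close>

instantiation list :: (type) monoid_add
begin

definition zero_list :: "'a list" where "zero_list = []"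

definition plus_list :: "'a list \<Rightarrow> 'a list \<Rightarrow> 'a list" where "plus_list = (@)"

instance by standard (simp_all add: zero_list_def plus_list_def)

end

type_synonym ('g, 'f) free = "'g list \<Rightarrow>\<^sub>0 'f"

definition var :: "'g \<Rightarrow> ('g, 'f::field) free"
  where "var g = Poly_Mapping.single [g] 1"

definition free_alg :: "'g set \<Rightarrow> ('f::field, ('g, 'f) free) module"
  where "free_alg G =
    \<lparr>carrier = {x. Poly_Mapping.keys x \<subseteq> lists G}, mult = (*), one = 1, zero = 0, add = (+),
     smult = (\<lambda>c x. Poly_Mapping.single [] c * x)\<rparr>"

text \<open>A pair \<open>(l, r)\<close> of elements of the free algebra stands for the relation \<open>l = r\<close>.\<close>

definition pres_ideal :: "'g set \<Rightarrow> (('g, 'f::field) free \<times> ('g, 'f) free) set \<Rightarrow> ('g, 'f) free set"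
  where "pres_ideal G S = Idl\<^bsub>free_alg G\<^esub> ((\<lambda>(l, r). l - r) ` S)"

definition pres_alg ::
    "'g set \<Rightarrow> (('g, 'f::field) free \<times> ('g, 'f) free) set \<Rightarrow> ('f, ('g, 'f) free set) module"
  where "pres_alg G S = quot_alg (free_alg G) (pres_ideal G S)"

definition pres_gen ::
    "'g set \<Rightarrow> (('g, 'f::field) free \<times> ('g, 'f) free) set \<Rightarrow> 'g \<Rightarrow> ('g, 'f) free set"
  where "pres_gen G S g = pres_ideal G S +>\<^bsub>free_alg G\<^esub> var g"

definition rename :: "('g \<Rightarrow> 'h) \<Rightarrow> ('g, 'f::field) free \<Rightarrow> ('h, 'f) free"
  where "rename f x = (\<Sum>w\<in>Poly_Mapping.keys x. Poly_Mapping.single (map f w) (Poly_Mapping.lookup x w))"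

section \<open>Compositions, tuples and orbits\<close>

text \<open>
  The \<open>n\<close>-tuples with entries in \<open>'k\<close> are the elements of \<open>{1..n} \<rightarrow>\<^sub>E UNIV\<close>.
\<close>

definition composition :: "nat \<Rightarrow> ('k \<Rightarrow> nat) \<Rightarrow> bool"
  where "composition n \<alpha> \<longleftrightarrow> finite {k. \<alpha> k \<noteq> 0} \<and> (\<Sum>k | \<alpha> k \<noteq> 0. \<alpha> k) = n"

definition tuples :: "nat \<Rightarrow> ('k \<Rightarrow> nat) \<Rightarrow> (nat \<Rightarrow> 'k) set"
  where "tuples n \<alpha> = {k \<in> {1..n} \<rightarrow>\<^sub>E UNIV. \<forall>j. card {a \<in> {1..n}. k a = j} = \<alpha> j}"

definition swap :: "nat \<Rightarrow> (nat \<Rightarrow> 'k) \<Rightarrow> (nat \<Rightarrow> 'k)"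
  where "swap a k = k(a := k (a + 1), a + 1 := k a)"

definition tup_act :: "nat \<Rightarrow> ('k \<Rightarrow> 'k) \<Rightarrow> (nat \<Rightarrow> 'k) \<Rightarrow> (nat \<Rightarrow> 'k)"
  where "tup_act n \<sigma> k = (\<lambda>a\<in>{1..n}. \<sigma> (k a))"

definition comp_act :: "('k \<Rightarrow> 'k) \<Rightarrow> ('k \<Rightarrow> nat) \<Rightarrow> ('k \<Rightarrow> nat)"
  where "comp_act \<sigma> \<alpha> = (\<lambda>k. \<alpha> (inv_into UNIV \<sigma> k))"

text \<open>
  The orbit under the cyclic group generated by \<open>f\<close>. All maps in question have finite order,
  so that non-negative powers suffice.
\<close>

definition cyc_orbit :: "('x \<Rightarrow> 'x) \<Rightarrow> 'x \<Rightarrow> 'x set"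
  where "cyc_orbit f x = {(f ^^ i) x | i :: nat. True}"

abbreviation comp_orbit :: "('k \<Rightarrow> 'k) \<Rightarrow> ('k \<Rightarrow> nat) \<Rightarrow> ('k \<Rightarrow> nat) set"
  where "comp_orbit \<sigma> \<alpha> \<equiv> cyc_orbit (comp_act \<sigma>) \<alpha>"

abbreviation tup_orbit :: "nat \<Rightarrow> ('k \<Rightarrow> 'k) \<Rightarrow> (nat \<Rightarrow> 'k) \<Rightarrow> (nat \<Rightarrow> 'k) set"
  where "tup_orbit n \<sigma> k \<equiv> cyc_orbit (tup_act n \<sigma>) k"

definition orbit_tuples :: "nat \<Rightarrow> ('k \<Rightarrow> 'k) \<Rightarrow> ('k \<Rightarrow> nat) \<Rightarrow> (nat \<Rightarrow> 'k) set"
  where "orbit_tuples n \<sigma> \<alpha> = (\<Union>\<beta>\<in>comp_orbit \<sigma> \<alpha>. tuples n \<beta>)"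

definition tuple_orbits :: "nat \<Rightarrow> ('k \<Rightarrow> 'k) \<Rightarrow> ('k \<Rightarrow> nat) \<Rightarrow> (nat \<Rightarrow> 'k) set set"
  where "tuple_orbits n \<sigma> \<alpha> = tup_orbit n \<sigma> ` orbit_tuples n \<sigma> \<alpha>"

section \<open>Quiver Hecke algebras\<close>

definition unlinked :: "('k \<times> 'k) set \<Rightarrow> 'k \<Rightarrow> 'k \<Rightarrow> bool"
  where "unlinked E k k' \<longleftrightarrow> k \<noteq> k' \<and> (k, k') \<notin> E \<and> (k', k) \<notin> E"

definition arrow :: "('k \<times> 'k) set \<Rightarrow> 'k \<Rightarrow> 'k \<Rightarrow> bool"
  where "arrow E k k' \<longleftrightarrow> (k, k') \<in> E \<and> (k', k) \<notin> E"

definition biarrow :: "('k \<times> 'k) set \<Rightarrow> 'k \<Rightarrow> 'k \<Rightarrow> bool"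
  where "biarrow E k k' \<longleftrightarrow> (k, k') \<in> E \<and> (k', k) \<in> E"

datatype 'i gen = E_gen 'i | Y_gen nat | Psi_gen nat

abbreviation ge :: "'i \<Rightarrow> ('i gen, 'f::field) free" where "ge i \<equiv> var (E_gen i)"
abbreviation gy :: "nat \<Rightarrow> ('i gen, 'f::field) free" where "gy a \<equiv> var (Y_gen a)"
abbreviation gpsi :: "nat \<Rightarrow> ('i gen, 'f::field) free" where "gpsi a \<equiv> var (Psi_gen a)"

definition klr_gens :: "nat \<Rightarrow> 'i set \<Rightarrow> 'i gen set"
  where "klr_gens n J = E_gen ` J \<union> Y_gen ` {1..n} \<union> Psi_gen ` {1..<n}"

definition sq_factor :: "('k \<times> 'k) set \<Rightarrow> (nat \<Rightarrow> 'k) \<Rightarrow> nat \<Rightarrow> ('i gen, 'f::field) free"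
  where "sq_factor E k a =
    (if k a = k (a + 1) then 0
     else if unlinked E (k a) (k (a + 1)) then 1
     else if arrow E (k a) (k (a + 1)) then gy (a + 1) - gy a
     else if arrow E (k (a + 1)) (k a) then gy a - gy (a + 1)
     else (gy (a + 1) - gy a) * (gy a - gy (a + 1)))"

definition braid_term :: "('k \<times> 'k) set \<Rightarrow> (nat \<Rightarrow> 'k) \<Rightarrow> nat \<Rightarrow> ('i gen, 'f::field) free"
  where "braid_term E k a =
    (if k (a + 2) = k a then
       if arrow E (k a) (k (a + 1)) then -1
       else if arrow E (k (a + 1)) (k a) then 1
       else if biarrow E (k a) (k (a + 1)) then 2 * gy (a + 1) - gy a - gy (a + 2)
       else 0
     else 0)"

text \<open>
  The quiver Hecke relations, stated once for both presentations. Here \<open>T\<close> is a set of tuples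
  and \<open>lab\<close> gives the index of the idempotent belonging to a tuple: with the identity one gets
  the relations among the \<open>e(k)\<close>, and with the map sending \<open>k\<close> to its orbit \<open>\<gamma>\<close> one gets
  the relations among the \<open>e(\<gamma>)\<close>, in which the conditions on \<open>\<gamma>\<close> (such as an arrow from
  \<open>\<gamma>\<^sub>a\<close> to \<open>\<gamma>\<^sub>b\<close>) are expressed through a representative \<open>k\<close>.
\<close>

inductive_set klr_rels ::
    "nat \<Rightarrow> ('k \<times> 'k) set \<Rightarrow> (nat \<Rightarrow> 'k) set \<Rightarrow> ((nat \<Rightarrow> 'k) \<Rightarrow> 'i)
      \<Rightarrow> (('i gen, 'f::field) free \<times> ('i gen, 'f) free) set"
  for n :: nat and E :: "('k \<times> 'k) set" and T :: "(nat \<Rightarrow> 'k) set" and lab :: "(nat \<Rightarrow> 'k) \<Rightarrow> 'i"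
  where
  idem_sum:
    "(\<Sum>i\<in>lab ` T. ge i, 1) \<in> klr_rels n E T lab"
| idem_mult:
    "\<lbrakk>k \<in> T; k' \<in> T\<rbrakk>
      \<Longrightarrow> (ge (lab k) * ge (lab k'), if lab k = lab k' then ge (lab k) else 0) \<in> klr_rels n E T lab"
| y_idem:
    "\<lbrakk>k \<in> T; a \<in> {1..n}\<rbrakk> \<Longrightarrow> (gy a * ge (lab k), ge (lab k) * gy a) \<in> klr_rels n E T lab"
| psi_idem:
    "\<lbrakk>k \<in> T; a \<in> {1..<n}\<rbrakk>
      \<Longrightarrow> (gpsi a * ge (lab k), ge (lab (swap a k)) * gpsi a) \<in> klr_rels n E T lab"
| y_y:
    "\<lbrakk>a \<in> {1..n}; b \<in> {1..n}\<rbrakk> \<Longrightarrow> (gy a * gy b, gy b * gy a) \<in> klr_rels n E T lab"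
| psi_y:
    "\<lbrakk>a \<in> {1..<n}; b \<in> {1..n}; b \<noteq> a; b \<noteq> a + 1\<rbrakk>
      \<Longrightarrow> (gpsi a * gy b, gy b * gpsi a) \<in> klr_rels n E T lab"
| psi_psi:
    "\<lbrakk>a \<in> {1..<n}; b \<in> {1..<n}; \<bar>int a - int b\<bar> > 1\<rbrakk>
      \<Longrightarrow> (gpsi a * gpsi b, gpsi b * gpsi a) \<in> klr_rels n E T lab"
| psi_y_Suc:
    "\<lbrakk>k \<in> T; a \<in> {1..<n}\<rbrakk>
      \<Longrightarrow> (gpsi a * gy (a + 1) * ge (lab k),
           (gy a * gpsi a + (if k a = k (a + 1) then 1 else 0)) * ge (lab k)) \<in> klr_rels n E T lab"
| y_Suc_psi:
    "\<lbrakk>k \<in> T; a \<in> {1..<n}\<rbrakk>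
      \<Longrightarrow> (gy (a + 1) * gpsi a * ge (lab k),
           (gpsi a * gy a + (if k a = k (a + 1) then 1 else 0)) * ge (lab k)) \<in> klr_rels n E T lab"
| psi_sq:
    "\<lbrakk>k \<in> T; a \<in> {1..<n}\<rbrakk>
      \<Longrightarrow> (gpsi a ^ 2 * ge (lab k), sq_factor E k a * ge (lab k)) \<in> klr_rels n E T lab"
| braid:
    "\<lbrakk>k \<in> T; 1 \<le> a; a + 1 < n\<rbrakk>
      \<Longrightarrow> (gpsi (a + 1) * gpsi a * gpsi (a + 1) * ge (lab k),
           (gpsi a * gpsi (a + 1) * gpsi a + braid_term E k a) * ge (lab k)) \<in> klr_rels n E T lab"

abbreviation comp_gens :: "nat \<Rightarrow> ('k \<Rightarrow> nat) \<Rightarrow> (nat \<Rightarrow> 'k) gen set"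
  where "comp_gens n \<beta> \<equiv> klr_gens n (tuples n \<beta>)"

abbreviation comp_rels :: "nat \<Rightarrow> ('k \<times> 'k) set \<Rightarrow> ('k \<Rightarrow> nat) \<Rightarrow>
    (((nat \<Rightarrow> 'k) gen, 'f::field) free \<times> ((nat \<Rightarrow> 'k) gen, 'f) free) set"
  where "comp_rels n E \<beta> \<equiv> klr_rels n E (tuples n \<beta>) (\<lambda>k. k)"

definition klr :: "nat \<Rightarrow> ('k \<times> 'k) set \<Rightarrow> ('k \<Rightarrow> nat) \<Rightarrow>
    ('f::field, ((nat \<Rightarrow> 'k) gen, 'f) free set) module"
  where "klr n E \<beta> = pres_alg (comp_gens n \<beta>) (comp_rels n E \<beta>)"

type_synonym ('k, 'f) klr_elt = "('k \<Rightarrow> nat) \<Rightarrow> ((nat \<Rightarrow> 'k) gen, 'f) free set"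

definition klr_orb :: "nat \<Rightarrow> ('k \<times> 'k) set \<Rightarrow> ('k \<Rightarrow> 'k) \<Rightarrow> ('k \<Rightarrow> nat) \<Rightarrow>
    ('f::field, ('k, 'f) klr_elt) module"
  where "klr_orb n E \<sigma> \<alpha> = prod_alg (comp_orbit \<sigma> \<alpha>) (klr n E)"

definition orb_e :: "nat \<Rightarrow> ('k \<times> 'k) set \<Rightarrow> ('k \<Rightarrow> 'k) \<Rightarrow> ('k \<Rightarrow> nat) \<Rightarrow>
    (nat \<Rightarrow> 'k) \<Rightarrow> ('k, 'f::field) klr_elt"
  where "orb_e n E \<sigma> \<alpha> k = (\<lambda>\<beta>\<in>comp_orbit \<sigma> \<alpha>.
    if k \<in> tuples n \<beta> then pres_gen (comp_gens n \<beta>) (comp_rels n E \<beta>) (E_gen k)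
    else \<zero>\<^bsub>klr n E \<beta>\<^esub>)"

definition orb_y :: "nat \<Rightarrow> ('k \<times> 'k) set \<Rightarrow> ('k \<Rightarrow> 'k) \<Rightarrow> ('k \<Rightarrow> nat) \<Rightarrow>
    nat \<Rightarrow> ('k, 'f::field) klr_elt"
  where "orb_y n E \<sigma> \<alpha> a = (\<lambda>\<beta>\<in>comp_orbit \<sigma> \<alpha>.
    pres_gen (comp_gens n \<beta>) (comp_rels n E \<beta>) (Y_gen a))"

definition orb_psi :: "nat \<Rightarrow> ('k \<times> 'k) set \<Rightarrow> ('k \<Rightarrow> 'k) \<Rightarrow> ('k \<Rightarrow> nat) \<Rightarrow>
    nat \<Rightarrow> ('k, 'f::field) klr_elt"
  where "orb_psi n E \<sigma> \<alpha> a = (\<lambda>\<beta>\<in>comp_orbit \<sigma> \<alpha>.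
    pres_gen (comp_gens n \<beta>) (comp_rels n E \<beta>) (Psi_gen a))"

text \<open>
  The automorphism with \<open>e(k) \<mapsto> e(\<sigma>(k))\<close> that fixes all \<open>y\<^sub>a\<close> and \<open>\<psi>\<^sub>a\<close>. The renaming of
  idempotents carries the ideal of relations for \<open>\<sigma>\<^sup>-\<^sup>1\<cdot>\<beta>\<close> onto the one for \<open>\<beta>\<close>, so that the
  image of a coset in the component \<open>\<sigma>\<^sup>-\<^sup>1\<cdot>\<beta>\<close> is a coset in the component \<open>\<beta>\<close>.
\<close>

definition orb_aut :: "nat \<Rightarrow> ('k \<Rightarrow> 'k) \<Rightarrow> ('k \<Rightarrow> nat) \<Rightarrow>
    ('k, 'f::field) klr_elt \<Rightarrow> ('k, 'f) klr_elt"
  where "orb_aut n \<sigma> \<alpha> x = (\<lambda>\<beta>\<in>comp_orbit \<sigma> \<alpha>.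
    rename (map_gen (tup_act n \<sigma>)) ` x (comp_act (inv_into UNIV \<sigma>) \<beta>))"

definition cyc_ideal :: "nat \<Rightarrow> ('k \<times> 'k) set \<Rightarrow> ('k \<Rightarrow> 'k) \<Rightarrow> ('k \<Rightarrow> nat) \<Rightarrow> ('k \<Rightarrow> nat) \<Rightarrow>
    ('k, 'f::field) klr_elt set"
  where "cyc_ideal n E \<sigma> \<alpha> \<Lambda> = (let R = klr_orb n E \<sigma> \<alpha> in
    Idl\<^bsub>R\<^esub> {orb_y n E \<sigma> \<alpha> 1 [^]\<^bsub>R\<^esub> \<Lambda> (k 1) \<otimes>\<^bsub>R\<^esub> orb_e n E \<sigma> \<alpha> k | k. k \<in> orbit_tuples n \<sigma> \<alpha>})"

definition cyc_klr :: "nat \<Rightarrow> ('k \<times> 'k) set \<Rightarrow> ('k \<Rightarrow> 'k) \<Rightarrow> ('k \<Rightarrow> nat) \<Rightarrow> ('k \<Rightarrow> nat) \<Rightarrow>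
    ('f::field, ('k, 'f) klr_elt set) module"
  where "cyc_klr n E \<sigma> \<alpha> \<Lambda> = quot_alg (klr_orb n E \<sigma> \<alpha>) (cyc_ideal n E \<sigma> \<alpha> \<Lambda>)"

text \<open>The induced automorphism of the cyclotomic quotient sends a coset to its image.\<close>

definition cyc_klr_fixed :: "nat \<Rightarrow> ('k \<times> 'k) set \<Rightarrow> ('k \<Rightarrow> 'k) \<Rightarrow> ('k \<Rightarrow> nat) \<Rightarrow> ('k \<Rightarrow> nat) \<Rightarrow>
    ('f::field, ('k, 'f) klr_elt set) module"
  where "cyc_klr_fixed n E \<sigma> \<alpha> \<Lambda> =
    fixed_subalg (cyc_klr n E \<sigma> \<alpha> \<Lambda>) (\<lambda>C. orb_aut n \<sigma> \<alpha> ` C)"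

definition cyc_class :: "nat \<Rightarrow> ('k \<times> 'k) set \<Rightarrow> ('k \<Rightarrow> 'k) \<Rightarrow> ('k \<Rightarrow> nat) \<Rightarrow> ('k \<Rightarrow> nat) \<Rightarrow>
    ('k, 'f::field) klr_elt \<Rightarrow> ('k, 'f) klr_elt set"
  where "cyc_class n E \<sigma> \<alpha> \<Lambda> x = cyc_ideal n E \<sigma> \<alpha> \<Lambda> +>\<^bsub>klr_orb n E \<sigma> \<alpha>\<^esub> x"

definition orb_idem :: "nat \<Rightarrow> ('k \<times> 'k) set \<Rightarrow> ('k \<Rightarrow> 'k) \<Rightarrow> ('k \<Rightarrow> nat) \<Rightarrow>
    (nat \<Rightarrow> 'k) set \<Rightarrow> ('k, 'f::field) klr_elt"
  where "orb_idem n E \<sigma> \<alpha> \<gamma> = (\<Oplus>\<^bsub>klr_orb n E \<sigma> \<alpha>\<^esub>k\<in>\<gamma>. orb_e n E \<sigma> \<alpha> k)"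

definition klr_fixed :: "nat \<Rightarrow> ('k \<times> 'k) set \<Rightarrow> ('k \<Rightarrow> 'k) \<Rightarrow> ('k \<Rightarrow> nat) \<Rightarrow>
    ('f::field, ('k, 'f) klr_elt) module"
  where "klr_fixed n E \<sigma> \<alpha> = fixed_subalg (klr_orb n E \<sigma> \<alpha>) (orb_aut n \<sigma> \<alpha>)"

definition klr_fixed_cyc :: "nat \<Rightarrow> ('k \<times> 'k) set \<Rightarrow> ('k \<Rightarrow> 'k) \<Rightarrow> ('k \<Rightarrow> nat) \<Rightarrow> ('k \<Rightarrow> nat) \<Rightarrow>
    ('f::field, ('k, 'f) klr_elt set) module"
  where "klr_fixed_cyc n E \<sigma> \<alpha> \<Lambda> = (let R = klr_fixed n E \<sigma> \<alpha> in
    quot_alg R (Idl\<^bsub>R\<^esub> {orb_y n E \<sigma> \<alpha> 1 [^]\<^bsub>R\<^esub> \<Lambda> (k 1) \<otimes>\<^bsub>R\<^esub> orb_idem n E \<sigma> \<alpha> (tup_orbit n \<sigma> k)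
      | k. k \<in> orbit_tuples n \<sigma> \<alpha>}))"

definition fix_gens :: "nat \<Rightarrow> ('k \<Rightarrow> 'k) \<Rightarrow> ('k \<Rightarrow> nat) \<Rightarrow> (nat \<Rightarrow> 'k) set gen set"
  where "fix_gens n \<sigma> \<alpha> = klr_gens n (tuple_orbits n \<sigma> \<alpha>)"

definition fix_rels :: "nat \<Rightarrow> ('k \<times> 'k) set \<Rightarrow> ('k \<Rightarrow> 'k) \<Rightarrow> ('k \<Rightarrow> nat) \<Rightarrow> ('k \<Rightarrow> nat) \<Rightarrow>
    (((nat \<Rightarrow> 'k) set gen, 'f::field) free \<times> ((nat \<Rightarrow> 'k) set gen, 'f) free) set"
  where "fix_rels n E \<sigma> \<alpha> \<Lambda> =
    klr_rels n E (orbit_tuples n \<sigma> \<alpha>) (tup_orbit n \<sigma>) \<union>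
    {(gy 1 ^ \<Lambda> (k 1) * ge (tup_orbit n \<sigma> k), 0) | k. k \<in> orbit_tuples n \<sigma> \<alpha>}"

end

theory Submission
  imports Defs "HOL-Library.Function_Algebras"
begin

text \<open>
  Let \<open>A\<close> be the algebra presented by (F1)--(F11) and (FC), let \<open>R\<close> be the quiver Hecke algebra of the
  orbit, \<open>I\<close> its cyclotomic ideal, and \<open>J\<close> the cyclotomic ideal of the fixed algebra. The relations
  give a homomorphism \<open>\<phi>\<close> from the free algebra to the fixed algebra, and everything follows once
  \<open>\<phi>\<close> is onto modulo \<open>I\<close> and modulo \<open>0\<close>, and \<open>\<phi>(x) \<in> I\<close> implies that \<open>x\<close> vanishes in \<open>A\<close>: then
  both algebras in the theorem are the quotient of the free algebra by the same ideal.

  Surjectivity: for each tuple \<open>k\<close> and each \<open>X\<close> there is a \<open>u\<close> with \<open>X e(k) = \<phi>(u) e(k)\<close>. If \<open>X\<close> is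
  fixed, applying powers of the automorphism gives the same identity for all tuples in the orbit
  \<open>\<gamma>\<close> of \<open>k\<close>, so that \<open>X e(\<gamma>) = \<phi>(u) e(\<gamma>)\<close>, and one sums over \<open>\<gamma>\<close>.

  Injectivity: \<open>R\<close> acts on the families \<open>v\<close> with \<open>v(k) \<in> e(\<gamma>) A\<close> for all tuples \<open>k\<close>, where \<open>\<gamma>\<close> is the
  orbit of \<open>k\<close>: \<open>e(k)\<close> projects, \<open>y\<^sub>a\<close> multiplies pointwise, and \<open>(\<psi>\<^sub>a v)(l) = \<psi>\<^sub>a v(s\<^sub>a l)\<close>. This action
  kills \<open>I\<close>, and summing the entries of \<open>v\<close> is \<open>A\<close>-linear. The family with entry \<open>e(\<gamma>)\<close> at one
  representative of each orbit and \<open>0\<close> elsewhere has sum \<open>1\<close>, so an element of \<open>A\<close> that acts as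
  zero is zero.
\<close>

section \<open>The free algebra and its linear actions\<close>

text \<open>No basis of any of the algebras is at hand, so injectivity cannot be read off a normal
  form; this is why a module is built. It is modelled on \<open>R\<close> acting on itself from the
  left. All orbits of tuples have length p, so for X in e(k)R the sum of the images of X under the p
  powers of \<sigma> lies in e(\<gamma>) times the fixed algebra, and left multiplication by e(k)
  recovers X. Under this identification, summing the entries of a family is the trace, which is
  linear over the fixed algebra, and the chosen family is a sum of e(k) with one k per orbit, an
  element of trace 1. Putting the presented algebra in place of the fixed algebra gives a module
  that exists before anything is known about the fixed algebra. The obstacle for surjectivity is
  that a fixed coset does not visibly contain a fixed element. The local identity gets around it: in
  a word multiplied by e(k), every idempotent letter acts as 1 or 0, so only letters y and \<psi>
  survive, and these are fixed.\<close>

lemma free_alg_simps [simp]: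
  "mult (free_alg G) = (*)" "one (free_alg G) = 1" "zero (free_alg G) = 0" "add (free_alg G) = (+)"
  "smult (free_alg G) = (\<lambda>c x. Poly_Mapping.single [] c * x)"
  by (simp_all add: free_alg_def)

lemma mem_free_alg: "x \<in> carrier (free_alg G) \<longleftrightarrow> Poly_Mapping.keys x \<subseteq> lists G"
  by (simp add: free_alg_def)

lemma free_alg_add: "x \<in> carrier (free_alg G) \<Longrightarrow> y \<in> carrier (free_alg G) \<Longrightarrow> x + y \<in> carrier (free_alg G)"
  unfolding mem_free_alg using Poly_Mapping.keys_add[of x y] by blast

lemma free_alg_uminus: "x \<in> carrier (free_alg G) \<Longrightarrow> - x \<in> carrier (free_alg G)"
  unfolding mem_free_alg by simp

lemma free_alg_diff: "x \<in> carrier (free_alg G) \<Longrightarrow> y \<in> carrier (free_alg G) \<Longrightarrow> x - y \<in> carrier (free_alg G)"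
  using free_alg_add[OF _ free_alg_uminus] by fastforce

lemma free_alg_mult:
  assumes "x \<in> carrier (free_alg G)" and "y \<in> carrier (free_alg G)"
  shows "x * y \<in> carrier (free_alg G)"
  using assms Poly_Mapping.keys_mult[of x y] unfolding mem_free_alg
  by (fastforce simp: plus_list_def)

lemma free_alg_zero: "0 \<in> carrier (free_alg G)"
  by (simp add: mem_free_alg)

lemma free_alg_single: "w \<in> lists G \<Longrightarrow> Poly_Mapping.single w c \<in> carrier (free_alg G)"
  by (simp add: mem_free_alg)

lemma single_Nil_one: "Poly_Mapping.single [] 1 = 1"
  by (metis single_one zero_list_def)

lemma free_alg_one: "1 \<in> carrier (free_alg G)"
  by (metis single_Nil_one free_alg_single lists.Nil)

lemma free_alg_var: "g \<in> G \<Longrightarrow> var g \<in> carrier (free_alg G)"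
  by (simp add: var_def free_alg_single)

lemma free_alg_power: "x \<in> carrier (free_alg G) \<Longrightarrow> x ^ m \<in> carrier (free_alg G)"
  by (induction m) (simp_all add: free_alg_one free_alg_mult)

lemma free_alg_sum: "(\<And>i. i \<in> A \<Longrightarrow> f i \<in> carrier (free_alg G)) \<Longrightarrow> sum f A \<in> carrier (free_alg G)"
  by (induction A rule: infinite_finite_induct) (simp_all add: free_alg_zero free_alg_add)

lemma free_alg_two: "2 \<in> carrier (free_alg G)"
  using free_alg_add[OF free_alg_one free_alg_one] by simp

lemmas free_alg_closed = free_alg_add free_alg_uminus free_alg_diff free_alg_mult free_alg_zero
  free_alg_one free_alg_power free_alg_sum free_alg_two free_alg_single[OF lists.Nil]

lemma ring_free_alg: "ring (free_alg G)"
proof (intro ringI abelian_groupI monoidI)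
  fix x assume "x \<in> carrier (free_alg G)"
  then show "\<exists>y\<in>carrier (free_alg G). y \<oplus>\<^bsub>free_alg G\<^esub> x = \<zero>\<^bsub>free_alg G\<^esub>"
    by (intro bexI[of _ "- x"]) (simp_all add: free_alg_uminus)
qed (simp_all add: free_alg_closed algebra_simps)

lemma update_eq_add_single:
  "w \<notin> Poly_Mapping.keys f \<Longrightarrow> Poly_Mapping.update w b f = f + Poly_Mapping.single w b"
  by (intro poly_mapping_eqI) (auto simp: lookup_update lookup_add lookup_single in_keys_iff when_def split: if_splits)

text \<open>The empty word is neutral and coefficients commute. Hence left multiplication by
  \<open>single [] c\<close> is a scalar multiplication respected by all other left
  multiplications.\<close>

lemma scalar_commute: "Poly_Mapping.single [] c * x = x * (Poly_Mapping.single [] c :: ('g, 'f::field) free)"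
proof (induction x rule: Poly_Mapping.update_induct)
  case const
  then show ?case by simp
next
  case (update f w b)
  then show ?case
    by (simp add: update_eq_add_single algebra_simps mult_single plus_list_def mult.commute)
qed

lemma free_alg_induct_words [consumes 1, case_names zero add word]:
  assumes "x \<in> carrier (free_alg G)" and "P 0"
    and "\<And>x y. \<lbrakk>x \<in> carrier (free_alg G); y \<in> carrier (free_alg G); P x; P y\<rbrakk> \<Longrightarrow> P (x + y)"
    and "\<And>w c. w \<in> lists G \<Longrightarrow> P (Poly_Mapping.single w c)"
  shows "P x"
  using assms(1)
proof (induction x rule: Poly_Mapping.update_induct)
  case const
  then show ?case using assms(2) by simp
next
  case (update f w b)
  have "Poly_Mapping.keys (Poly_Mapping.update w b f) = insert w (Poly_Mapping.keys f)"
    using update(1,2) by (auto simp: in_keys_iff lookup_update split: if_splits)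
  then have "w \<in> lists G" "f \<in> carrier (free_alg G)"
    using update(4) unfolding mem_free_alg by auto
  then show ?case
    unfolding update_eq_add_single[OF update(1)] using update(3) by (intro assms(3) assms(4)) (simp_all add: free_alg_single)
qed

text \<open>Letters are peeled off on the left, matching \<open>foldr\<close> in \<open>act\<close>:
  the leftmost letter is the operator applied last.\<close>

lemma free_alg_induct [consumes 1, case_names zero one add scale var]:
  assumes "x \<in> carrier (free_alg G)" and "P 0" and one: "P 1"
    and "\<And>x y. \<lbrakk>x \<in> carrier (free_alg G); y \<in> carrier (free_alg G); P x; P y\<rbrakk> \<Longrightarrow> P (x + y)"
    and scale: "\<And>c x. \<lbrakk>x \<in> carrier (free_alg G); P x\<rbrakk> \<Longrightarrow> P (Poly_Mapping.single [] c * x)"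
    and var: "\<And>g x. \<lbrakk>g \<in> G; x \<in> carrier (free_alg G); P x\<rbrakk> \<Longrightarrow> P (var g * x)"
  shows "P x"
  using assms(1)
proof (induction x rule: free_alg_induct_words)
  case (word w c)
  have "P (Poly_Mapping.single w 1)"
    using word
  proof (induction w)
    case Nil
    then show ?case using one by (simp add: single_Nil_one)
  next
    case (Cons g w)
    then have "P (var g * Poly_Mapping.single w 1)"
      by (intro var) (simp_all add: free_alg_single)
    then show ?case by (simp add: var_def mult_single plus_list_def)
  qed
  then have "P (Poly_Mapping.single [] c * Poly_Mapping.single w 1)"
    using word by (intro scale) (simp_all add: free_alg_single)
  then show ?case by (simp add: mult_single plus_list_def)
qed (use assms in auto)

section \<open>Actions of the free algebra extended from operators on letters\<close>

definition act :: "('f::field \<Rightarrow> 'v::ab_group_add \<Rightarrow> 'v) \<Rightarrow> ('g \<Rightarrow> 'v \<Rightarrow> 'v) \<Rightarrow> ('g, 'f) free \<Rightarrow> 'v \<Rightarrow> 'v"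
  where "act sc op x v = (\<Sum>w\<in>Poly_Mapping.keys x. sc (Poly_Mapping.lookup x w) (foldr op w v))"

text \<open>Universal property of the free algebra in module form: operators for the letters,
  subject only to linearity, extend to all of it. It is instantiated twice, with left
  multiplications on another free algebra and with operators on families indexed by tuples.\<close>

locale free_rep =
  fixes sc :: "'f::field \<Rightarrow> 'v::ab_group_add \<Rightarrow> 'v" and op :: "'g \<Rightarrow> 'v \<Rightarrow> 'v"
  assumes sc_add: "sc c (u + v) = sc c u + sc c v"
    and sc_add_left: "sc (c + d) v = sc c v + sc d v"
    and sc_mult: "sc c (sc d v) = sc (c * d) v"
    and sc_one: "sc 1 v = v"
    and op_add: "op g (u + v) = op g u + op g v"
    and op_sc: "op g (sc c v) = sc c (op g v)"
begin

lemma sc_zero_left: "sc 0 v = 0"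
  using sc_add_left[of 0 0 v] by simp

lemma foldr_add: "foldr op w (u + v) = foldr op w u + foldr op w v"
  by (induction w) (simp_all add: op_add)

lemma foldr_sc: "foldr op w (sc c v) = sc c (foldr op w v)"
  by (induction w) (simp_all add: op_sc)

lemma act_superset:
  assumes "finite K" and "Poly_Mapping.keys x \<subseteq> K"
  shows "act sc op x v = (\<Sum>w\<in>K. sc (Poly_Mapping.lookup x w) (foldr op w v))"
  unfolding act_def using assms
  by (intro sum.mono_neutral_left) (auto simp: in_keys_iff sc_zero_left)

lemma act_add: "act sc op (x + y) v = act sc op x v + act sc op y v"
proof -
  let ?K = "Poly_Mapping.keys x \<union> Poly_Mapping.keys y"
  show ?thesis
    using Poly_Mapping.keys_add[of x y]
    by (simp add: act_superset[of ?K] lookup_add sc_add_left sum.distrib)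
qed

lemma act_zero: "act sc op 0 v = 0"
  by (simp add: act_def)

lemma act_uminus: "act sc op (- x) v = - act sc op x v"
  using act_add[of x "- x" v] by (simp add: act_zero minus_unique)

lemma act_diff: "act sc op (x - y) v = act sc op x v - act sc op y v"
  using act_add[of x "- y" v] by (simp add: act_uminus)

lemma act_sum: "act sc op (sum f A) v = (\<Sum>i\<in>A. act sc op (f i) v)"
  by (induction A rule: infinite_finite_induct) (simp_all add: act_zero act_add)

lemma act_add_right: "act sc op x (u + v) = act sc op x u + act sc op x v"
  by (simp add: act_def foldr_add sc_add sum.distrib)

lemma act_zero_right: "act sc op x 0 = 0"
  using act_add_right[of x 0 0] by simp

lemma act_single: "act sc op (Poly_Mapping.single w c) v = sc c (foldr op w v)"
  by (simp add: act_superset[of "{w}"])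

lemma act_one: "act sc op 1 v = v"
  by (simp add: single_Nil_one[symmetric] act_single sc_one)

lemma act_var: "act sc op (var g) v = op g v"
  by (simp add: var_def act_single sc_one)

lemma act_mult: "act sc op (x * y) v = act sc op x (act sc op y v)"
proof -
  have U: "z \<in> carrier (free_alg UNIV)" for z :: "('g, 'f) free"
    by (simp add: mem_free_alg)
  \<comment> \<open>A single word on the left comes first, by induction on \<open>y\<close>;
    additivity in \<open>x\<close> then gives all products.\<close>
  have *: "act sc op (Poly_Mapping.single w c * y) v = act sc op (Poly_Mapping.single w c) (act sc op y v)" for w c
    using U[of y]
  proof (induction y rule: free_alg_induct_words)
    case (word u d)
    then show ?case
      by (simp add: mult_single act_single plus_list_def foldr_sc sc_mult)
  qed (simp_all add: act_zero act_zero_right algebra_simps act_add act_add_right)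
  show ?thesis
    using U[of x] by (induction x rule: free_alg_induct_words) (simp_all add: * act_zero algebra_simps act_add)
qed

lemma act_scalar: "act sc op (Poly_Mapping.single [] c * x) v = sc c (act sc op x v)"
  by (simp add: act_mult act_single)

lemma act_closed:
  assumes "x \<in> carrier (free_alg G)" and "v \<in> U" and "0 \<in> U"
    and "\<And>u v. u \<in> U \<Longrightarrow> v \<in> U \<Longrightarrow> u + v \<in> U"
    and "\<And>c v. v \<in> U \<Longrightarrow> sc c v \<in> U"
    and "\<And>g v. g \<in> G \<Longrightarrow> v \<in> U \<Longrightarrow> op g v \<in> U"
  shows "act sc op x v \<in> U"
  using assms(1)
  by (induction x rule: free_alg_induct)
    (simp_all add: assms act_zero act_one act_add act_mult act_single act_var)

end

section \<open>Substitution homomorphisms between free algebras\<close>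

definition subst :: "('g \<Rightarrow> ('h, 'f::field) free) \<Rightarrow> ('g, 'f) free \<Rightarrow> ('h, 'f) free"
  where "subst f x = act (\<lambda>c y. Poly_Mapping.single [] c * y) (\<lambda>g y. f g * y) x 1"

interpretation subst: free_rep "\<lambda>c y. Poly_Mapping.single [] c * y" "\<lambda>g y. f g * y"
  for f :: "'g \<Rightarrow> ('h, 'f::field) free"
proof
  fix g c and v :: "('h, 'f) free"
  show "f g * (Poly_Mapping.single [] c * v) = Poly_Mapping.single [] c * (f g * v)"
    by (metis scalar_commute mult.assoc)
qed (simp_all add: algebra_simps single_add single_Nil_one mult.assoc[symmetric] mult_single plus_list_def)

text \<open>Left multiplications commute with right multiplication by \<open>v\<close>, so the
  action is determined by its value at 1, which is \<open>subst\<close>. Compatibility of the action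
  with products thereby becomes multiplicativity of \<open>subst\<close>.\<close>

lemma act_subst_mult_right:
  "act (\<lambda>c y. Poly_Mapping.single [] c * y) (\<lambda>g y. f g * y) x v = subst f x * v"
proof -
  have "foldr (\<lambda>g y. f g * y) w v = foldr (\<lambda>g y. f g * y) w 1 * v" for w
    by (induction w) (simp_all add: mult.assoc)
  then show ?thesis
    unfolding subst_def act_def by (simp add: sum_distrib_right mult.assoc)
qed

lemma subst_simps [simp]:
  "subst f 0 = 0" "subst f 1 = 1" "subst f (x + y) = subst f x + subst f y"
  "subst f (- x) = - subst f x" "subst f (x - y) = subst f x - subst f y"
  "subst f (var g) = f g" "subst f (sum h A) = (\<Sum>i\<in>A. subst f (h i))"
  "subst f (Poly_Mapping.single [] c) = Poly_Mapping.single [] c"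
  by (simp_all add: subst_def subst.act_zero subst.act_one subst.act_add subst.act_uminus
      subst.act_diff subst.act_var subst.act_sum subst.act_single)

lemma subst_mult [simp]: "subst f (x * y) = subst f x * subst f y"
  unfolding act_subst_mult_right[symmetric] by (simp add: subst_def subst.act_mult)

lemma subst_power [simp]: "subst f (x ^ m) = subst f x ^ m"
  by (induction m) simp_all

lemma subst_two [simp]: "subst f 2 = 2"
  using subst_simps(3)[of f 1 1] by simp

lemma subst_closed:
  assumes "x \<in> carrier (free_alg G)" and "\<And>g. g \<in> G \<Longrightarrow> f g \<in> carrier (free_alg H)"
  shows "subst f x \<in> carrier (free_alg H)"
  using assms(1) by (induction x rule: free_alg_induct) (simp_all add: free_alg_closed assms(2))

lemma rename_eq_subst:
  fixes f :: "'a \<Rightarrow> 'b"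
  shows "rename f = (subst (\<lambda>g. var (f g)) :: ('a, 'c::field) free \<Rightarrow> ('b, 'c) free)"
proof
  fix x :: "('a, 'c) free"
  have "foldr (\<lambda>g y. var (f g) * y) w 1 = (Poly_Mapping.single (map f w) 1 :: ('b, 'c) free)" for w
    by (induction w) (simp_all add: single_Nil_one var_def mult_single plus_list_def)
  then show "rename f x = subst (\<lambda>g. var (f g)) x"
    by (simp add: rename_def subst_def act_def mult_single plus_list_def)
qed

section \<open>Algebras, quotients and fixed points\<close>

text \<open>The last axiom reduces scalars to left multiplication by multiples of 1. Every two-sided
  ideal is therefore stable under scalars, and quotients inherit them.\<close>

locale scalar_ring = ring A for A :: "('f, 'a, 'm) module_scheme" (structure) +
  assumes smult_closed: "x \<in> carrier A \<Longrightarrow> c \<odot> x \<in> carrier A"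
    and smult_eq: "x \<in> carrier A \<Longrightarrow> c \<odot> x = (c \<odot> \<one>) \<otimes> x"

definition alg_hom :: "('f, 'a, 'm) module_scheme \<Rightarrow> ('f, 'b, 'n) module_scheme \<Rightarrow> ('a \<Rightarrow> 'b) set"
  where "alg_hom A B = {h \<in> ring_hom A B. \<forall>c. \<forall>x\<in>carrier A. h (c \<odot>\<^bsub>A\<^esub> x) = c \<odot>\<^bsub>B\<^esub> h x}"

lemma alg_iso_iff: "h \<in> alg_iso A B \<longleftrightarrow> h \<in> alg_hom A B \<and> bij_betw h (carrier A) (carrier B)"
  by (auto simp: alg_iso_def alg_hom_def ring_iso_def)

lemma alg_homE:
  assumes "h \<in> alg_hom A B"
  shows "x \<in> carrier A \<Longrightarrow> h x \<in> carrier B"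
    and "x \<in> carrier A \<Longrightarrow> y \<in> carrier A \<Longrightarrow> h (x \<otimes>\<^bsub>A\<^esub> y) = h x \<otimes>\<^bsub>B\<^esub> h y"
    and "x \<in> carrier A \<Longrightarrow> y \<in> carrier A \<Longrightarrow> h (x \<oplus>\<^bsub>A\<^esub> y) = h x \<oplus>\<^bsub>B\<^esub> h y"
    and "h \<one>\<^bsub>A\<^esub> = \<one>\<^bsub>B\<^esub>"
    and "x \<in> carrier A \<Longrightarrow> h (c \<odot>\<^bsub>A\<^esub> x) = c \<odot>\<^bsub>B\<^esub> h x"
    and "h \<in> ring_hom A B"
  using assms by (auto simp: alg_hom_def ring_hom_def)

lemma alg_homI:
  assumes "\<And>x. x \<in> carrier A \<Longrightarrow> h x \<in> carrier B"
    and "\<And>x y. x \<in> carrier A \<Longrightarrow> y \<in> carrier A \<Longrightarrow> h (x \<otimes>\<^bsub>A\<^esub> y) = h x \<otimes>\<^bsub>B\<^esub> h y"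
    and "\<And>x y. x \<in> carrier A \<Longrightarrow> y \<in> carrier A \<Longrightarrow> h (x \<oplus>\<^bsub>A\<^esub> y) = h x \<oplus>\<^bsub>B\<^esub> h y"
    and "h \<one>\<^bsub>A\<^esub> = \<one>\<^bsub>B\<^esub>"
    and "\<And>c x. x \<in> carrier A \<Longrightarrow> h (c \<odot>\<^bsub>A\<^esub> x) = c \<odot>\<^bsub>B\<^esub> h x"
  shows "h \<in> alg_hom A B"
  using assms by (auto simp: alg_hom_def intro: ring_hom_memI)

lemma alg_hom_trans: "f \<in> alg_hom A B \<Longrightarrow> g \<in> alg_hom B C \<Longrightarrow> g \<circ> f \<in> alg_hom A C"
  by (intro alg_homI) (simp_all add: alg_homE)

lemma alg_iso_trans: "f \<in> alg_iso A B \<Longrightarrow> g \<in> alg_iso B C \<Longrightarrow> g \<circ> f \<in> alg_iso A C"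
  by (auto simp: alg_iso_iff intro: alg_hom_trans bij_betw_trans)

lemma (in scalar_ring) alg_iso_sym:
  assumes "h \<in> alg_iso A B"
  shows "inv_into (carrier A) h \<in> alg_iso B A"
proof -
  have hom: "h \<in> alg_hom A B" and bij: "bij_betw h (carrier A) (carrier B)"
    using assms by (simp_all add: alg_iso_iff)
  let ?g = "inv_into (carrier A) h"
  have iso: "?g \<in> ring_iso B A"
    using ring_iso_set_sym[OF ring_axioms, of h B] assms by (auto simp: alg_iso_def)
  have "?g (c \<odot>\<^bsub>B\<^esub> y) = c \<odot>\<^bsub>A\<^esub> ?g y" if y: "y \<in> carrier B" for c y
  proof -
    have "h (?g y) = y"
      using bij y by (rule bij_betw_inv_into_right)
    moreover have "?g y \<in> carrier A"
      using bij y by (simp add: bij_betw_imp_surj_on inv_into_into)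
    ultimately show ?thesis
      using bij by (metis alg_homE(5)[OF hom] bij_betw_inv_into_left smult_closed)
  qed
  then show ?thesis
    using iso by (simp add: alg_iso_def)
qed

context scalar_ring
begin

lemma smult_diff:
  assumes "x \<in> carrier A" and "y \<in> carrier A"
  shows "c \<odot> x \<ominus> c \<odot> y = (c \<odot> \<one>) \<otimes> (x \<ominus> y)"
  using assms smult_eq[of x c] smult_eq[of y c] smult_closed[OF one_closed, of c]
  by (simp add: a_minus_def r_distr r_minus)

lemma quot_alg_hom:
  assumes "ideal I A"
  shows "(+>) I \<in> alg_hom A (quot_alg A I)"
proof -
  interpret ideal I A by fact
  have "(+>) I \<in> ring_hom A (A Quot I)"
    by (rule rcos_ring_hom)
  \<comment> \<open>\<open>quot_alg\<close> defines scalar multiplication as a union over all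
    representatives of a coset; all of them have to give the same coset.\<close>
  moreover have "I +> (c \<odot> x) = (\<Union>y\<in>I +> x. I +> (c \<odot> y))" if x: "x \<in> carrier A" for c x
  proof -
    have "I +> (c \<odot> y) = I +> (c \<odot> x)" if y: "y \<in> I +> x" for y
    proof -
      have yc: "y \<in> carrier A" using y x a_r_coset_subset_G[OF a_subset] by blast
      have "y \<ominus> x \<in> I"
        using y yc x by (simp add: a_rcos_module_minus[OF ring_axioms])
      then have "c \<odot> y \<ominus> c \<odot> x \<in> I"
        using x yc by (simp add: smult_diff I_l_closed smult_closed)
      then show ?thesis
        using quotient_eq_iff_same_a_r_cos[OF is_ideal smult_closed[OF yc] smult_closed[OF x]] by blast
    qed
    then show ?thesis
      using a_rcos_self[OF x] by blast
  qed
  ultimately show ?thesis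
    by (simp add: alg_hom_def quot_alg_def ring_hom_def)
qed

lemma carrier_quot_alg: "carrier (quot_alg A I) = (+>) I ` carrier A"
  by (auto simp: quot_alg_def FactRing_simps)

lemma scalar_ring_quot:
  assumes "ideal I A"
  shows "scalar_ring (quot_alg A I)"
proof -
  interpret ideal I A by fact
  note hom = quot_alg_hom[OF assms]
  have "ring (quot_alg A I\<lparr>carrier := (+>) I ` carrier A, zero := I +> \<zero>\<rparr>)"
    by (rule ring_hom_imp_img_ring[OF alg_homE(6)[OF hom]])
  \<comment> \<open>The image ring has the coset of 0 as its zero, the quotient has \<open>I\<close>
    itself; identifying the two makes the records equal.\<close>
  moreover have "I +> \<zero> = I"
    by (simp add: a_subset)
  then have "quot_alg A I\<lparr>carrier := (+>) I ` carrier A, zero := I +> \<zero>\<rparr> = quot_alg A I"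
    unfolding carrier_quot_alg[symmetric] by (simp add: quot_alg_def FactRing_def)
  ultimately have "ring (quot_alg A I)"
    by simp
  moreover have "scalar_ring_axioms (quot_alg A I)"
  proof
    fix c X assume "X \<in> carrier (quot_alg A I)"
    then obtain x where x: "x \<in> carrier A" and X: "X = I +> x"
      by (auto simp: carrier_quot_alg)
    show "c \<odot>\<^bsub>quot_alg A I\<^esub> X \<in> carrier (quot_alg A I)"
      using x by (auto simp: X alg_homE(5)[OF hom, symmetric] carrier_quot_alg smult_closed)
    show "c \<odot>\<^bsub>quot_alg A I\<^esub> X = (c \<odot>\<^bsub>quot_alg A I\<^esub> \<one>\<^bsub>quot_alg A I\<^esub>) \<otimes>\<^bsub>quot_alg A I\<^esub> X"
      using x smult_eq[OF x]
      by (simp add: X alg_homE(5)[OF hom, symmetric] alg_homE(4)[OF hom, symmetric]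
          alg_homE(2)[OF hom, symmetric] smult_closed)
  qed
  ultimately show ?thesis
    by (rule scalar_ring.intro)
qed

lemma quot_alg_eq_iff:
  assumes "ideal I A" "x \<in> carrier A" "y \<in> carrier A"
  shows "I +> x = I +> y \<longleftrightarrow> x \<ominus> y \<in> I"
  using quotient_eq_iff_same_a_r_cos[OF assms] by simp

text \<open>First isomorphism theorem with the value on every coset, since the images of the
  generators are read off from it at the end.\<close>

lemma first_iso:
  assumes "scalar_ring B" and g: "g \<in> alg_hom A B" and surj: "g ` carrier A = carrier B"
    and I: "ideal I A" and ker: "\<And>x. x \<in> carrier A \<Longrightarrow> g x = \<zero>\<^bsub>B\<^esub> \<longleftrightarrow> x \<in> I"
  shows "\<exists>h\<in>alg_iso (quot_alg A I) B. \<forall>x\<in>carrier A. h (I +> x) = g x"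
proof -
  interpret B: scalar_ring B by fact
  interpret hom: ring_hom_ring A B g
    using alg_homE(6)[OF g] by (rule ring_hom_ringI2[OF ring_axioms B.ring_axioms])
  note q = quot_alg_hom[OF I]
  have eq: "I +> x = I +> y \<longleftrightarrow> g x = g y" if "x \<in> carrier A" "y \<in> carrier A" for x y
    using that ker[of "x \<ominus> y"] by (simp add: quot_alg_eq_iff[OF I] a_minus_def)
      (metis B.minus_equality B.minus_minus B.r_neg hom.hom_closed B.add.inv_closed B.a_comm)
  define h where "h C = g (SOME x. x \<in> carrier A \<and> C = I +> x)" for C
  have h: "h (I +> x) = g x" if x: "x \<in> carrier A" for x
  proof -
    let ?y = "SOME y. y \<in> carrier A \<and> I +> x = I +> y"
    have "?y \<in> carrier A \<and> I +> x = I +> ?y"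
      by (rule someI[of _ x]) (simp add: x)
    then show ?thesis
      using x eq[of x ?y] by (simp add: h_def)
  qed
  have "h \<in> alg_hom (quot_alg A I) B"
  proof (intro alg_homI)
    show "h \<one>\<^bsub>quot_alg A I\<^esub> = \<one>\<^bsub>B\<^esub>"
      using h[OF one_closed] by (simp add: alg_homE(4)[OF q, symmetric])
  qed (auto simp: carrier_quot_alg h alg_homE(2,3,5)[OF q, symmetric] alg_homE(5)[OF g] smult_closed)
  moreover have "bij_betw h (carrier (quot_alg A I)) (carrier B)"
    unfolding carrier_quot_alg surj[symmetric]
    by (auto simp: bij_betw_def inj_on_def h eq image_image intro: rev_image_eqI)
  ultimately show ?thesis
    using h by (intro bexI[of _ h]) (simp_all add: alg_iso_iff)
qed

lemma image_coset:
  assumes "scalar_ring B" and h: "h \<in> alg_hom A B" and I: "ideal I A" and J: "ideal J B"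
    and "h ` I = J" and x: "x \<in> carrier A"
  shows "h ` (I +> x) = J +>\<^bsub>B\<^esub> h x"
proof -
  have "I \<subseteq> carrier A"
    using I by (simp add: additive_subgroup.a_subset ideal.axioms(1))
  then show ?thesis
    using x unfolding \<open>h ` I = J\<close>[symmetric] a_r_coset_def'
    by (auto simp: alg_homE[OF h] subset_iff image_iff)
qed

lemma ideal_preimage:
  assumes "ring B" and "h \<in> ring_hom A B" and "ideal J B"
  shows "ideal {x \<in> carrier A. h x \<in> J} A"
  using ring_hom_ring.ideal_vimage[OF ring_hom_ringI2[OF ring_axioms assms(1,2)] assms(3)] .

end

lemma scalar_ring_fixed:
  assumes "scalar_ring A" and s: "s \<in> alg_hom A A"
  shows "scalar_ring (fixed_subalg A s)"
proof -
  interpret scalar_ring A by fact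
  interpret hom: ring_hom_ring A A s
    using alg_homE(6)[OF s] by (rule ring_hom_ringI2[OF ring_axioms ring_axioms])
  have "ring (fixed_subalg A s)"
  proof (intro ringI abelian_groupI monoidI)
    fix x assume "x \<in> carrier (fixed_subalg A s)"
    then show "\<exists>y\<in>carrier (fixed_subalg A s). y \<oplus>\<^bsub>fixed_subalg A s\<^esub> x = \<zero>\<^bsub>fixed_subalg A s\<^esub>"
      by (intro bexI[of _ "\<ominus>\<^bsub>A\<^esub> x"]) (auto simp: fixed_subalg_def l_neg)
  qed (auto simp: fixed_subalg_def a_ac m_assoc l_distr r_distr)
  moreover have "scalar_ring_axioms (fixed_subalg A s)"
    by standard (auto simp: fixed_subalg_def smult_closed alg_homE(5)[OF s] intro: smult_eq)
  ultimately show ?thesis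
    by (rule scalar_ring.intro)
qed

lemma scalar_ring_prod:
  assumes "\<And>i. i \<in> I \<Longrightarrow> scalar_ring (A i)"
  shows "scalar_ring (prod_alg I A)"
proof -
  have r: "ring (A i)" if "i \<in> I" for i
    using assms[OF that] by (rule scalar_ring.axioms)
  note rules = ring.ring_simprules[OF r]
  have "ring (prod_alg I A)"
  proof (intro ringI abelian_groupI monoidI)
    fix x assume "x \<in> carrier (prod_alg I A)"
    then show "\<exists>y\<in>carrier (prod_alg I A). y \<oplus>\<^bsub>prod_alg I A\<^esub> x = \<zero>\<^bsub>prod_alg I A\<^esub>"
      by (intro bexI[of _ "\<lambda>i\<in>I. \<ominus>\<^bsub>A i\<^esub> x i"])
        (auto simp: prod_alg_def PiE_iff rules intro!: restrict_ext)
  qed (auto simp: prod_alg_def PiE_iff rules monoid.r_one[OF ring.is_monoid[OF r]] fun_eq_iff extensional_def)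
  moreover have "scalar_ring_axioms (prod_alg I A)"
    by standard (auto simp: prod_alg_def PiE_iff fun_eq_iff intro: scalar_ring.smult_closed[OF assms]
        scalar_ring.smult_eq[OF assms])
  ultimately show ?thesis
    by (rule scalar_ring.intro)
qed

lemma scalar_ring_free: "scalar_ring (free_alg G)"
  by (intro scalar_ring.intro scalar_ring_axioms.intro ring_free_alg) (simp_all add: free_alg_closed)

text \<open>Applying \<open>s\<close> to (X - U) \<open>e i\<close> gives (s X - U)
  \<open>e (Suc i)\<close>, and exchanging s X for X changes this by an element of \<open>I\<close>.
  So the identity at \<open>e 0\<close> spreads, modulo \<open>I\<close>, along the whole
  orbit.\<close>

lemma (in ideal) fixed_mod_ideal:
  assumes s: "s \<in> ring_hom R R" and "s ` I \<subseteq> I"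
    and "X \<in> carrier R" and "s X \<ominus> X \<in> I" and "U \<in> carrier R" and "s U = U"
    and e: "\<And>i. e i \<in> carrier R" "\<And>i. s (e i) = e (Suc i)" and "X \<otimes> e 0 = U \<otimes> e 0"
  shows "(X \<ominus> U) \<otimes> e i \<in> I"
proof (induction i)
  case 0
  then show ?case
    using assms by (simp add: a_minus_def l_distr l_minus r_neg zero_closed)
next
  case (Suc i)
  interpret hom: ring_hom_ring R R s
    using s by (rule ring_hom_ringI2[OF ring_axioms ring_axioms])
  have c: "s X \<in> carrier R" using assms by simp
  have "s ((X \<ominus> U) \<otimes> e i) \<in> I"
    using Suc assms(2) by blast
  then have "(s X \<ominus> U) \<otimes> e (Suc i) \<in> I"
    using assms by (simp add: a_minus_def)
  moreover have "(s X \<ominus> X) \<otimes> e (Suc i) \<in> I"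
    using assms by (simp add: I_r_closed)
  ultimately have "(s X \<ominus> U) \<otimes> e (Suc i) \<ominus> (s X \<ominus> X) \<otimes> e (Suc i) \<in> I"
    by (simp add: a_minus_def a_inv_closed)
  moreover have "(s X \<ominus> U) \<otimes> e (Suc i) \<ominus> (s X \<ominus> X) \<otimes> e (Suc i) = (X \<ominus> U) \<otimes> e (Suc i)"
  proof -
    have "(s X \<ominus> U) \<ominus> (s X \<ominus> X) = X \<ominus> U"
      using assms(3,5) c by algebra
    moreover have "(s X \<ominus> U) \<otimes> e (Suc i) \<ominus> (s X \<ominus> X) \<otimes> e (Suc i) 
      = ((s X \<ominus> U) \<ominus> (s X \<ominus> X)) \<otimes> e (Suc i)"
      using assms c e(1)[of "Suc i"] minus_closed by (simp add: a_minus_def l_distr l_minus)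
    ultimately show ?thesis by simp
  qed
  ultimately show ?case by simp
qed

section \<open>Tuples and their orbits\<close>

lemma cyc_orbit_self: "x \<in> cyc_orbit f x"
  unfolding cyc_orbit_def by (auto intro: exI[of _ 0])

lemma cyc_orbit_funpow: "(f ^^ i) x \<in> cyc_orbit f x"
  by (auto simp: cyc_orbit_def)

lemma cyc_orbit_eq:
  assumes "p \<ge> 1" and "(f ^^ p) x = x" and "y \<in> cyc_orbit f x"
  shows "cyc_orbit f y = cyc_orbit f x"
proof -
  obtain i where y: "y = (f ^^ i) x"
    using assms(3) by (auto simp: cyc_orbit_def)
  \<comment> \<open>After the i steps from x to y, another p * i - i steps lead back to x. The
    truncated subtraction is exact because p is positive.\<close>
  have "(f ^^ (p * i)) x = x"
    using funpow_mod_eq[OF assms(2), of "p * i"] by simp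
  moreover have "p * i = (p * i - i) + i"
    using assms(1) by (cases p) auto
  ultimately have x: "x = (f ^^ (p * i - i)) y"
    unfolding y by (metis funpow_add comp_apply)
  show ?thesis
  proof
    show "cyc_orbit f y \<subseteq> cyc_orbit f x"
      unfolding cyc_orbit_def y by (auto simp: funpow_add[symmetric, unfolded comp_def, THEN fun_cong])
    show "cyc_orbit f x \<subseteq> cyc_orbit f y"
      unfolding cyc_orbit_def by (subst x) (auto, metis comp_apply funpow_add)
  qed
qed

lemma finite_cyc_orbit:
  assumes "p \<ge> 1" and "(f ^^ p) x = x"
  shows "finite (cyc_orbit f x)"
proof -
  have "cyc_orbit f x \<subseteq> (\<lambda>i. (f ^^ i) x) ` {..<p}"
    using assms funpow_mod_eq[OF assms(2)]
    by (auto simp: cyc_orbit_def image_iff intro!: bexI[of _ "_ mod p"])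
  then show ?thesis
    by (rule finite_subset) simp
qed

lemma swap_swap [simp]: "swap a (swap a k) = k"
  by (auto simp: swap_def fun_eq_iff)

lemma tuplesD:
  assumes "k \<in> tuples n \<beta>"
  shows "k \<in> extensional {1..n}" and "card {a \<in> {1..n}. k a = j} = \<beta> j"
  using assms by (auto simp: tuples_def PiE_iff)

lemma swap_tuples:
  assumes k: "k \<in> tuples n \<beta>" and a: "a \<in> {1..<n}"
  shows "swap a k \<in> tuples n \<beta>"
proof -
  \<comment> \<open>The transposition of two positions: it permutes the places at which a value
    occurs and so preserves their number.\<close>
  define t where "t b = (if b = a then a + 1 else if b = a + 1 then a else b)" for b
  have t: "t (t b) = b" "swap a k b = k (t b)" for b
    by (simp_all add: t_def swap_def)
  have "t b \<in> {1..n} \<longleftrightarrow> b \<in> {1..n}" for b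
    using a by (auto simp: t_def)
  then have "{b \<in> {1..n}. swap a k b = j} = t ` {b \<in> {1..n}. k b = j}" for j
    using t by (auto simp: image_iff) (metis t(1))
  moreover have "inj t"
    by (metis injI t(1))
  ultimately have "card {b \<in> {1..n}. swap a k b = j} = card {b \<in> {1..n}. k b = j}" for j
    by (simp add: card_image inj_on_subset)
  moreover have "swap a k \<in> extensional {1..n}"
    using tuplesD(1)[OF k] a by (auto simp: swap_def extensional_def)
  ultimately show ?thesis
    using k by (auto simp: tuples_def PiE_iff)
qed

lemma tuples_unique: "k \<in> tuples n \<beta> \<Longrightarrow> k \<in> tuples n \<beta>' \<Longrightarrow> \<beta> = \<beta>'"
  by (auto simp: tuples_def)

lemma finite_tuples:
  assumes "finite {j. \<beta> j \<noteq> 0}"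
  shows "finite (tuples n \<beta>)"
proof (rule finite_subset)
  show "tuples n \<beta> \<subseteq> {1..n} \<rightarrow>\<^sub>E {j. \<beta> j \<noteq> 0}"
  proof
    fix k assume k: "k \<in> tuples n \<beta>"
    have "\<beta> (k a) \<noteq> 0" if "a \<in> {1..n}" for a
    proof -
      have "card {b \<in> {1..n}. k b = k a} \<noteq> 0"
        using that by (auto simp: card_eq_0_iff)
      then show ?thesis using tuplesD(2)[OF k, of "k a"] by metis
    qed
    then show "k \<in> {1..n} \<rightarrow>\<^sub>E {j. \<beta> j \<noteq> 0}"
      using tuplesD(1)[OF k] by (auto simp: PiE_iff)
  qed
qed (use assms in \<open>simp add: finite_PiE\<close>)

lemma tup_act_tuples:
  assumes "bij \<sigma>" and k: "k \<in> tuples n \<beta>"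
  shows "tup_act n \<sigma> k \<in> tuples n (comp_act \<sigma> \<beta>)"
proof -
  have "{a \<in> {1..n}. tup_act n \<sigma> k a = j} = {a \<in> {1..n}. k a = inv_into UNIV \<sigma> j}" for j
    using bij_is_inj[OF assms(1)] bij_is_surj[OF assms(1)]
    by (intro Collect_cong) (metis inv_f_f restrict_apply surj_f_inv_f tup_act_def)
  then show ?thesis
    using k by (auto simp: tuples_def comp_act_def PiE_iff) (auto simp: tup_act_def)
qed

lemma tup_act_funpow:
  "k \<in> extensional {1..n} \<Longrightarrow> (tup_act n \<sigma> ^^ i) k = (\<lambda>a\<in>{1..n}. (\<sigma> ^^ i) (k a))"
  by (induction i) (auto simp: tup_act_def fun_eq_iff extensional_def)

lemma tup_act_swap: "a \<in> {1..<n} \<Longrightarrow> tup_act n \<sigma> (swap a k) = swap a (tup_act n \<sigma> k)"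
  by (auto simp: tup_act_def swap_def fun_eq_iff)

section \<open>Orbits of compositions and tuples under the quiver automorphism\<close>

locale quiver_aut =
  fixes n p :: nat and E :: "('k \<times> 'k) set" and \<sigma> :: "'k \<Rightarrow> 'k" and \<alpha> \<Lambda> :: "'k \<Rightarrow> nat"
  assumes n: "n \<ge> 1" and p: "p \<ge> 1" and bij: "bij \<sigma>"
    and edge: "(k, k') \<in> E \<Longrightarrow> (\<sigma> k, \<sigma> k') \<in> E"
    and order: "(\<sigma> ^^ p) k = k"
    and finite_support: "finite {k. \<alpha> k \<noteq> 0}"
    and Lambda: "\<Lambda> (\<sigma> k) = \<Lambda> k"
begin

abbreviation "Orb \<equiv> comp_orbit \<sigma> \<alpha>"
abbreviation "T \<equiv> orbit_tuples n \<sigma> \<alpha>"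
abbreviation "lab \<equiv> tup_orbit n \<sigma>"
abbreviation "act_tup \<equiv> tup_act n \<sigma>"
abbreviation "inv_tup \<equiv> tup_act n (inv_into UNIV \<sigma>)"
abbreviation "inv_comp \<equiv> comp_act (inv_into UNIV \<sigma>)"

lemma sigma_inv [simp]: "\<sigma> (inv_into UNIV \<sigma> k) = k" "inv_into UNIV \<sigma> (\<sigma> k) = k"
  using bij by (simp_all add: bij_is_inj bij_is_surj surj_f_inv_f)

text \<open>The inverse of \<sigma> is its power with exponent p - 1, hence preserves edges
  too.\<close>

lemma edge_iff: "(\<sigma> k, \<sigma> k') \<in> E \<longleftrightarrow> (k, k') \<in> E"
proof
  have *: "(k, k') \<in> E \<Longrightarrow> ((\<sigma> ^^ i) k, (\<sigma> ^^ i) k') \<in> E" for i k k'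
    by (induction i) (simp_all add: edge)
  assume "(\<sigma> k, \<sigma> k') \<in> E"
  moreover have "(\<sigma> ^^ (p - 1)) (\<sigma> k) = k" for k
    using p order[of k] by (metis Suc_diff_1 Suc_le_eq One_nat_def comp_apply funpow_Suc_right)
  ultimately show "(k, k') \<in> E"
    using *[of "\<sigma> k" "\<sigma> k'" "p - 1"] by simp
qed (rule edge)

lemma edge_inv_iff: "(inv_into UNIV \<sigma> k, inv_into UNIV \<sigma> k') \<in> E \<longleftrightarrow> (k, k') \<in> E"
  using edge_iff[of "inv_into UNIV \<sigma> k" "inv_into UNIV \<sigma> k'"] by simp

lemma comp_act_funpow: "(comp_act \<sigma> ^^ i) \<beta> = \<beta> \<circ> (inv_into UNIV \<sigma> ^^ i)"
  by (induction i) (auto simp: comp_act_def fun_eq_iff funpow_swap1)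

lemma inv_order: "(inv_into UNIV \<sigma> ^^ p) k = k"
proof -
  have "(inv_into UNIV \<sigma> ^^ i) ((\<sigma> ^^ i) k) = k" for i k
    by (induction i arbitrary: k) (simp_all add: funpow_swap1)
  then show ?thesis
    using order by metis
qed

lemma comp_order: "(comp_act \<sigma> ^^ p) \<beta> = \<beta>"
  by (simp add: comp_act_funpow fun_eq_iff inv_order)

lemma comp_inv [simp]: "inv_comp (comp_act \<sigma> \<beta>) = \<beta>" "comp_act \<sigma> (inv_comp \<beta>) = \<beta>"
  using bij by (simp_all add: comp_act_def inv_inv_eq)

lemma comp_act_Orb: "\<beta> \<in> Orb \<Longrightarrow> comp_act \<sigma> \<beta> \<in> Orb"
  using cyc_orbit_funpow[of 1 "comp_act \<sigma>" \<beta>] cyc_orbit_eq[OF p comp_order] by auto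

lemma inv_comp_Orb:
  assumes "\<beta> \<in> Orb"
  shows "inv_comp \<beta> \<in> Orb"
proof -
  have "inv_comp \<beta> = (comp_act \<sigma> ^^ (p - 1)) \<beta>"
  proof -
    have "comp_act \<sigma> ((comp_act \<sigma> ^^ (p - 1)) \<beta>) = \<beta>"
      using p comp_order[of \<beta>] by (metis Suc_diff_1 Suc_le_eq One_nat_def comp_apply funpow.simps(2))
    then show ?thesis by (metis comp_inv(1))
  qed
  then show ?thesis
    using cyc_orbit_funpow[of "p - 1" "comp_act \<sigma>" \<beta>] cyc_orbit_eq[OF p comp_order assms] by simp
qed

lemma finite_Orb: "finite Orb"
  by (rule finite_cyc_orbit[OF p comp_order])

lemma finite_tuples_Orb:
  assumes "\<beta> \<in> Orb"
  shows "finite (tuples n \<beta>)"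
proof -
  obtain i where "\<beta> = \<alpha> \<circ> (inv_into UNIV \<sigma> ^^ i)"
    using assms by (auto simp: cyc_orbit_def comp_act_funpow)
  moreover have "inj (inv_into UNIV \<sigma> ^^ i)"
    using bij by (intro inj_fn) (simp add: bij_imp_bij_inv bij_is_inj)
  ultimately have "finite {j. \<beta> j \<noteq> 0}"
    using finite_vimageI[OF finite_support] by (simp add: vimage_def)
  then show ?thesis by (rule finite_tuples)
qed

lemma finite_T: "finite T"
  unfolding orbit_tuples_def using finite_Orb finite_tuples_Orb by blast

lemma T_I: "\<beta> \<in> Orb \<Longrightarrow> k \<in> tuples n \<beta> \<Longrightarrow> k \<in> T"
  by (auto simp: orbit_tuples_def)

lemma T_ext: "k \<in> T \<Longrightarrow> k \<in> extensional {1..n}"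
  using tuplesD(1) by (fastforce simp: orbit_tuples_def)

lemma swap_T: "k \<in> T \<Longrightarrow> a \<in> {1..<n} \<Longrightarrow> swap a k \<in> T"
  using swap_tuples by (fastforce simp: orbit_tuples_def)

lemma act_T: "k \<in> T \<Longrightarrow> act_tup k \<in> T"
  using tup_act_tuples[OF bij] comp_act_Orb by (fastforce simp: orbit_tuples_def)

lemma lab_order: "k \<in> T \<Longrightarrow> (act_tup ^^ p) k = k"
  by (auto simp: tup_act_funpow[OF T_ext] order fun_eq_iff dest!: T_ext) (auto simp: extensional_def)

lemma lab_self: "k \<in> lab k"
  by (rule cyc_orbit_self)

lemma lab_eq_iff: "k \<in> T \<Longrightarrow> l \<in> lab k \<longleftrightarrow> lab l = lab k"
  using cyc_orbit_eq[OF p lab_order] lab_self by blast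

lemma lab_T: "k \<in> T \<Longrightarrow> lab k \<subseteq> T"
proof -
  assume k: "k \<in> T"
  have "(act_tup ^^ i) k \<in> T" for i
    by (induction i) (simp_all add: k act_T)
  then show ?thesis by (auto simp: cyc_orbit_def)
qed

lemma lab_disjoint:
  assumes "\<gamma> \<in> lab ` T" and "\<gamma>' \<in> lab ` T" and "\<gamma> \<noteq> \<gamma>'"
  shows "\<gamma> \<inter> \<gamma>' = {}"
proof -
  obtain k k' where "k \<in> T" "\<gamma> = lab k" "k' \<in> T" "\<gamma>' = lab k'"
    using assms(1,2) by blast
  then show ?thesis
    using assms(3) lab_eq_iff[of k] lab_eq_iff[of k'] by blast
qed

lemma lab_swap_mem:
  assumes a: "a \<in> {1..<n}" and "l \<in> lab k"
  shows "swap a l \<in> lab (swap a k)"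
proof -
  have "swap a ((act_tup ^^ i) k) = (act_tup ^^ i) (swap a k)" for i
    by (induction i) (simp_all add: tup_act_swap[OF a, symmetric])
  then show ?thesis
    using assms(2) by (auto simp: cyc_orbit_def)
qed

lemma finite_lab: "k \<in> T \<Longrightarrow> finite (lab k)"
  using finite_subset[OF lab_T finite_T] .

text \<open>This makes the conditions, coefficients and exponents attached to an orbit independent
  of the representative.\<close>

lemma lab_invariant:
  assumes "l \<in> lab k" and "\<And>k. P (act_tup k) = P k"
  shows "P l = P k"
proof -
  have "P ((act_tup ^^ i) k) = P k" for i
    by (induction i) (simp_all add: assms(2))
  then show ?thesis using assms(1) by (auto simp: cyc_orbit_def)
qed

lemma sigma_eq_iff: "\<sigma> k = \<sigma> k' \<longleftrightarrow> k = k'"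
  by (metis sigma_inv(2))

lemma link_act:
  assumes "a \<in> {1..n}" "b \<in> {1..n}"
  shows "act_tup k a = act_tup k b \<longleftrightarrow> k a = k b"
    "unlinked E (act_tup k a) (act_tup k b) = unlinked E (k a) (k b)"
    "arrow E (act_tup k a) (act_tup k b) = arrow E (k a) (k b)"
    "biarrow E (act_tup k a) (act_tup k b) = biarrow E (k a) (k b)"
  using assms by (simp_all add: tup_act_def sigma_eq_iff unlinked_def arrow_def biarrow_def edge_iff)

lemma sq_factor_act: "a \<in> {1..<n} \<Longrightarrow> sq_factor E (act_tup k) a = sq_factor E k a"
  by (simp add: sq_factor_def link_act)

lemma braid_term_act: "1 \<le> a \<Longrightarrow> a + 1 < n \<Longrightarrow> braid_term E (act_tup k) a = braid_term E k a"
  by (simp add: braid_term_def link_act)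

lemma Lambda_act: "\<Lambda> (act_tup k 1) = \<Lambda> (k 1)"
  using n by (simp add: tup_act_def Lambda)

lemma sq_factor_lab: "a \<in> {1..<n} \<Longrightarrow> l \<in> lab k \<Longrightarrow> sq_factor E l a = sq_factor E k a"
  by (rule lab_invariant[where P = "\<lambda>k. sq_factor E k a"]) (simp_all add: sq_factor_act)

lemma braid_term_lab: "1 \<le> a \<Longrightarrow> a + 1 < n \<Longrightarrow> l \<in> lab k \<Longrightarrow> braid_term E l a = braid_term E k a"
  by (rule lab_invariant[where P = "\<lambda>k. braid_term E k a"]) (simp_all add: braid_term_act)

lemma Lambda_lab: "l \<in> lab k \<Longrightarrow> \<Lambda> (l 1) = \<Lambda> (k 1)"
  by (rule lab_invariant[where P = "\<lambda>k. \<Lambda> (k 1)"]) (simp_all only: Lambda_act)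

lemma eq_Suc_lab: "a \<in> {1..<n} \<Longrightarrow> l \<in> lab k \<Longrightarrow> l a = l (a + 1) \<longleftrightarrow> k a = k (a + 1)"
  by (rule lab_invariant[where P = "\<lambda>k. k a = k (a + 1)"]) (simp_all add: link_act)

end

section \<open>Relations in the components\<close>

text \<open>Membership of a difference serves as congruence modulo \<open>I\<close>, so that
  computations take place with elements of the free algebra instead of cosets.\<close>

locale free_ideal = ideal I "free_alg H" for I :: "('h, 'f::field) free set" and H :: "'h set"
begin

lemma mem_carrier: "x \<in> I \<Longrightarrow> x \<in> carrier (free_alg H)"
  by (rule a_Hcarr)

lemma mem_zero: "0 \<in> I"
  using additive_subgroup.zero_closed[OF is_additive_subgroup] by simp

lemma mem_add: "x \<in> I \<Longrightarrow> y \<in> I \<Longrightarrow> x + y \<in> I"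
  using additive_subgroup.a_closed[OF is_additive_subgroup] by simp

lemma mem_left: "x \<in> I \<Longrightarrow> a \<in> carrier (free_alg H) \<Longrightarrow> a * x \<in> I"
  using I_l_closed by simp

lemma mem_right: "x \<in> I \<Longrightarrow> a \<in> carrier (free_alg H) \<Longrightarrow> x * a \<in> I"
  using I_r_closed by simp

lemma mem_uminus: "x \<in> I \<Longrightarrow> - x \<in> I"
  using mem_left[of x "- 1"] by (simp add: free_alg_closed)

lemma mem_diff: "x \<in> I \<Longrightarrow> y \<in> I \<Longrightarrow> x - y \<in> I"
  using mem_add[of x "- y"] mem_uminus by simp

lemma mem_sum: "(\<And>i. i \<in> A \<Longrightarrow> f i \<in> I) \<Longrightarrow> sum f A \<in> I"
  by (induction A rule: infinite_finite_induct) (simp_all add: mem_zero mem_add)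

lemma mem_trans: "x - y \<in> I \<Longrightarrow> y - z \<in> I \<Longrightarrow> x - z \<in> I"
  using mem_add[of "x - y" "y - z"] by simp

lemma mem_left_diff: "x - y \<in> I \<Longrightarrow> a \<in> carrier (free_alg H) \<Longrightarrow> a * x - a * y \<in> I"
  using mem_left[of "x - y" a] by (simp add: algebra_simps)

lemma mem_right_diff: "x - y \<in> I \<Longrightarrow> a \<in> carrier (free_alg H) \<Longrightarrow> x * a - y * a \<in> I"
  using mem_right[of "x - y" a] by (simp add: algebra_simps)

lemma mem_sum_diff: "(\<And>i. i \<in> A \<Longrightarrow> f i - g i \<in> I) \<Longrightarrow> sum f A - sum g A \<in> I"
  using mem_sum[of A "\<lambda>i. f i - g i"] by (simp add: sum_subtractf)

end

lemma free_idealI: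
  fixes I :: "('h, 'f::field) free set"
  assumes "I \<subseteq> carrier (free_alg H)" and "0 \<in> I"
    and "\<And>x y. x \<in> I \<Longrightarrow> y \<in> I \<Longrightarrow> x + y \<in> I"
    and l: "\<And>a x. x \<in> I \<Longrightarrow> a \<in> carrier (free_alg H) \<Longrightarrow> a * x \<in> I"
    and "\<And>a x. x \<in> I \<Longrightarrow> a \<in> carrier (free_alg H) \<Longrightarrow> x * a \<in> I"
  shows "free_ideal I H"
  unfolding free_ideal_def
proof (rule idealI[OF ring_free_alg])
  interpret ring "free_alg H" by (rule ring_free_alg)
  have "\<ominus>\<^bsub>free_alg H\<^esub> x \<in> I" if "x \<in> I" for x
    using that assms(1) l[of x "- 1"] minus_equality[of "- x" x] by (auto simp: free_alg_closed)
  then show "subgroup I (add_monoid (free_alg H))"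
    using assms by (intro add.subgroupI) (auto simp: a_inv_def)
qed (use assms in auto)

definition rels_closed :: "'g set \<Rightarrow> (('g, 'f::field) free \<times> ('g, 'f) free) set \<Rightarrow> bool"
  where "rels_closed G S \<longleftrightarrow> S \<subseteq> carrier (free_alg G) \<times> carrier (free_alg G)"

lemma pres_ideal:
  assumes "rels_closed G S"
  shows "free_ideal (pres_ideal G S) G" and "(l, r) \<in> S \<Longrightarrow> l - r \<in> pres_ideal G S"
proof -
  have sub: "(\<lambda>(l, r). l - r) ` S \<subseteq> carrier (free_alg G)"
    using assms by (auto simp: rels_closed_def free_alg_diff)
  interpret ring "free_alg G" by (rule ring_free_alg)
  show "free_ideal (pres_ideal G S) G"
    unfolding pres_ideal_def free_ideal_def by (rule genideal_ideal[OF sub])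
  show "(l, r) \<in> S \<Longrightarrow> l - r \<in> pres_ideal G S"
    unfolding pres_ideal_def using genideal_self[OF sub] by force
qed

lemma pres_ideal_minimal:
  assumes "ideal J (free_alg G)" and "\<And>l r. (l, r) \<in> S \<Longrightarrow> l - r \<in> J"
  shows "pres_ideal G S \<subseteq> J"
  unfolding pres_ideal_def using assms by (intro ring.genideal_minimal[OF ring_free_alg]) auto

lemma klr_gens_carrier:
  "i \<in> J \<Longrightarrow> ge i \<in> carrier (free_alg (klr_gens n J))"
  "a \<in> {1..n} \<Longrightarrow> gy a \<in> carrier (free_alg (klr_gens n J))"
  "a \<in> {1..<n} \<Longrightarrow> gpsi a \<in> carrier (free_alg (klr_gens n J))"
  by (simp_all add: klr_gens_def free_alg_var)

lemma sq_factor_carrier: "a \<in> {1..<n} \<Longrightarrow> sq_factor E k a \<in> carrier (free_alg (klr_gens n J))"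
  by (simp add: sq_factor_def free_alg_closed klr_gens_carrier)

lemma braid_term_carrier:
  "1 \<le> a \<Longrightarrow> a + 1 < n \<Longrightarrow> braid_term E k a \<in> carrier (free_alg (klr_gens n J))"
  by (simp add: braid_term_def free_alg_closed klr_gens_carrier)

lemma rels_closed_klr:
  assumes "\<And>k a. k \<in> T \<Longrightarrow> a \<in> {1..<n} \<Longrightarrow> swap a k \<in> T"
  shows "rels_closed (klr_gens n (lab ` T)) (klr_rels n E T lab :: (('i gen, 'f::field) free \<times> _) set)"
proof -
  have "l \<in> carrier (free_alg (klr_gens n (lab ` T))) \<and> r \<in> carrier (free_alg (klr_gens n (lab ` T)))"
    if "(l, r) \<in> klr_rels n E T lab" for l r :: "('i gen, 'f) free"
    using that
    by cases (auto intro!: free_alg_closed klr_gens_carrier sq_factor_carrier braid_term_carrier assms)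
  then show ?thesis
    by (auto simp: rels_closed_def)
qed

lemma subst_sq_factor:
  "(\<And>b. f (Y_gen b) = gy b) \<Longrightarrow> subst f (sq_factor E k a) = sq_factor E k a"
  by (simp add: sq_factor_def)

lemma subst_braid_term:
  "(\<And>b. f (Y_gen b) = gy b) \<Longrightarrow> subst f (braid_term E k a) = braid_term E k a"
  by (simp add: braid_term_def)

lemma rels_closed_comp: "rels_closed (comp_gens n \<beta>) (comp_rels n E \<beta>)"
  using rels_closed_klr[of "tuples n \<beta>" n "\<lambda>k. k"] swap_tuples by fastforce

abbreviation (in quiver_aut) comp_ideal :: "('k \<Rightarrow> nat) \<Rightarrow> ((nat \<Rightarrow> 'k) gen, 'f::field) free set"
  where "comp_ideal \<beta> \<equiv> pres_ideal (comp_gens n \<beta>) (comp_rels n E \<beta>)"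

lemma (in quiver_aut) comp_ideal: "free_ideal (comp_ideal \<beta>) (comp_gens n \<beta>)"
  by (rule pres_ideal[OF rels_closed_comp])

lemma (in quiver_aut) comp_rel: "(l, r) \<in> comp_rels n E \<beta> \<Longrightarrow> l - r \<in> comp_ideal \<beta>"
  by (rule pres_ideal[OF rels_closed_comp])

section \<open>Renaming idempotents along the automorphism\<close>

context quiver_aut
begin

text \<open>Applying results about \<sigma> to its inverse turns the inclusion between the relation
  ideals of two components into an equality.\<close>

lemma inverse: "quiver_aut n p E (inv_into UNIV \<sigma>) \<alpha> \<Lambda>"
proof
  show "\<Lambda> (inv_into UNIV \<sigma> k) = \<Lambda> k" for k
    using Lambda[of "inv_into UNIV \<sigma> k"] by simp
qed (use n p bij edge_inv_iff inv_order finite_support in \<open>auto simp: bij_imp_bij_inv\<close>)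

lemma inv_tup_act: "k \<in> extensional {1..n} \<Longrightarrow> inv_tup (act_tup k) = k"
  by (auto simp: tup_act_def fun_eq_iff extensional_def)

lemma act_inv_tup: "k \<in> extensional {1..n} \<Longrightarrow> act_tup (inv_tup k) = k"
  by (auto simp: tup_act_def fun_eq_iff extensional_def)

lemma act_tup_image: "act_tup ` tuples n \<beta> = tuples n (comp_act \<sigma> \<beta>)"
proof
  show "tuples n (comp_act \<sigma> \<beta>) \<subseteq> act_tup ` tuples n \<beta>"
  proof
    fix k assume k: "k \<in> tuples n (comp_act \<sigma> \<beta>)"
    then have "inv_tup k \<in> tuples n \<beta>"
      using tup_act_tuples[of "inv_into UNIV \<sigma>" k n "comp_act \<sigma> \<beta>"] bij by (simp add: bij_imp_bij_inv)
    then show "k \<in> act_tup ` tuples n \<beta>"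
      using act_inv_tup[OF tuplesD(1)[OF k]] by (metis image_eqI)
  qed
qed (use tup_act_tuples[OF bij] in auto)

lemma inj_on_act_tup: "inj_on act_tup (tuples n \<beta>)"
  by (rule inj_on_inverseI[of _ inv_tup]) (erule inv_tup_act[OF tuplesD(1)])

text \<open>The relation at k goes to the relation of the same kind at \<sigma>(k), since \<sigma>
  commutes with place permutations and preserves equality of entries and the edges between
  them.\<close>

lemma rename_rel:
  fixes l r :: "((nat \<Rightarrow> 'k) gen, 'f::field) free"
  assumes "(l, r) \<in> comp_rels n E \<beta>"
  shows "(rename (map_gen act_tup) l, rename (map_gen act_tup) r) \<in> comp_rels n E (comp_act \<sigma> \<beta>)"
proof -
  let ?f = "\<lambda>g. var (map_gen act_tup g) :: ((nat \<Rightarrow> 'k) gen, 'f) free"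
  let ?R = "comp_rels n E (comp_act \<sigma> \<beta>) :: (((nat \<Rightarrow> 'k) gen, 'f) free \<times> _) set"
  note act = tup_act_tuples[OF bij]
  have sq: "subst ?f (sq_factor E k a) = sq_factor E (act_tup k) a" if "a \<in> {1..<n}" for k a
    using that by (simp add: sq_factor_act subst_sq_factor)
  have br: "subst ?f (braid_term E k a) = braid_term E (act_tup k) a" if "1 \<le> a" "a + 1 < n" for k a
    using that by (simp add: braid_term_act subst_braid_term)
  have "(subst ?f l, subst ?f r) \<in> ?R"
    using assms
  proof cases
    case idem_sum
    have "(\<Sum>k\<in>tuples n \<beta>. ge (act_tup k)) = (\<Sum>k\<in>tuples n (comp_act \<sigma> \<beta>). ge k :: ((nat \<Rightarrow> 'k) gen, 'f) free)"
      by (simp add: act_tup_image[symmetric] sum.reindex[OF inj_on_act_tup])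
    then show ?thesis
      using klr_rels.idem_sum[of "\<lambda>k. k" "tuples n (comp_act \<sigma> \<beta>)" n E] idem_sum by simp
  next
    case (idem_mult k k')
    then show ?thesis
      using klr_rels.idem_mult[of "act_tup k" "tuples n (comp_act \<sigma> \<beta>)" "act_tup k'" "\<lambda>k. k" n E]
        inj_on_eq_iff[OF inj_on_act_tup[of \<beta>]] by (cases "k = k'") (simp_all add: act)
  next
    case (y_idem k a)
    then show ?thesis
      using klr_rels.y_idem[OF act[OF y_idem(3)], of a n "\<lambda>k. k" E] by simp
  next
    case (psi_idem k a)
    then show ?thesis
      using klr_rels.psi_idem[OF act[OF psi_idem(3)], of a n "\<lambda>k. k" E] by (simp add: tup_act_swap)
  next
    case (psi_y_Suc k a)
    then show ?thesis
      using klr_rels.psi_y_Suc[OF act[OF psi_y_Suc(3)], of a n "\<lambda>k. k" E]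
      by (cases "k a = k (a + 1)") (simp_all add: link_act)
  next
    case (y_Suc_psi k a)
    then show ?thesis
      using klr_rels.y_Suc_psi[OF act[OF y_Suc_psi(3)], of a n "\<lambda>k. k" E]
      by (cases "k a = k (a + 1)") (simp_all add: link_act)
  next
    case (psi_sq k a)
    then show ?thesis
      using klr_rels.psi_sq[OF act[OF psi_sq(3)], of a n "\<lambda>k. k" E] by (simp add: sq)
  next
    case (braid k a)
    then show ?thesis
      using klr_rels.braid[OF act[OF braid(3)], of a n "\<lambda>k. k" E] by (simp add: br)
  qed (auto intro: klr_rels.y_y klr_rels.psi_y klr_rels.psi_psi)
  then show ?thesis by (simp add: rename_eq_subst)
qed

lemma rename_closed:
  "x \<in> carrier (free_alg (comp_gens n \<beta>)) \<Longrightarrow>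
    rename (map_gen act_tup) x \<in> carrier (free_alg (comp_gens n (comp_act \<sigma> \<beta>)))"
  unfolding rename_eq_subst
  by (erule subst_closed) (auto simp: klr_gens_def intro!: free_alg_var tup_act_tuples[OF bij])

lemma rename_ideal: "rename (map_gen act_tup) ` comp_ideal \<beta> \<subseteq> comp_ideal (comp_act \<sigma> \<beta>)"
proof -
  interpret J: free_ideal "comp_ideal (comp_act \<sigma> \<beta>)" "comp_gens n (comp_act \<sigma> \<beta>)"
    by (rule comp_ideal)
  let ?J = "{x \<in> carrier (free_alg (comp_gens n \<beta>)). rename (map_gen act_tup) x \<in> comp_ideal (comp_act \<sigma> \<beta>)}"
  have "comp_ideal \<beta> \<subseteq> ?J"
  proof (rule pres_ideal_minimal)
    show "ideal ?J (free_alg (comp_gens n \<beta>))"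
      unfolding free_ideal_def[symmetric]
      by (rule free_idealI)
        (auto simp: free_alg_closed J.mem_zero J.mem_add J.mem_left J.mem_right rename_closed
          rename_eq_subst rename_closed[unfolded rename_eq_subst])
    fix l r :: "((nat \<Rightarrow> 'k) gen, 'c) free"
    assume lr: "(l, r) \<in> comp_rels n E \<beta>"
    then have "l - r \<in> carrier (free_alg (comp_gens n \<beta>))"
      using rels_closed_comp by (force simp: rels_closed_def free_alg_diff)
    then show "l - r \<in> ?J"
      using comp_rel[OF rename_rel[OF lr]] by (simp add: rename_eq_subst)
  qed
  then show ?thesis by auto
qed

lemma rename_inverse:
  assumes "x \<in> carrier (free_alg (comp_gens n \<beta>))"
  shows "rename (map_gen inv_tup) (rename (map_gen act_tup) x) = x"
  using assms unfolding rename_eq_subst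
proof (induction x rule: free_alg_induct)
  case (var g x)
  then show ?case
    by (auto simp: klr_gens_def inv_tup_act[OF tuplesD(1)])
qed simp_all

lemma rename_ideal_eq: "rename (map_gen act_tup) ` comp_ideal (inv_comp \<beta>) = comp_ideal \<beta>"
proof
  interpret inv: quiver_aut n p E "inv_into UNIV \<sigma>" \<alpha> \<Lambda> by (rule inverse)
  interpret J: free_ideal "comp_ideal \<beta>" "comp_gens n \<beta>" by (rule comp_ideal)
  show "rename (map_gen act_tup) ` comp_ideal (inv_comp \<beta>) \<subseteq> comp_ideal \<beta>"
    using rename_ideal[of "inv_comp \<beta>"] by simp
  show "comp_ideal \<beta> \<subseteq> rename (map_gen act_tup) ` comp_ideal (inv_comp \<beta>)"
  proof
    fix x :: "((nat \<Rightarrow> 'k) gen, 'c) free"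
    assume x: "x \<in> comp_ideal \<beta>"
    then have "rename (map_gen act_tup) (rename (map_gen inv_tup) x) = x"
      using inv.rename_inverse[OF J.mem_carrier[OF x]] bij by (simp add: inv_inv_eq)
    moreover have "rename (map_gen inv_tup) x \<in> comp_ideal (inv_comp \<beta>)"
      using inv.rename_ideal[of \<beta>] x by blast
    ultimately show "x \<in> rename (map_gen act_tup) ` comp_ideal (inv_comp \<beta>)"
      by (rule image_eqI[OF sym])
  qed
qed

text \<open>The component at \<beta> of the homomorphism \<phi>, on letters. Of the orbit sum
  e(\<gamma>), only the tuples belonging to \<beta> contribute to this component.\<close>

definition fixsub :: "('k \<Rightarrow> nat) \<Rightarrow> (nat \<Rightarrow> 'k) set gen \<Rightarrow> ((nat \<Rightarrow> 'k) gen, 'f::field) free"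
  where "fixsub \<beta> g =
    (case g of E_gen \<gamma> \<Rightarrow> \<Sum>k\<in>\<gamma> \<inter> tuples n \<beta>. ge k | Y_gen a \<Rightarrow> gy a | Psi_gen a \<Rightarrow> gpsi a)"

lemma fixsub_simps [simp]:
  "fixsub \<beta> (E_gen \<gamma>) = (\<Sum>k\<in>\<gamma> \<inter> tuples n \<beta>. ge k)"
  "fixsub \<beta> (Y_gen a) = gy a" "fixsub \<beta> (Psi_gen a) = gpsi a"
  by (simp_all add: fixsub_def)

lemma fixsub_closed:
  "x \<in> carrier (free_alg (fix_gens n \<sigma> \<alpha>)) \<Longrightarrow> subst (fixsub \<beta>) x \<in> carrier (free_alg (comp_gens n \<beta>))"
  by (erule subst_closed) (auto simp: fix_gens_def klr_gens_def intro!: free_alg_closed free_alg_var)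

text \<open>A relation at an orbit is the sum of the relations at those of its tuples that lie in
  the given component. They can be added because the correction terms agree along the orbit.\<close>

lemma fixsub_rel:
  fixes l r :: "((nat \<Rightarrow> 'k) set gen, 'f::field) free"
  assumes "(l, r) \<in> klr_rels n E T lab" and \<beta>: "\<beta> \<in> Orb"
  shows "subst (fixsub \<beta>) l - subst (fixsub \<beta>) r \<in> comp_ideal \<beta>"
proof -
  let ?f = "fixsub \<beta> :: _ \<Rightarrow> ((nat \<Rightarrow> 'k) gen, 'f) free"
  let ?R = "comp_rels n E \<beta> :: (((nat \<Rightarrow> 'k) gen, 'f) free \<times> _) set"
  let ?I = "comp_ideal \<beta> :: ((nat \<Rightarrow> 'k) gen, 'f) free set"
  let ?D = "\<lambda>k. lab k \<inter> tuples n \<beta>"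
  interpret I: free_ideal "comp_ideal \<beta>" "comp_gens n \<beta>" by (rule comp_ideal)
  have fin: "finite (A \<inter> tuples n \<beta>)" for A
    using finite_tuples_Orb[OF \<beta>] by simp
  \<comment> \<open>Serves all relations in which one idempotent stands on the right of both
    sides.\<close>
  have local: "L * sum ge (?D k) - R * sum ge (?D k) \<in> ?I"
    if "\<And>l. l \<in> ?D k \<Longrightarrow> (L * ge l, R * ge l) \<in> ?R" for L R k
    unfolding sum_distrib_left by (rule I.mem_sum_diff) (rule comp_rel[OF that])
  from assms(1) show ?thesis
  proof cases
    case idem_sum
    have "(\<Sum>\<gamma>\<in>lab ` T. \<Sum>k\<in>\<gamma> \<inter> tuples n \<beta>. ge k) = (\<Sum>k\<in>(\<Union>\<gamma>\<in>lab ` T. \<gamma> \<inter> tuples n \<beta>). ge k :: ((nat \<Rightarrow> 'k) gen, 'f) free)"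
      using finite_T fin lab_disjoint
      by (intro sum.UNION_disjoint[symmetric]) (simp_all add: Int_commute Int_left_commute inf.assoc Int_assoc)
    also have "(\<Union>\<gamma>\<in>lab ` T. \<gamma> \<inter> tuples n \<beta>) = tuples n \<beta>"
      using T_I[OF \<beta>] lab_self by auto
    finally show ?thesis
      using comp_rel[OF klr_rels.idem_sum[of "\<lambda>k. k" "tuples n \<beta>" n E]] idem_sum by simp
  next
    case (idem_mult k k')
    have "(\<Sum>i\<in>?D k. \<Sum>j\<in>?D k'. ge i * ge j) - (\<Sum>i\<in>?D k. \<Sum>j\<in>?D k'. if i = j then ge i else 0) \<in> ?I"
      by (intro I.mem_sum_diff comp_rel klr_rels.idem_mult[where lab = "\<lambda>k. k"]) auto
    \<comment> \<open>Only the diagonal of the double sum survives; for different orbits there is no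
      diagonal.\<close>
    moreover have "(\<Sum>i\<in>?D k. \<Sum>j\<in>?D k'. if i = j then ge i else 0)
      = (if lab k = lab k' then sum ge (?D k) else 0 :: ((nat \<Rightarrow> 'k) gen, 'f) free)"
    proof (cases "lab k = lab k'")
      case False
      then have "i \<noteq> j" if "i \<in> ?D k" "j \<in> ?D k'" for i j
        using that idem_mult(3,4) by (auto simp: lab_eq_iff)
      then show ?thesis using False by (auto intro!: sum.neutral)
    qed (simp add: fin)
    ultimately show ?thesis
      using idem_mult by (cases "lab k = lab k'") (simp_all add: sum_product)
  next
    case (y_idem k a)
    have "gy a * sum ge (?D k) - sum ge (?D k) * gy a \<in> ?I"
      unfolding sum_distrib_left sum_distrib_right
      by (intro I.mem_sum_diff comp_rel) (use klr_rels.y_idem[of _ "tuples n \<beta>" a n "\<lambda>k. k" E] y_idem in auto)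
    then show ?thesis using y_idem by simp
  next
    case (psi_idem k a)
    \<comment> \<open>The relation at the orbit carries the idempotent of
      \<open>lab (swap a k)\<close>, whereas summing the relations at tuples produces the swapped
      members of \<open>lab k\<close>; both index the same sum.\<close>
    have "swap a ` ?D k = ?D (swap a k)"
    proof
      show "?D (swap a k) \<subseteq> swap a ` ?D k"
      proof
        fix l assume "l \<in> ?D (swap a k)"
        then have "swap a l \<in> ?D k"
          using lab_swap_mem[OF psi_idem(4), of l "swap a k"] psi_idem(4) by (simp add: swap_tuples)
        then show "l \<in> swap a ` ?D k" by (metis image_eqI swap_swap)
      qed
    qed (use psi_idem(4) in \<open>auto intro: lab_swap_mem swap_tuples\<close>)
    moreover have "inj (swap a :: (nat \<Rightarrow> 'k) \<Rightarrow> _)"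
      by (metis injI swap_swap)
    ultimately have "sum ge (?D (swap a k)) = (\<Sum>l\<in>?D k. ge (swap a l) :: ((nat \<Rightarrow> 'k) gen, 'f) free)"
      using sum.reindex[OF inj_on_subset[OF _ subset_UNIV], of "swap a" ge "?D k"] by (simp add: comp_def)
    moreover have "gpsi a * sum ge (?D k) - (\<Sum>l\<in>?D k. ge (swap a l)) * gpsi a \<in> ?I"
      unfolding sum_distrib_left sum_distrib_right
      by (intro I.mem_sum_diff comp_rel) (use klr_rels.psi_idem[of _ "tuples n \<beta>" a n "\<lambda>k. k" E] psi_idem in auto)
    ultimately show ?thesis using psi_idem by simp
  next
    case (psi_y_Suc k a)
    have "gpsi a * gy (a + 1) * sum ge (?D k) - (gy a * gpsi a + (if k a = k (a + 1) then 1 else 0)) * sum ge (?D k) \<in> ?I"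
    proof (rule local)
      fix m assume "m \<in> ?D k"
      then show "(gpsi a * gy (a + 1) * ge m, (gy a * gpsi a + (if k a = k (a + 1) then 1 else 0)) * ge m) \<in> ?R"
        using klr_rels.psi_y_Suc[of m "tuples n \<beta>" a n "\<lambda>k. k" E] eq_Suc_lab[of a m k] psi_y_Suc(4)
        by (cases "k a = k (a + 1)") simp_all
    qed
    then show ?thesis
      using psi_y_Suc by (cases "k a = k (a + 1)") simp_all
  next
    case (y_Suc_psi k a)
    have "gy (a + 1) * gpsi a * sum ge (?D k) - (gpsi a * gy a + (if k a = k (a + 1) then 1 else 0)) * sum ge (?D k) \<in> ?I"
    proof (rule local)
      fix m assume "m \<in> ?D k"
      then show "(gy (a + 1) * gpsi a * ge m, (gpsi a * gy a + (if k a = k (a + 1) then 1 else 0)) * ge m) \<in> ?R"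
        using klr_rels.y_Suc_psi[of m "tuples n \<beta>" a n "\<lambda>k. k" E] eq_Suc_lab[of a m k] y_Suc_psi(4)
        by (cases "k a = k (a + 1)") simp_all
    qed
    then show ?thesis
      using y_Suc_psi by (cases "k a = k (a + 1)") simp_all
  next
    case (psi_sq k a)
    have "gpsi a ^ 2 * sum ge (?D k) - (sq_factor E k a) * sum ge (?D k) \<in> ?I"
    proof (rule local)
      fix m assume "m \<in> ?D k"
      then show "(gpsi a ^ 2 * ge m, (sq_factor E k a) * ge m) \<in> ?R"
        using klr_rels.psi_sq[of m "tuples n \<beta>" a n "\<lambda>k. k" E] psi_sq(4) by (simp add: sq_factor_lab[of a m k])
    qed
    then show ?thesis
      using psi_sq by (simp add: subst_sq_factor)
  next
    case (braid k a)
    have "gpsi (a + 1) * gpsi a * gpsi (a + 1) * sum ge (?D k) - (gpsi a * gpsi (a + 1) * gpsi a + braid_term E k a) * sum ge (?D k) \<in> ?I"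
    proof (rule local)
      fix m assume "m \<in> ?D k"
      then show "(gpsi (a + 1) * gpsi a * gpsi (a + 1) * ge m, (gpsi a * gpsi (a + 1) * gpsi a + braid_term E k a) * ge m) \<in> ?R"
        using klr_rels.braid[of m "tuples n \<beta>" a n "\<lambda>k. k" E] braid(4,5) by (simp add: braid_term_lab[of a m k])
    qed
    then show ?thesis
      using braid by (simp add: subst_braid_term)
  next
    case (y_y a b)
    then show ?thesis using comp_rel[OF klr_rels.y_y[OF y_y(3,4), where lab = "\<lambda>k. k"]] by simp
  next
    case (psi_y a b)
    then show ?thesis using comp_rel[OF klr_rels.psi_y[OF psi_y(3-6), where lab = "\<lambda>k. k"]] by simp
  next
    case (psi_psi a b)
    then show ?thesis using comp_rel[OF klr_rels.psi_psi[OF psi_psi(3-5), where lab = "\<lambda>k. k"]] by simp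
  qed
qed

end

section \<open>A module over the quiver Hecke algebras\<close>

fun tup_op :: "(nat \<Rightarrow> 'k) gen \<Rightarrow> ((nat \<Rightarrow> 'k) \<Rightarrow> ('i gen, 'f::field) free) \<Rightarrow> (nat \<Rightarrow> 'k) \<Rightarrow> ('i gen, 'f) free"
  where
    "tup_op (E_gen k) v = (\<lambda>l. if l = k then v l else 0)"
  | "tup_op (Y_gen a) v = (\<lambda>l. gy a * v l)"
  | "tup_op (Psi_gen a) v = (\<lambda>l. gpsi a * v (swap a l))"

definition tup_scale :: "'f::field \<Rightarrow> ('t \<Rightarrow> ('g, 'f) free) \<Rightarrow> 't \<Rightarrow> ('g, 'f) free"
  where "tup_scale c v = (\<lambda>l. Poly_Mapping.single [] c * v l)"

text \<open>Only linearity is checked here. The quiver Hecke relations hold later, on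
  \<open>repV\<close> and modulo \<open>fix_ideal\<close>. Using all functions as the underlying set
  makes the module a type that is an abelian group.\<close>

interpretation tup: free_rep tup_scale tup_op
proof
  fix g :: "(nat \<Rightarrow> 'k) gen" and u v :: "(nat \<Rightarrow> 'k) \<Rightarrow> ('i gen, 'f::field) free" and c :: 'f
  show "tup_op g (u + v) = tup_op g u + tup_op g v"
    by (cases g) (auto simp: fun_eq_iff algebra_simps)
  have *: "z * (Poly_Mapping.single [] c * w) = Poly_Mapping.single [] c * (z * w)" for z w :: "('i gen, 'f) free"
    by (metis scalar_commute mult.assoc)
  show "tup_op g (tup_scale c v) = tup_scale c (tup_op g v)"
    by (cases g) (auto simp: fun_eq_iff tup_scale_def *)
qed (auto simp: tup_scale_def fun_eq_iff algebra_simps single_add single_Nil_one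
    mult.assoc[symmetric] mult_single plus_list_def)

abbreviation "tup_act_free \<equiv> act tup_scale tup_op"

lemma tup_sum_apply: "sum f A l = (\<Sum>i\<in>A. f i l)" for f :: "'a \<Rightarrow> 'b \<Rightarrow> 'c::comm_monoid_add"
  by (induction A rule: infinite_finite_induct) simp_all

lemmas tup_act_simps = tup.act_mult tup.act_add tup.act_diff tup.act_var tup.act_one tup.act_zero tup.act_sum
  tup.act_uminus

text \<open>The two occurrences of \<open>sq_factor\<close> live over different alphabets: the
  letters y act pointwise, so a polynomial in them acts as multiplication by its counterpart among
  the values.\<close>

lemma tup_act_sq_factor: "tup_act_free (sq_factor E k a) v l = sq_factor E k a * v l"
  by (simp add: sq_factor_def tup_act_simps algebra_simps)

lemma tup_act_braid_term: "tup_act_free (braid_term E k a) v l = braid_term E k a * v l"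
  by (simp add: braid_term_def mult_2 tup_act_simps algebra_simps)

lemma tup_act_gy_power: "tup_act_free (gy a ^ m) v l = gy a ^ m * v l"
  by (induction m) (simp_all add: tup_act_simps mult.assoc)

lemma swap_commute: "a \<noteq> b \<Longrightarrow> a \<noteq> b + 1 \<Longrightarrow> b \<noteq> a + 1 \<Longrightarrow> swap a (swap b l) = swap b (swap a l)"
  by (auto simp: swap_def fun_eq_iff)

lemma swap_braid: "swap (a + 1) (swap a (swap (a + 1) l)) = swap a (swap (a + 1) (swap a l))"
  by (auto simp: swap_def fun_eq_iff)

lemma swap_trivial: "k a = k (a + 1) \<Longrightarrow> swap a k = k"
  by (auto simp: swap_def fun_eq_iff)

text \<open>The three swaps together exchange positions a and a + 2, which hold the same
  entry.\<close>

lemma swap_braid_trivial: "k (a + 2) = k a \<Longrightarrow> swap (a + 1) (swap a (swap (a + 1) k)) = k"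
  by (auto simp: swap_def fun_eq_iff)

context quiver_aut
begin

abbreviation (input) "FR \<equiv> fix_rels n E \<sigma> \<alpha> \<Lambda>"
abbreviation (input) "FG \<equiv> fix_gens n \<sigma> \<alpha>"
abbreviation fix_ideal :: "((nat \<Rightarrow> 'k) set gen, 'f::field) free set"
  where "fix_ideal \<equiv> pres_ideal FG FR"

lemma tuple_orbits_eq: "tuple_orbits n \<sigma> \<alpha> = lab ` T"
  by (simp add: tuple_orbits_def)

lemma FG_carrier:
  "k \<in> T \<Longrightarrow> ge (lab k) \<in> carrier (free_alg FG)"
  "a \<in> {1..n} \<Longrightarrow> gy a \<in> carrier (free_alg FG)"
  "a \<in> {1..<n} \<Longrightarrow> gpsi a \<in> carrier (free_alg FG)"
  by (simp_all add: fix_gens_def tuple_orbits_eq klr_gens_carrier)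

lemma rels_closed_fix: "rels_closed FG (FR :: (((nat \<Rightarrow> 'k) set gen, 'f::field) free \<times> _) set)"
proof -
  have "rels_closed FG (klr_rels n E T lab :: (((nat \<Rightarrow> 'k) set gen, 'f) free \<times> _) set)"
    unfolding fix_gens_def tuple_orbits_eq by (rule rels_closed_klr) (rule swap_T)
  then show ?thesis
    using n by (auto simp: rels_closed_def fix_rels_def intro!: free_alg_closed FG_carrier)
qed

lemma fix_ideal: "free_ideal fix_ideal FG"
  by (rule pres_ideal[OF rels_closed_fix])

lemma fix_rel: "(l, r) \<in> klr_rels n E T lab \<Longrightarrow> l - r \<in> fix_ideal"
  by (rule pres_ideal[OF rels_closed_fix]) (simp add: fix_rels_def)

lemma fix_rel_cyc: "k \<in> T \<Longrightarrow> gy 1 ^ \<Lambda> (k 1) * ge (lab k) \<in> fix_ideal"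
  using pres_ideal(2)[OF rels_closed_fix, of "gy 1 ^ \<Lambda> (k 1) * ge (lab k)" 0] by (auto simp: fix_rels_def)

text \<open>
  The module of the injectivity argument, before passing to the quotient by \<^term>\<open>fix_ideal\<close>: its
  elements are the families in \<open>repV\<close>, and \<open>repW\<close> consists of those that represent zero.
\<close>

definition repV :: "('k \<Rightarrow> nat) \<Rightarrow> ((nat \<Rightarrow> 'k) \<Rightarrow> ((nat \<Rightarrow> 'k) set gen, 'f::field) free) set"
  where "repV \<beta> = {v. \<forall>l\<in>tuples n \<beta>. v l \<in> carrier (free_alg FG) \<and> ge (lab l) * v l - v l \<in> fix_ideal}"

definition repW :: "('k \<Rightarrow> nat) \<Rightarrow> ((nat \<Rightarrow> 'k) \<Rightarrow> ((nat \<Rightarrow> 'k) set gen, 'f::field) free) set"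
  where "repW \<beta> = {v. \<forall>l\<in>tuples n \<beta>. v l \<in> fix_ideal}"

text \<open>The annihilator, in the free algebra, of the quotient of \<open>repV\<close> by
  \<open>repW\<close>.\<close>

definition rep_ann :: "('k \<Rightarrow> nat) \<Rightarrow> ((nat \<Rightarrow> 'k) gen, 'f::field) free set"
  where "rep_ann \<beta> = {x \<in> carrier (free_alg (comp_gens n \<beta>)). \<forall>v\<in>repV \<beta>. tup_act_free x v \<in> repW \<beta>}"

text \<open>The condition on values survives because y commutes with the orbit idempotents, and
  because \<psi> at l reads the entry at \<open>swap a l\<close> and carries the idempotent of that
  orbit to the one of l.\<close>

lemma repV_closed:
  fixes v :: "(nat \<Rightarrow> 'k) \<Rightarrow> ((nat \<Rightarrow> 'k) set gen, 'f::field) free"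
  assumes \<beta>: "\<beta> \<in> Orb" and x: "x \<in> carrier (free_alg (comp_gens n \<beta>))" and v: "v \<in> repV \<beta>"
  shows "tup_act_free x v \<in> repV \<beta>"
proof (rule tup.act_closed[OF x v])
  interpret P: free_ideal fix_ideal FG by (rule fix_ideal)
  show "0 \<in> repV \<beta>"
    by (simp add: repV_def free_alg_zero P.mem_zero)
  fix u v :: "(nat \<Rightarrow> 'k) \<Rightarrow> ((nat \<Rightarrow> 'k) set gen, 'f) free" and c :: 'f
  assume v: "v \<in> repV \<beta>"
  show "tup_scale c v \<in> repV \<beta>"
    unfolding repV_def tup_scale_def
  proof (intro CollectI ballI conjI)
    fix l assume "l \<in> tuples n \<beta>"
    then have v: "v l \<in> carrier (free_alg FG)" "ge (lab l) * v l - v l \<in> fix_ideal"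
      using v by (auto simp: repV_def)
    then show "Poly_Mapping.single [] c * v l \<in> carrier (free_alg FG)"
      by (simp add: free_alg_closed)
    have "ge (lab l) * (Poly_Mapping.single [] c * v l) = Poly_Mapping.single [] c * (ge (lab l) * v l)"
      by (metis scalar_commute mult.assoc)
    then show "ge (lab l) * (Poly_Mapping.single [] c * v l) - Poly_Mapping.single [] c * v l \<in> fix_ideal"
      using P.mem_left_diff[OF v(2)] by (simp add: free_alg_closed)
  qed
  show "tup_op g v \<in> repV \<beta>" if "g \<in> comp_gens n \<beta>" for g
  proof (cases g)
    case (E_gen k)
    then show ?thesis using v by (auto simp: repV_def P.mem_zero free_alg_zero)
  next
    case (Y_gen a)
    then have a: "a \<in> {1..n}" using that by (auto simp: klr_gens_def)
    have "ge (lab l) * (gy a * v l) - gy a * v l \<in> fix_ideal" if l: "l \<in> tuples n \<beta>" for l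
    proof (rule P.mem_trans)
      have vl: "v l \<in> carrier (free_alg FG)" "ge (lab l) * v l - v l \<in> fix_ideal"
        using v l by (auto simp: repV_def)
      show "gy a * (ge (lab l) * v l) - gy a * v l \<in> fix_ideal"
        by (rule P.mem_left_diff[OF vl(2) FG_carrier(2)[OF a]])
      show "ge (lab l) * (gy a * v l) - gy a * (ge (lab l) * v l) \<in> fix_ideal"
        using P.mem_right_diff[OF P.mem_uminus[OF fix_rel[OF klr_rels.y_idem[OF T_I[OF \<beta> l] a]], simplified] vl(1)]
        by (simp add: mult.assoc)
    qed
    then show ?thesis using v a Y_gen by (auto simp: repV_def free_alg_closed FG_carrier)
  next
    case (Psi_gen a)
    then have a: "a \<in> {1..<n}" using that by (auto simp: klr_gens_def)
    have "ge (lab l) * (gpsi a * v (swap a l)) - gpsi a * v (swap a l) \<in> fix_ideal" if l: "l \<in> tuples n \<beta>" for l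
    proof (rule P.mem_trans)
      let ?l = "swap a l"
      have l': "?l \<in> tuples n \<beta>" by (rule swap_tuples[OF l a])
      have vl: "v ?l \<in> carrier (free_alg FG)" "ge (lab ?l) * v ?l - v ?l \<in> fix_ideal"
        using v l' by (auto simp: repV_def)
      show "gpsi a * (ge (lab ?l) * v ?l) - gpsi a * v ?l \<in> fix_ideal"
        by (rule P.mem_left_diff[OF vl(2) FG_carrier(3)[OF a]])
      show "ge (lab l) * (gpsi a * v ?l) - gpsi a * (ge (lab ?l) * v ?l) \<in> fix_ideal"
        using P.mem_right_diff[OF P.mem_uminus[OF fix_rel[OF klr_rels.psi_idem[OF T_I[OF \<beta> l'] a]], simplified] vl(1)]
        by (simp add: mult.assoc)
    qed
    then show ?thesis using v a Psi_gen
      by (auto simp: repV_def free_alg_closed FG_carrier swap_tuples)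
  qed
  assume u: "u \<in> repV \<beta>"
  show "u + v \<in> repV \<beta>"
    unfolding repV_def
  proof (intro CollectI ballI conjI)
    fix l assume "l \<in> tuples n \<beta>"
    then have "u l \<in> carrier (free_alg FG)" "ge (lab l) * u l - u l \<in> fix_ideal"
      "v l \<in> carrier (free_alg FG)" "ge (lab l) * v l - v l \<in> fix_ideal"
      using u v by (auto simp: repV_def)
    then show "(u + v) l \<in> carrier (free_alg FG)" "ge (lab l) * (u + v) l - (u + v) l \<in> fix_ideal"
      using P.mem_add[of "ge (lab l) * u l - u l" "ge (lab l) * v l - v l"]
      by (simp_all add: free_alg_add algebra_simps)
  qed
qed

lemma repW_closed:
  assumes x: "x \<in> carrier (free_alg (comp_gens n \<beta>))" and v: "v \<in> repW \<beta>"
  shows "tup_act_free x v \<in> repW \<beta>"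
proof (rule tup.act_closed[OF x v])
  interpret P: free_ideal fix_ideal FG by (rule fix_ideal)
  fix g u v c
  assume v: "v \<in> repW \<beta>" 
  then show "tup_scale c v \<in> repW \<beta>"
    by (auto simp: repW_def tup_scale_def free_alg_closed intro: P.mem_left)
  show "tup_op g v \<in> repW \<beta>" if "g \<in> comp_gens n \<beta>"
    using that v by (cases g)
      (auto simp: repW_def klr_gens_def P.mem_zero swap_tuples intro!: P.mem_left FG_carrier)
qed (auto simp: repW_def free_ideal.mem_zero[OF fix_ideal] free_ideal.mem_add[OF fix_ideal])

text \<open>Closure under multiplication from the left uses that \<open>repW\<close> is stable under
  the action, closure from the right that \<open>repV\<close> is.\<close>

lemma rep_ann_ideal:
  assumes "\<beta> \<in> Orb"
  shows "free_ideal (rep_ann \<beta>) (comp_gens n \<beta>)"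
proof -
  interpret P: free_ideal fix_ideal FG by (rule fix_ideal)
  show ?thesis
    by (rule free_idealI)
      (auto simp: rep_ann_def free_alg_closed tup_act_simps repW_closed repV_closed[OF assms],
       auto simp: repW_def P.mem_zero P.mem_add)
qed

text \<open>An entry of v absorbs the idempotent of its orbit modulo \<open>fix_ideal\<close>, so a
  relation stated with that idempotent on the right can be applied to the entry with the idempotent
  removed.\<close>

lemma rep_eq:
  assumes "(L * ge (lab k), R * ge (lab k)) \<in> klr_rels n E T lab"
    and "L \<in> carrier (free_alg FG)" "R \<in> carrier (free_alg FG)" and "v \<in> repV \<beta>" and "k \<in> tuples n \<beta>"
  shows "L * v k - R * v k \<in> fix_ideal"
proof -
  interpret P: free_ideal fix_ideal FG by (rule fix_ideal)
  have v: "v k \<in> carrier (free_alg FG)" "ge (lab k) * v k - v k \<in> fix_ideal"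
    using assms by (auto simp: repV_def)
  have 1: "(L * ge (lab k)) * v k - (R * ge (lab k)) * v k \<in> fix_ideal"
    by (rule P.mem_right_diff[OF fix_rel[OF assms(1)] v(1)])
  have 2: "L * (ge (lab k) * v k) - L * v k \<in> fix_ideal" "R * (ge (lab k) * v k) - R * v k \<in> fix_ideal"
    using P.mem_left_diff[OF v(2)] assms(2,3) by blast+
  show ?thesis
    using P.mem_add[OF P.mem_diff[OF 1 2(1)] 2(2)] by (simp add: mult.assoc)
qed

text \<open>Read at one entry m, each relation among the e(k) becomes either trivial bookkeeping of
  positions or the corresponding relation of the presented algebra, applied to a single entry of
  v.\<close>

lemma comp_rel_ann:
  assumes \<beta>: "\<beta> \<in> Orb" and lr: "(l, r) \<in> comp_rels n E \<beta>"
  shows "l - r \<in> rep_ann \<beta>"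
  unfolding rep_ann_def repW_def
proof (intro CollectI conjI ballI)
  interpret P: free_ideal fix_ideal FG by (rule fix_ideal)
  show "l - r \<in> carrier (free_alg (comp_gens n \<beta>))"
    using free_ideal.mem_carrier[OF comp_ideal comp_rel[OF lr]] .
  fix v :: "(nat \<Rightarrow> 'k) \<Rightarrow> ((nat \<Rightarrow> 'k) set gen, 'a) free" and m
  assume v: "v \<in> repV \<beta>" and m: "m \<in> tuples n \<beta>"
  have carr: "v k \<in> carrier (free_alg FG)" if "k \<in> tuples n \<beta>" for k
    using v that by (simp add: repV_def)
  note gens = free_alg_closed FG_carrier
  from lr show "tup_act_free (l - r) v m \<in> fix_ideal"
  proof cases
    case idem_sum
    have "(\<Sum>k\<in>tuples n \<beta>. if m = k then v m else 0) = v m"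
      using m finite_tuples_Orb[OF \<beta>] by simp
    then show ?thesis
      using idem_sum by (simp add: tup_act_simps tup_sum_apply P.mem_zero)
  next
    case (idem_mult k k')
    then show ?thesis by (simp add: tup_act_simps P.mem_zero)
  next
    case (y_idem k a)
    then show ?thesis by (simp add: tup_act_simps P.mem_zero)
  next
    case (psi_idem k a)
    then show ?thesis by (auto simp: tup_act_simps P.mem_zero)
  next
    case (y_y a b)
    then show ?thesis
      using P.mem_right_diff[OF fix_rel[OF klr_rels.y_y[OF y_y(3,4)]] carr[OF m]]
      by (simp add: tup_act_simps mult.assoc)
  next
    case (psi_y a b)
    then show ?thesis
      using P.mem_right_diff[OF fix_rel[OF klr_rels.psi_y[OF psi_y(3-6)]] carr[OF swap_tuples[OF m psi_y(3)]]]
      by (simp add: tup_act_simps mult.assoc)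
  next
    case (psi_psi a b)
    have "swap a (swap b m) = swap b (swap a m)"
      using psi_psi(5) by (intro swap_commute) auto
    then show ?thesis
      using P.mem_right_diff[OF fix_rel[OF klr_rels.psi_psi[OF psi_psi(3-5)]]
          carr[OF swap_tuples[OF swap_tuples[OF m psi_psi(4)] psi_psi(3)]]] psi_psi
      by (simp add: tup_act_simps mult.assoc)
  next
    case (psi_y_Suc k a)
    let ?d = "if k a = k (a + 1) then 1 else 0"
    show ?thesis
    \<comment> \<open>Words with one \<psi> read v at \<open>swap a m\<close>, the correction term
      at m. The correction is present only if k has equal entries at a and a + 1, and then
      \<open>swap a\<close> fixes k, so both conditions agree.\<close>
    proof (cases "swap a m = k")
      case True
      have "gpsi a * gy (a + 1) * v k - (gy a * gpsi a + ?d) * v k \<in> fix_ideal"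
        by (rule rep_eq[OF klr_rels.psi_y_Suc[OF T_I[OF \<beta> psi_y_Suc(3)] psi_y_Suc(4)] _ _ v psi_y_Suc(3)])
          (use psi_y_Suc(4) in \<open>auto intro!: gens\<close>)
      moreover have "k a = k (a + 1) \<longrightarrow> m = k"
        using True swap_trivial[of k a] by (metis swap_swap)
      ultimately show ?thesis
        using psi_y_Suc True by (simp add: tup_act_simps mult.assoc algebra_simps split: if_splits)
    next
      case False
      then have "k a = k (a + 1) \<Longrightarrow> m \<noteq> k"
        using swap_trivial[of k a] by auto
      then show ?thesis
        using psi_y_Suc False by (simp add: tup_act_simps P.mem_zero)
    qed
  next
    case (y_Suc_psi k a)
    let ?d = "if k a = k (a + 1) then 1 else 0"
    show ?thesis
    proof (cases "swap a m = k")
      case True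
      have "gy (a + 1) * gpsi a * v k - (gpsi a * gy a + ?d) * v k \<in> fix_ideal"
        by (rule rep_eq[OF klr_rels.y_Suc_psi[OF T_I[OF \<beta> y_Suc_psi(3)] y_Suc_psi(4)] _ _ v y_Suc_psi(3)])
          (use y_Suc_psi(4) in \<open>auto intro!: gens\<close>)
      moreover have "k a = k (a + 1) \<longrightarrow> m = k"
        using True swap_trivial[of k a] by (metis swap_swap)
      ultimately show ?thesis
        using y_Suc_psi True by (simp add: tup_act_simps mult.assoc algebra_simps split: if_splits)
    next
      case False
      then have "k a = k (a + 1) \<Longrightarrow> m \<noteq> k"
        using swap_trivial[of k a] by auto
      then show ?thesis
        using y_Suc_psi False by (simp add: tup_act_simps P.mem_zero)
    qed
  next
    case (psi_sq k a)
    show ?thesis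
    proof (cases "m = k")
      case True
      have "gpsi a ^ 2 * v k - sq_factor E k a * v k \<in> fix_ideal"
        by (rule rep_eq[OF klr_rels.psi_sq[OF T_I[OF \<beta> psi_sq(3)] psi_sq(4)] _ _ v psi_sq(3)])
          (use psi_sq(4) in \<open>auto intro!: gens sq_factor_carrier simp: fix_gens_def klr_gens_carrier\<close>)
      then show ?thesis
        using psi_sq True by (simp add: tup_act_simps tup_act_sq_factor power2_eq_square mult.assoc)
    next
      case False
      then show ?thesis
        using psi_sq by (simp add: tup_act_simps tup_act_sq_factor power2_eq_square P.mem_zero)
    qed
  next
    case (braid k a)
    let ?L = "gpsi (a + 1) * gpsi a * gpsi (a + 1)" and ?R = "gpsi a * gpsi (a + 1) * gpsi a"
    define m' where "m' = swap (a + 1) (swap a (swap (a + 1) m))"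
    have m': "swap a (swap (a + 1) (swap a m)) = m'"
      unfolding m'_def by (rule swap_braid[symmetric])
    have act: "tup_act_free (l - r) v m = ?L * (if m' = k then v m' else 0)
        - (?R * (if m' = k then v m' else 0) + braid_term E k a * (if m = k then v m else 0))"
      using braid by (simp add: tup_act_simps tup_act_braid_term m'[unfolded Suc_eq_plus1[symmetric]]
          m'_def[unfolded Suc_eq_plus1[symmetric]] mult.assoc)
    \<comment> \<open>The words in \<open>\<psi>\<close> read off \<open>v\<close> at \<open>m'\<close> and the correction term at \<open>m\<close>, but when these
      conditions differ the correction term is \<open>0\<close>.\<close>
    have triv: "braid_term E k a = (0 :: ((nat \<Rightarrow> 'k) set gen, 'a) free) \<or> (m = k \<longleftrightarrow> m' = k)"
    proof (cases "k (a + 2) = k a")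
      case True
      then have "swap (a + 1) (swap a (swap (a + 1) k)) = k"
        by (rule swap_braid_trivial)
      then have "m = k \<longleftrightarrow> m' = k"
        unfolding m'_def by (metis swap_swap)
      then show ?thesis by simp
    qed (simp add: braid_term_def)
    have eq: "?L * v k - (?R + braid_term E k a) * v k \<in> fix_ideal"
      by (rule rep_eq[OF klr_rels.braid[OF T_I[OF \<beta> braid(3)] braid(4,5)] _ _ v braid(3)])
        (use braid(4,5) in \<open>auto intro!: gens braid_term_carrier simp: fix_gens_def klr_gens_carrier\<close>)
    show ?thesis
      unfolding act using triv eq by (auto simp: P.mem_zero algebra_simps)
  qed
qed

lemma comp_ideal_ann: "\<beta> \<in> Orb \<Longrightarrow> comp_ideal \<beta> \<subseteq> rep_ann \<beta>"
  using rep_ann_ideal comp_rel_ann by (intro pres_ideal_minimal) (auto simp: free_ideal_def)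

text \<open>Relation (FC) kills the power of y times the orbit idempotent, and the entry of v at k
  absorbs that idempotent.\<close>

lemma cyc_ann:
  assumes \<beta>: "\<beta> \<in> Orb" and k: "k \<in> tuples n \<beta>"
  shows "gy 1 ^ \<Lambda> (k 1) * ge k \<in> rep_ann \<beta>"
  unfolding rep_ann_def repW_def
proof (intro CollectI conjI ballI)
  interpret P: free_ideal fix_ideal FG by (rule fix_ideal)
  show "gy 1 ^ \<Lambda> (k 1) * ge k \<in> carrier (free_alg (comp_gens n \<beta>))"
    using n k by (auto intro!: free_alg_closed klr_gens_carrier)
  fix v :: "(nat \<Rightarrow> 'k) \<Rightarrow> ((nat \<Rightarrow> 'k) set gen, 'a) free" and m
  assume v: "v \<in> repV \<beta>" and m: "m \<in> tuples n \<beta>"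
  have vk: "v k \<in> carrier (free_alg FG)" "ge (lab k) * v k - v k \<in> fix_ideal"
    using v k by (auto simp: repV_def)
  have y: "gy 1 ^ \<Lambda> (k 1) \<in> carrier (free_alg FG)"
    using n by (intro free_alg_power FG_carrier) simp
  have "gy 1 ^ \<Lambda> (k 1) * (ge (lab k) * v k) \<in> fix_ideal"
    using P.mem_right[OF fix_rel_cyc[OF T_I[OF \<beta> k]] vk(1)] by (simp add: mult.assoc)
  then have "gy 1 ^ \<Lambda> (k 1) * v k \<in> fix_ideal"
    using P.mem_diff[OF _ P.mem_left_diff[OF vk(2) y]] by fastforce
  then show "tup_act_free (gy 1 ^ \<Lambda> (k 1) * ge k) v m \<in> fix_ideal"
    by (simp add: tup_act_simps tup_act_gy_power P.mem_zero)
qed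

text \<open>It suffices to check letters. Acting by e(\<gamma>) keeps exactly the entries at tuples
  of \<gamma>; multiplying the sum by e(\<gamma>) does the same, because every entry absorbs the
  idempotent of its own orbit. Letters y act pointwise, and \<psi> only permutes the summands before
  multiplying.\<close>

lemma sum_equivariant:
  fixes v :: "(nat \<Rightarrow> 'k) \<Rightarrow> ((nat \<Rightarrow> 'k) set gen, 'f::field) free"
  assumes \<beta>: "\<beta> \<in> Orb" and x: "x \<in> carrier (free_alg FG)" and v: "v \<in> repV \<beta>"
  shows "(\<Sum>l\<in>tuples n \<beta>. tup_act_free (subst (fixsub \<beta>) x) v l) - x * (\<Sum>l\<in>tuples n \<beta>. v l) \<in> fix_ideal"
  using x
proof (induction x rule: free_alg_induct)
  interpret P: free_ideal fix_ideal FG by (rule fix_ideal)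
  let ?S = "\<lambda>v. \<Sum>l\<in>tuples n \<beta>. v l"
  {
    case zero
    then show ?case by (simp add: tup_act_simps P.mem_zero)
  next
    case one
    then show ?case by (simp add: tup_act_simps P.mem_zero)
  next
    case (add x y)
    then show ?case
      using P.mem_add[OF add(3,4)] by (simp add: tup_act_simps sum.distrib algebra_simps)
  next
    case (scale c x)
    then show ?case
      using P.mem_left[OF scale(2), of "Poly_Mapping.single [] c"]
      by (simp add: tup.act_scalar tup_scale_def[of c "tup_act_free (subst (fixsub \<beta>) x) v"]
          sum_distrib_left[symmetric] right_diff_distrib mult.assoc free_alg_closed)
  next
    case (var g x)
    define u where "u = tup_act_free (subst (fixsub \<beta>) x) v"
    have u: "u \<in> repV \<beta>"
      unfolding u_def using repV_closed[OF \<beta> fixsub_closed[OF var(2)] v] .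
    have ul: "u l \<in> carrier (free_alg FG)" "ge (lab l) * u l - u l \<in> fix_ideal" if "l \<in> tuples n \<beta>" for l
      using u that by (auto simp: repV_def)
    have "?S (tup_act_free (fixsub \<beta> g) u) - var g * ?S u \<in> fix_ideal"
    proof (cases g)
      case (E_gen \<gamma>)
      then obtain k where k: "k \<in> T" "\<gamma> = lab k"
        using var(1) by (auto simp: fix_gens_def klr_gens_def tuple_orbits_eq)
      have "(\<Sum>i\<in>\<gamma> \<inter> tuples n \<beta>. if l = i then u l else 0) - ge \<gamma> * u l \<in> fix_ideal" if l: "l \<in> tuples n \<beta>" for l
      proof -
        have lT: "l \<in> T" using T_I[OF \<beta> l] .
        have s: "(\<Sum>i\<in>\<gamma> \<inter> tuples n \<beta>. if l = i then u l else 0) = (if \<gamma> = lab l then u l else 0)"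
          using l k lab_eq_iff[OF k(1), of l] finite_tuples_Orb[OF \<beta>] by auto
        show ?thesis
        proof (cases "\<gamma> = lab l")
          case True
          then show ?thesis using s P.mem_uminus[OF ul(2)[OF l]] by simp
        next
          case False
          have "ge \<gamma> * ge (lab l) * u l \<in> fix_ideal"
            using P.mem_right[OF fix_rel[OF klr_rels.idem_mult[OF k(1) lT, of lab]] ul(1)[OF l]] False k
            by simp
          then have "ge \<gamma> * ge (lab l) * u l - ge \<gamma> * (ge (lab l) * u l - u l) \<in> fix_ideal"
            using P.mem_left[OF ul(2)[OF l] FG_carrier(1)[OF k(1)]] k by (intro P.mem_diff) simp_all
          then have "ge \<gamma> * u l \<in> fix_ideal"
            by (simp add: algebra_simps)
          then show ?thesis using s False P.mem_uminus by simp
        qed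
      qed
      then have "(\<Sum>l\<in>tuples n \<beta>. \<Sum>i\<in>\<gamma> \<inter> tuples n \<beta>. if l = i then u l else 0) - (\<Sum>l\<in>tuples n \<beta>. ge \<gamma> * u l) \<in> fix_ideal"
        by (rule P.mem_sum_diff)
      then show ?thesis
        by (simp add: E_gen tup_act_simps tup_sum_apply sum_distrib_left)
    next
      case (Y_gen a)
      then show ?thesis by (simp add: tup_act_simps sum_distrib_left P.mem_zero)
    next
      case (Psi_gen a)
      then have a: "a \<in> {1..<n}"
        using var(1) by (auto simp: fix_gens_def klr_gens_def)
      have "(\<Sum>l\<in>tuples n \<beta>. u (swap a l)) = ?S u"
        by (rule sum.reindex_bij_witness[of _ "swap a" "swap a"]) (simp_all add: swap_tuples[OF _ a])
      then show ?thesis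
        by (simp add: Psi_gen tup.act_var sum_distrib_left[symmetric] P.mem_zero)
    qed
    moreover have "var g * ?S u - var g * (x * ?S v) \<in> fix_ideal"
      using P.mem_left_diff[OF var(3) free_alg_var[OF var(1)]] by (simp add: u_def)
    ultimately have "?S (tup_act_free (fixsub \<beta> g) u) - var g * (x * ?S v) \<in> fix_ideal"
      by (rule P.mem_trans)
    then show ?case
      unfolding u_def by (simp add: tup.act_mult mult.assoc)
  }
qed

lemma mem_fix_ideal:
  fixes x :: "((nat \<Rightarrow> 'k) set gen, 'f::field) free"
  assumes x: "x \<in> carrier (free_alg FG)" and ann: "\<And>\<beta>. \<beta> \<in> Orb \<Longrightarrow> subst (fixsub \<beta>) x \<in> rep_ann \<beta>"
  shows "x \<in> fix_ideal"
proof -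
  interpret P: free_ideal fix_ideal FG by (rule fix_ideal)
  define rep where "rep \<gamma> = (SOME l. l \<in> \<gamma>)" for \<gamma> :: "(nat \<Rightarrow> 'k) set"
  define v :: "(nat \<Rightarrow> 'k) \<Rightarrow> ((nat \<Rightarrow> 'k) set gen, 'f) free"
    where "v k = (if rep (lab k) = k then ge (lab k) else 0)" for k
  have rep: "rep (lab k) \<in> lab k" for k
    unfolding rep_def by (rule someI[of _ k]) (rule lab_self)
  have rep_T: "rep (lab k) \<in> T" "lab (rep (lab k)) = lab k" if "k \<in> T" for k
    using rep[of k] lab_T[OF that] lab_eq_iff[OF that] by auto
  have v: "v \<in> repV \<beta>" if \<beta>: "\<beta> \<in> Orb" for \<beta>
  proof -
    have "ge (lab l) * ge (lab l) - ge (lab l) \<in> fix_ideal" if "l \<in> T" for l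
      using fix_rel[OF klr_rels.idem_mult[OF that that, of lab]] by simp
    then show ?thesis
      using T_I[OF \<beta>] by (auto simp: repV_def v_def P.mem_zero free_alg_zero intro!: FG_carrier)
  qed
  have "x * (\<Sum>l\<in>tuples n \<beta>. v l) \<in> fix_ideal" if \<beta>: "\<beta> \<in> Orb" for \<beta>
  proof -
    have "(\<Sum>l\<in>tuples n \<beta>. tup_act_free (subst (fixsub \<beta>) x) v l) \<in> fix_ideal"
      using ann[OF \<beta>] v[OF \<beta>] by (intro P.mem_sum) (auto simp: rep_ann_def repW_def)
    then show ?thesis
      using P.mem_diff[OF _ sum_equivariant[OF \<beta> x v[OF \<beta>]]] by fastforce
  qed
  then have "(\<Sum>\<beta>\<in>Orb. x * (\<Sum>l\<in>tuples n \<beta>. v l)) \<in> fix_ideal"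
    by (rule P.mem_sum)
  \<comment> \<open>Each orbit has its representative in only one component, so the sum over a
    single component need not be 1; the sums over all components are added up.\<close>
  moreover have "(\<Sum>\<beta>\<in>Orb. \<Sum>l\<in>tuples n \<beta>. v l) = (\<Sum>l\<in>T. v l)"
    unfolding orbit_tuples_def
  proof (rule sum.UNION_disjoint[symmetric])
    show "\<forall>\<beta>\<in>Orb. \<forall>\<beta>'\<in>Orb. \<beta> \<noteq> \<beta>' \<longrightarrow> tuples n \<beta> \<inter> tuples n \<beta>' = {}"
      using tuples_unique by blast
  qed (use finite_Orb finite_tuples_Orb in auto)
  moreover have "(\<Sum>l\<in>T. v l) = (\<Sum>\<gamma>\<in>lab ` T. ge \<gamma>)"
  proof -
    have "v l = 0" if "l \<in> T - rep ` lab ` T" for l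
    proof -
      have "rep (lab l) \<in> rep ` lab ` T" using that by blast
      then have "rep (lab l) \<noteq> l" using that by force
      then show ?thesis by (simp add: v_def)
    qed
    moreover have "rep ` lab ` T \<subseteq> T"
      using rep_T(1) by blast
    ultimately have "(\<Sum>l\<in>T. v l) = (\<Sum>l\<in>rep ` lab ` T. v l)"
      using finite_T by (intro sum.mono_neutral_right) blast+
    also have "inj_on rep (lab ` T)"
      using rep_T(2) by (intro inj_on_inverseI[of _ lab]) blast
    then have "(\<Sum>l\<in>rep ` lab ` T. v l) = (\<Sum>\<gamma>\<in>lab ` T. v (rep \<gamma>))"
      by (simp add: sum.reindex)
    also have "\<dots> = (\<Sum>\<gamma>\<in>lab ` T. ge \<gamma>)"
    proof (rule sum.cong)
      fix \<gamma> assume "\<gamma> \<in> lab ` T"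
      then show "v (rep \<gamma>) = ge \<gamma>"
        using rep_T(2) unfolding v_def by auto
    qed simp
    finally show ?thesis .
  qed
  ultimately have "x * (\<Sum>\<gamma>\<in>lab ` T. ge \<gamma>) \<in> fix_ideal"
    by (simp add: sum_distrib_left[symmetric])
  moreover have "x * (\<Sum>\<gamma>\<in>lab ` T. ge \<gamma>) - x * 1 \<in> fix_ideal"
    by (intro P.mem_left_diff fix_rel klr_rels.idem_sum x)
  ultimately show ?thesis
    using P.mem_diff by fastforce
qed

end

section \<open>The direct sum over the orbit\<close>

lemma free_alg_minus:
  assumes "y \<in> carrier (free_alg G)"
  shows "x \<ominus>\<^bsub>free_alg G\<^esub> y = x - y"
proof -
  interpret ring "free_alg G" by (rule ring_free_alg)
  have "\<ominus>\<^bsub>free_alg G\<^esub> y = - y"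
    using assms by (intro minus_equality) (simp_all add: free_alg_uminus)
  then show ?thesis by (simp add: a_minus_def)
qed

text \<open>The additional parameter fixes the coefficient field, so that the algebras can be
  abbreviated at one type.\<close>

locale quiver_klr = quiver_aut n p E \<sigma> \<alpha> \<Lambda>
  for n p :: nat and E :: "('k \<times> 'k) set" and \<sigma> :: "'k \<Rightarrow> 'k" and \<alpha> \<Lambda> :: "'k \<Rightarrow> nat" +
  fixes F :: "'f::field itself"
begin

abbreviation fr :: "('k \<Rightarrow> nat) \<Rightarrow> ('f, ((nat \<Rightarrow> 'k) gen, 'f) free) module"
  where "fr \<beta> \<equiv> free_alg (comp_gens n \<beta>)"
abbreviation kl :: "('k \<Rightarrow> nat) \<Rightarrow> ('f, ((nat \<Rightarrow> 'k) gen, 'f) free set) module"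
  where "kl \<beta> \<equiv> klr n E \<beta>"
abbreviation R :: "('f, ('k, 'f) klr_elt) module"
  where "R \<equiv> klr_orb n E \<sigma> \<alpha>"
abbreviation FX :: "('f, ((nat \<Rightarrow> 'k) set gen, 'f) free) module"
  where "FX \<equiv> free_alg FG"
abbreviation ren :: "((nat \<Rightarrow> 'k) gen, 'f) free \<Rightarrow> ((nat \<Rightarrow> 'k) gen, 'f) free"
  where "ren \<equiv> rename (map_gen act_tup)"
abbreviation aut :: "('k, 'f) klr_elt \<Rightarrow> ('k, 'f) klr_elt"
  where "aut \<equiv> orb_aut n \<sigma> \<alpha>"
abbreviation e :: "(nat \<Rightarrow> 'k) \<Rightarrow> ('k, 'f) klr_elt"
  where "e \<equiv> orb_e n E \<sigma> \<alpha>"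

definition cl :: "('k \<Rightarrow> nat) \<Rightarrow> ((nat \<Rightarrow> 'k) gen, 'f) free \<Rightarrow> ((nat \<Rightarrow> 'k) gen, 'f) free set"
  where "cl \<beta> x = comp_ideal \<beta> +>\<^bsub>fr \<beta>\<^esub> x"

lemma comp_ideal_ideal: "ideal (comp_ideal \<beta>) (fr \<beta>)"
  using comp_ideal by (simp add: free_ideal_def)

lemma klr_eq: "kl \<beta> = quot_alg (fr \<beta>) (comp_ideal \<beta>)"
  by (simp add: klr_def pres_alg_def)

lemma scalar_ring_klr: "scalar_ring (kl \<beta>)"
  unfolding klr_eq by (rule scalar_ring.scalar_ring_quot[OF scalar_ring_free comp_ideal_ideal])

lemma cl_hom: "cl \<beta> \<in> alg_hom (fr \<beta>) (kl \<beta>)"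
  unfolding klr_eq cl_def[abs_def]
  using scalar_ring.quot_alg_hom[OF scalar_ring_free comp_ideal_ideal] .

lemmas cl_simps = alg_homE[OF cl_hom, simplified]

lemma cl_zero: "\<zero>\<^bsub>kl \<beta>\<^esub> = cl \<beta> 0"
proof -
  interpret ideal "comp_ideal \<beta>" "fr \<beta>" by (rule comp_ideal_ideal)
  show ?thesis
    using a_coset_add_zero[OF a_subset] by (simp add: klr_eq quot_alg_def FactRing_def cl_def)
qed

lemma carrier_klr: "carrier (kl \<beta>) = cl \<beta> ` carrier (fr \<beta>)"
  unfolding klr_eq cl_def[abs_def] by (rule scalar_ring.carrier_quot_alg[OF scalar_ring_free])

lemma cl_eq_iff: "x \<in> carrier (fr \<beta>) \<Longrightarrow> y \<in> carrier (fr \<beta>) \<Longrightarrow> cl \<beta> x = cl \<beta> y \<longleftrightarrow> x - y \<in> comp_ideal \<beta>"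
  unfolding cl_def by (simp add: scalar_ring.quot_alg_eq_iff[OF scalar_ring_free comp_ideal_ideal] free_alg_minus)

text \<open>Representatives in the free algebras for all components of an element of
  \<open>R\<close> at once. Values outside the orbit of compositions are arbitrary, since
  \<open>CL\<close> discards them.\<close>

definition families :: "(('k \<Rightarrow> nat) \<Rightarrow> ((nat \<Rightarrow> 'k) gen, 'f) free) set"
  where "families = {z. \<forall>\<beta>\<in>Orb. z \<beta> \<in> carrier (fr \<beta>)}"

definition CL :: "(('k \<Rightarrow> nat) \<Rightarrow> ((nat \<Rightarrow> 'k) gen, 'f) free) \<Rightarrow> ('k, 'f) klr_elt"
  where "CL z = (\<lambda>\<beta>\<in>Orb. cl \<beta> (z \<beta>))"

lemma familiesI: "(\<And>\<beta>. \<beta> \<in> Orb \<Longrightarrow> z \<beta> \<in> carrier (fr \<beta>)) \<Longrightarrow> z \<in> families"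
  by (simp add: families_def)

lemma familiesD: "z \<in> families \<Longrightarrow> \<beta> \<in> Orb \<Longrightarrow> z \<beta> \<in> carrier (fr \<beta>)"
  by (simp add: families_def)

lemma families_closed:
  assumes "z \<in> families" and "z' \<in> families"
  shows "(\<lambda>\<beta>. z \<beta> + z' \<beta>) \<in> families" "(\<lambda>\<beta>. z \<beta> * z' \<beta>) \<in> families" "(\<lambda>\<beta>. - z \<beta>) \<in> families"
    "(\<lambda>\<beta>. z \<beta> - z' \<beta>) \<in> families" "(\<lambda>\<beta>. z \<beta> ^ m) \<in> families"
  using assms by (simp_all add: families_def free_alg_closed)

lemma scalar_ring_R: "scalar_ring R"
  unfolding klr_orb_def by (rule scalar_ring_prod) (rule scalar_ring_klr)

sublocale R: scalar_ring R
  by (rule scalar_ring_R)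

lemma carrier_R: "carrier R = CL ` families"
proof
  show "CL ` families \<subseteq> carrier R"
    by (auto simp: klr_orb_def prod_alg_def CL_def PiE_iff carrier_klr familiesD)
  show "carrier R \<subseteq> CL ` families"
  proof
    fix X assume "X \<in> carrier R"
    then have X: "X \<in> (\<Pi>\<^sub>E \<beta>\<in>Orb. cl \<beta> ` carrier (fr \<beta>))"
      by (simp add: klr_orb_def prod_alg_def carrier_klr)
    then have "\<forall>\<beta>\<in>Orb. \<exists>x\<in>carrier (fr \<beta>). X \<beta> = cl \<beta> x"
      by (auto simp: PiE_iff)
    then obtain z where z: "\<forall>\<beta>\<in>Orb. z \<beta> \<in> carrier (fr \<beta>) \<and> X \<beta> = cl \<beta> (z \<beta>)"
      by metis
    then have "X = CL z"
      using X by (auto simp: CL_def PiE_iff extensional_def fun_eq_iff)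
    then show "X \<in> CL ` families"
      using z by (auto simp: families_def)
  qed
qed

lemma CL_closed: "z \<in> families \<Longrightarrow> CL z \<in> carrier R"
  by (simp add: carrier_R)

lemma CL_mult: "z \<in> families \<Longrightarrow> z' \<in> families \<Longrightarrow> CL z \<otimes>\<^bsub>R\<^esub> CL z' = CL (\<lambda>\<beta>. z \<beta> * z' \<beta>)"
  by (auto simp: klr_orb_def prod_alg_def CL_def fun_eq_iff cl_simps familiesD)

lemma CL_add: "z \<in> families \<Longrightarrow> z' \<in> families \<Longrightarrow> CL z \<oplus>\<^bsub>R\<^esub> CL z' = CL (\<lambda>\<beta>. z \<beta> + z' \<beta>)"
  by (auto simp: klr_orb_def prod_alg_def CL_def fun_eq_iff cl_simps familiesD)

lemma CL_one: "\<one>\<^bsub>R\<^esub> = CL (\<lambda>_. 1)"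
  by (auto simp: klr_orb_def prod_alg_def CL_def fun_eq_iff cl_simps)

lemma CL_zero: "\<zero>\<^bsub>R\<^esub> = CL (\<lambda>_. 0)"
  by (auto simp: klr_orb_def prod_alg_def CL_def fun_eq_iff cl_zero)

lemma CL_smult: "z \<in> families \<Longrightarrow> c \<odot>\<^bsub>R\<^esub> CL z = CL (\<lambda>\<beta>. Poly_Mapping.single [] c * z \<beta>)"
  by (auto simp: klr_orb_def prod_alg_def CL_def fun_eq_iff cl_simps familiesD)

lemma CL_uminus:
  assumes "z \<in> families"
  shows "\<ominus>\<^bsub>R\<^esub> CL z = CL (\<lambda>\<beta>. - z \<beta>)"
  using assms families_closed[OF assms assms]
  by (intro R.minus_equality) (simp_all add: CL_add CL_zero CL_closed)

lemma CL_eq_iff: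
  "z \<in> families \<Longrightarrow> z' \<in> families \<Longrightarrow> CL z = CL z' \<longleftrightarrow> (\<forall>\<beta>\<in>Orb. z \<beta> - z' \<beta> \<in> comp_ideal \<beta>)"
  using cl_eq_iff[OF familiesD familiesD] by (auto simp: CL_def fun_eq_iff restrict_def)

lemma CL_cong: "(\<And>\<beta>. \<beta> \<in> Orb \<Longrightarrow> z \<beta> = z' \<beta>) \<Longrightarrow> CL z = CL z'"
  by (auto simp: CL_def intro!: restrict_ext)

lemma CL_pow: "z \<in> families \<Longrightarrow> CL z [^]\<^bsub>R\<^esub> (m::nat) = CL (\<lambda>\<beta>. z \<beta> ^ m)"
  by (induction m) (simp_all add: CL_one CL_mult families_closed power_Suc2 del: power_Suc)

text \<open>Serves to turn the annihilators of the components into one ideal of \<open>R\<close>,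
  which can then be compared with the cyclotomic ideal through generators.\<close>

lemma ideal_CL:
  assumes "\<And>\<beta>. \<beta> \<in> Orb \<Longrightarrow> free_ideal (A \<beta>) (comp_gens n \<beta>)"
  shows "ideal (CL ` {z. \<forall>\<beta>\<in>Orb. z \<beta> \<in> A \<beta>}) R"
proof (rule idealI[OF R.ring_axioms])
  let ?A = "{z. \<forall>\<beta>\<in>Orb. z \<beta> \<in> A \<beta>}"
  have fam: "?A \<subseteq> families"
    using free_ideal.mem_carrier[OF assms] by (auto intro: familiesI)
  have famD: "z \<in> families" if "z \<in> ?A" for z
    using fam that by (rule subsetD)
  show "subgroup (CL ` ?A) (add_monoid R)"
  proof (rule R.add.subgroupI)
    have "(\<lambda>_. 0) \<in> ?A"
      by (intro CollectI ballI) (rule free_ideal.mem_zero[OF assms])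
    then have "CL (\<lambda>_. 0) \<in> CL ` ?A"
      by (rule imageI)
    then show "CL ` ?A \<noteq> {}"
      by blast
    show "CL ` ?A \<subseteq> carrier R" using fam by (auto simp: carrier_R)
    fix X assume "X \<in> CL ` ?A"
    then obtain z where z: "z \<in> ?A" "X = CL z" by blast
    have mem: "z \<beta> \<in> A \<beta>" if "\<beta> \<in> Orb" for \<beta>
      using z(1) that by blast
    have "(\<lambda>\<beta>. - z \<beta>) \<in> ?A"
      by (intro CollectI ballI free_ideal.mem_uminus[OF assms] mem)
    moreover have "\<ominus>\<^bsub>R\<^esub> X = CL (\<lambda>\<beta>. - z \<beta>)"
      unfolding z(2) by (rule CL_uminus[OF famD[OF z(1)]])
    ultimately show "\<ominus>\<^bsub>R\<^esub> X \<in> CL ` ?A"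
      by (simp only: imageI)
    fix Y assume "Y \<in> CL ` ?A"
    then obtain z' where z': "z' \<in> ?A" "Y = CL z'" by blast
    have mem': "z' \<beta> \<in> A \<beta>" if "\<beta> \<in> Orb" for \<beta>
      using z'(1) that by blast
    have "(\<lambda>\<beta>. z \<beta> + z' \<beta>) \<in> ?A"
      by (intro CollectI ballI free_ideal.mem_add[OF assms] mem mem')
    moreover have "X \<oplus>\<^bsub>R\<^esub> Y = CL (\<lambda>\<beta>. z \<beta> + z' \<beta>)"
      unfolding z(2) z'(2) by (rule CL_add[OF famD[OF z(1)] famD[OF z'(1)]])
    ultimately show "X \<oplus>\<^bsub>R\<^esub> Y \<in> CL ` ?A"
      by (simp only: imageI)
  qed
  fix X Y assume "X \<in> CL ` ?A" and "Y \<in> carrier R"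
  then obtain z z' where z: "z \<in> ?A" "X = CL z" and z': "z' \<in> families" "Y = CL z'"
    unfolding carrier_R by blast
  have mem: "z \<beta> \<in> A \<beta>" if "\<beta> \<in> Orb" for \<beta>
    using z(1) that by blast
  have "(\<lambda>\<beta>. z \<beta> * z' \<beta>) \<in> ?A"
    by (intro CollectI ballI free_ideal.mem_right[OF assms] mem familiesD[OF z'(1)])
  moreover have "(\<lambda>\<beta>. z' \<beta> * z \<beta>) \<in> ?A"
    by (intro CollectI ballI free_ideal.mem_left[OF assms] mem familiesD[OF z'(1)])
  moreover have "X \<otimes>\<^bsub>R\<^esub> Y = CL (\<lambda>\<beta>. z \<beta> * z' \<beta>)" "Y \<otimes>\<^bsub>R\<^esub> X = CL (\<lambda>\<beta>. z' \<beta> * z \<beta>)"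
    unfolding z(2) z'(2) using famD[OF z(1)] z'(1) by (simp_all add: CL_mult)
  ultimately show "X \<otimes>\<^bsub>R\<^esub> Y \<in> CL ` ?A" "Y \<otimes>\<^bsub>R\<^esub> X \<in> CL ` ?A"
    by (simp_all only: imageI)
qed

definition phi :: "((nat \<Rightarrow> 'k) set gen, 'f) free \<Rightarrow> ('k, 'f) klr_elt"
  where "phi x = CL (\<lambda>\<beta>. subst (fixsub \<beta>) x)"

lemma phi_family: "x \<in> carrier FX \<Longrightarrow> (\<lambda>\<beta>. subst (fixsub \<beta>) x) \<in> families"
  by (intro familiesI fixsub_closed)

lemma phi_hom: "phi \<in> alg_hom FX R"
  unfolding phi_def
  by (rule alg_homI) (simp_all add: CL_closed phi_family CL_mult CL_add CL_one CL_smult)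

lemmas phi_simps = alg_homE[OF phi_hom, simplified]

lemma ren_hom: "ren \<in> alg_hom (fr (inv_comp \<beta>)) (fr \<beta>)"
proof -
  have "ren x \<in> carrier (fr \<beta>)" if "x \<in> carrier (fr (inv_comp \<beta>))" for x
    using rename_closed[OF that] by simp
  then show ?thesis
    by (intro alg_homI) (simp_all add: rename_eq_subst)
qed

lemma ren_family: "z \<in> families \<Longrightarrow> (\<lambda>\<beta>. ren (z (inv_comp \<beta>))) \<in> families"
  using familiesD[OF _ inv_comp_Orb] alg_homE(1)[OF ren_hom] by (intro familiesI) blast

text \<open>Images of cosets reduce to renamed representatives because renaming maps the relation
  ideal of one component onto that of the next, not merely into it.\<close>

lemma aut_CL: "z \<in> families \<Longrightarrow> aut (CL z) = CL (\<lambda>\<beta>. ren (z (inv_comp \<beta>)))"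
  unfolding orb_aut_def CL_def cl_def
  using scalar_ring.image_coset[OF scalar_ring_free scalar_ring_free ren_hom comp_ideal_ideal comp_ideal_ideal
      rename_ideal_eq familiesD[OF _ inv_comp_Orb]]
  by (intro restrict_ext) (simp add: inv_comp_Orb)

lemma aut_hom: "aut \<in> alg_hom R R"
proof (rule alg_homI)
  show "aut \<one>\<^bsub>R\<^esub> = \<one>\<^bsub>R\<^esub>"
    by (simp add: CL_one aut_CL familiesI free_alg_one rename_eq_subst)
  fix X Y c
  assume "X \<in> carrier R"
  then obtain z where z: "z \<in> families" "X = CL z"
    by (auto simp: carrier_R)
  show "aut X \<in> carrier R"
    using z by (simp add: aut_CL CL_closed ren_family)
  have "(\<lambda>\<beta>. Poly_Mapping.single [] c * z \<beta>) \<in> families"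
    using z by (auto intro!: familiesI free_alg_closed dest: familiesD)
  then show "aut (c \<odot>\<^bsub>R\<^esub> X) = c \<odot>\<^bsub>R\<^esub> aut X"
    using z by (simp add: CL_smult aut_CL ren_family) (simp add: rename_eq_subst)
  assume "Y \<in> carrier R"
  then obtain z' where z': "z' \<in> families" "Y = CL z'"
    by (auto simp: carrier_R)
  show "aut (X \<otimes>\<^bsub>R\<^esub> Y) = aut X \<otimes>\<^bsub>R\<^esub> aut Y" "aut (X \<oplus>\<^bsub>R\<^esub> Y) = aut X \<oplus>\<^bsub>R\<^esub> aut Y"
    using z z' by (simp_all add: CL_mult CL_add aut_CL ren_family families_closed) (simp_all add: rename_eq_subst)
qed

section \<open>Fixed points\<close>

lemma mem_tuples_inv:
  assumes "k \<in> extensional {1..n}"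
  shows "k \<in> tuples n (inv_comp \<beta>) \<longleftrightarrow> act_tup k \<in> tuples n \<beta>"
proof
  show "k \<in> tuples n (inv_comp \<beta>) \<Longrightarrow> act_tup k \<in> tuples n \<beta>"
    using tup_act_tuples[OF bij, of k n "inv_comp \<beta>"] by simp
  show "act_tup k \<in> tuples n \<beta> \<Longrightarrow> k \<in> tuples n (inv_comp \<beta>)"
    using tup_act_tuples[of "inv_into UNIV \<sigma>" "act_tup k" n \<beta>] bij assms
    by (simp add: bij_imp_bij_inv inv_tup_act)
qed

lemma act_tup_lab_image:
  assumes k: "k \<in> T"
  shows "act_tup ` (lab k \<inter> tuples n (inv_comp \<beta>)) = lab k \<inter> tuples n \<beta>"
proof -
  have ext: "l \<in> extensional {1..n}" if "l \<in> lab k" for l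
    using that lab_T[OF k] T_ext by blast
  have act: "act_tup l \<in> lab k" if "l \<in> lab k" for l
    using cyc_orbit_funpow[of 1 act_tup l] lab_eq_iff[OF k, of l] that by simp
  have "l \<in> act_tup ` lab k" if "l \<in> lab k" for l
  proof -
    have "(act_tup ^^ p) l = l"
      using that lab_T[OF k] lab_order by blast
    then have "act_tup ((act_tup ^^ (p - 1)) l) = l"
      using p by (metis Suc_diff_1 Suc_le_eq One_nat_def comp_apply funpow.simps(2))
    moreover have "(act_tup ^^ (p - 1)) l \<in> lab k"
      using cyc_orbit_funpow[of "p - 1" act_tup l] lab_eq_iff[OF k, of l] that by simp
    ultimately show ?thesis by (metis image_eqI)
  qed
  then show ?thesis
    using act mem_tuples_inv[OF ext] by fastforce
qed

text \<open>The reason why the image of \<open>phi\<close> is fixed: an orbit of tuples is stable,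
  so renaming moves its part in one component onto its part in the next.\<close>

lemma ren_fixsub:
  assumes "x \<in> carrier FX"
  shows "ren (subst (fixsub (inv_comp \<beta>)) x) = subst (fixsub \<beta>) x"
  using assms
proof (induction x rule: free_alg_induct)
  case (var g x)
  have "ren (fixsub (inv_comp \<beta>) g) = fixsub \<beta> g"
  proof (cases g)
    case (E_gen \<gamma>)
    then obtain k where k: "k \<in> T" "\<gamma> = lab k"
      using var(1) by (auto simp: fix_gens_def klr_gens_def tuple_orbits_eq)
    have "inj_on act_tup (\<gamma> \<inter> tuples n (inv_comp \<beta>))"
      using inj_on_subset[OF inj_on_act_tup] by blast
    then show ?thesis
      using sum.reindex[of act_tup "\<gamma> \<inter> tuples n (inv_comp \<beta>)" "ge :: _ \<Rightarrow> ((nat \<Rightarrow> 'k) gen, 'f) free"]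
      by (simp add: E_gen k(2) act_tup_lab_image[OF k(1)] rename_eq_subst)
  qed (simp_all add: rename_eq_subst)
  then show ?case
    using var by (simp add: rename_eq_subst)
qed (simp_all add: rename_eq_subst)

lemma aut_phi: "x \<in> carrier FX \<Longrightarrow> aut (phi x) = phi x"
  by (simp add: phi_def aut_CL phi_family ren_fixsub)

lemma aut_funpow_CL:
  assumes "z \<in> families"
  shows "(\<lambda>\<beta>. (ren ^^ i) (z ((inv_comp ^^ i) \<beta>))) \<in> families \<and>
    (aut ^^ i) (CL z) = CL (\<lambda>\<beta>. (ren ^^ i) (z ((inv_comp ^^ i) \<beta>)))"
proof (induction i)
  case (Suc i)
  then show ?case
    using ren_family[of "\<lambda>\<beta>. (ren ^^ i) (z ((inv_comp ^^ i) \<beta>))"] aut_CL by (simp add: funpow_swap1)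
qed (use assms in simp)

lemma ren_funpow:
  "(ren ^^ i) 0 = 0" "(ren ^^ i) 1 = 1" "(ren ^^ i) (x + y) = (ren ^^ i) x + (ren ^^ i) y"
  "(ren ^^ i) (x * y) = (ren ^^ i) x * (ren ^^ i) y"
  "(ren ^^ i) (Poly_Mapping.single [] c) = Poly_Mapping.single [] c"
  "(ren ^^ i) (gy a) = gy a" "(ren ^^ i) (gpsi a) = gpsi a" "(ren ^^ i) (ge k) = ge ((act_tup ^^ i) k)"
  by (induction i) (simp_all add: rename_eq_subst)

lemma ren_order:
  assumes "\<beta> \<in> Orb" and "x \<in> carrier (fr \<beta>)"
  shows "(ren ^^ p) x = x"
  using assms(2)
proof (induction x rule: free_alg_induct)
  case (var g x)
  then show ?case
    by (auto simp: klr_gens_def ren_funpow lab_order[OF T_I[OF assms(1)]])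
qed (simp_all add: ren_funpow)

lemma aut_order:
  assumes "X \<in> carrier R"
  shows "(aut ^^ p) X = X"
proof -
  obtain z where z: "z \<in> families" "X = CL z"
    using assms by (auto simp: carrier_R)
  have "(inv_comp ^^ p) \<beta> = \<beta>" for \<beta>
    using quiver_aut.comp_order[OF inverse] .
  then have "CL (\<lambda>\<beta>. (ren ^^ p) (z ((inv_comp ^^ p) \<beta>))) = CL z"
    using ren_order familiesD[OF z(1)] by (intro CL_cong) simp
  then show ?thesis
    using aut_funpow_CL[OF z(1), of p] z(2) by simp
qed

text \<open>The inverse of \<open>aut\<close> is a power of it, so stability gives equality, as
  required for images of cosets to be cosets.\<close>

lemma aut_image_ideal:
  assumes "I \<subseteq> carrier R" and "aut ` I \<subseteq> I"
  shows "aut ` I = I"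
proof
  show "I \<subseteq> aut ` I"
  proof
    fix X assume X: "X \<in> I"
    have "(aut ^^ i) X \<in> I" for i
      using X assms(2) by (induction i) auto
    then have "aut ((aut ^^ (p - 1)) X) \<in> aut ` I"
      by (rule imageI)
    moreover have "aut ((aut ^^ (p - 1)) X) = (aut ^^ Suc (p - 1)) X"
      by simp
    moreover have "(aut ^^ Suc (p - 1)) X = X"
      using aut_order[OF subsetD[OF assms(1) X]] p by (simp del: funpow.simps)
    ultimately show "X \<in> aut ` I" by simp
  qed
qed (rule assms(2))

definition e_family :: "(nat \<Rightarrow> 'k) \<Rightarrow> ('k \<Rightarrow> nat) \<Rightarrow> ((nat \<Rightarrow> 'k) gen, 'f) free"
  where "e_family k \<beta> = (if k \<in> tuples n \<beta> then ge k else 0)"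

lemma e_family: "e_family k \<in> families"
  by (auto simp: e_family_def families_def free_alg_zero klr_gens_carrier)

lemma e_eq: "e k = CL (e_family k)"
  unfolding orb_e_def CL_def
  by (intro restrict_ext) (simp add: e_family_def cl_zero, simp add: pres_gen_def cl_def)

lemma e_closed: "e k \<in> carrier R"
  by (simp add: e_eq CL_closed e_family)

lemma aut_e: "k \<in> T \<Longrightarrow> aut (e k) = e (act_tup k)"
  unfolding e_eq aut_CL[OF e_family]
  by (intro CL_cong) (simp add: e_family_def mem_tuples_inv[OF T_ext] rename_eq_subst)

lemma orb_y_eq: "orb_y n E \<sigma> \<alpha> a = CL (\<lambda>_. gy a)"
  by (simp add: orb_y_def CL_def cl_def pres_gen_def)

lemma orb_psi_eq: "orb_psi n E \<sigma> \<alpha> a = CL (\<lambda>_. gpsi a)"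
  by (simp add: orb_psi_def CL_def cl_def pres_gen_def)

lemma finsum_e:
  assumes "finite D"
  shows "(\<Oplus>\<^bsub>R\<^esub>k\<in>D. e k) = CL (\<lambda>\<beta>. \<Sum>k\<in>D \<inter> tuples n \<beta>. ge k)"
  using assms
proof (induction D rule: finite_induct)
  case empty
  then show ?case by (simp add: CL_zero)
next
  case (insert k D)
  have fam: "(\<lambda>\<beta>. \<Sum>k\<in>D \<inter> tuples n \<beta>. ge k) \<in> families"
    by (auto intro!: familiesI free_alg_sum klr_gens_carrier)
  have "(\<Oplus>\<^bsub>R\<^esub>k\<in>insert k D. e k) = e k \<oplus>\<^bsub>R\<^esub> (\<Oplus>\<^bsub>R\<^esub>k\<in>D. e k)"
    using insert e_closed by (intro R.finsum_insert) auto
  also have "\<dots> = CL (\<lambda>\<beta>. e_family k \<beta> + (\<Sum>k\<in>D \<inter> tuples n \<beta>. ge k))"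
    by (simp add: insert.IH e_eq[of k] CL_add e_family fam)
  also have "\<dots> = CL (\<lambda>\<beta>. \<Sum>k\<in>insert k D \<inter> tuples n \<beta>. ge k)"
    using insert by (intro CL_cong) (simp add: e_family_def Int_insert_left)
  finally show ?case .
qed

lemma orb_idem_eq: "k \<in> T \<Longrightarrow> orb_idem n E \<sigma> \<alpha> (lab k) = phi (ge (lab k))"
  by (simp add: orb_idem_def finsum_e finite_lab phi_def)

lemma phi_y: "phi (gy a) = orb_y n E \<sigma> \<alpha> a"
  by (simp add: phi_def orb_y_eq)

lemma phi_psi: "phi (gpsi a) = orb_psi n E \<sigma> \<alpha> a"
  by (simp add: phi_def orb_psi_eq)

text \<open>Induction adding letters on the left. The second congruence is the invariant: the
  product built so far lies in a single left idempotent \<open>ge k'\<close>, which y preserves and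
  \<psi> moves to \<open>swap a k'\<close>. Hence idempotent letters never have to be expressed
  through orbit idempotents, which would be impossible one by one.\<close>

lemma word_times_idem:
  assumes \<beta>: "\<beta> \<in> Orb" and k: "k \<in> tuples n \<beta>" and "w \<in> lists (comp_gens n \<beta>)"
  shows "\<exists>u\<in>carrier FX. \<exists>k'\<in>tuples n \<beta>.
    Poly_Mapping.single w 1 * ge k - subst (fixsub \<beta>) u * ge k \<in> comp_ideal \<beta> \<and>
    ge k' * (subst (fixsub \<beta>) u * ge k) - subst (fixsub \<beta>) u * ge k \<in> (comp_ideal \<beta> :: ((nat \<Rightarrow> 'k) gen, 'f) free set)"
  using assms(3)
proof (induction w)
  interpret I: free_ideal "comp_ideal \<beta> :: ((nat \<Rightarrow> 'k) gen, 'f) free set" "comp_gens n \<beta>"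
    by (rule comp_ideal)
  let ?I = "comp_ideal \<beta> :: ((nat \<Rightarrow> 'k) gen, 'f) free set"
  {
    case Nil
    have "ge k * ge k - ge k \<in> ?I"
      using comp_rel[OF klr_rels.idem_mult[OF k k, where lab = "\<lambda>k. k"]] by simp
    then show ?case
      using k by (intro bexI[of _ 1] bexI[of _ k]) (simp_all add: single_Nil_one I.mem_zero free_alg_one)
  next
    case (Cons g w)
    then obtain u k' where u: "u \<in> carrier FX" and k': "k' \<in> tuples n \<beta>"
      and 1: "Poly_Mapping.single w 1 * ge k - subst (fixsub \<beta>) u * ge k \<in> ?I"
      and 2: "ge k' * (subst (fixsub \<beta>) u * ge k) - subst (fixsub \<beta>) u * ge k \<in> ?I"
      by auto
    let ?S = "subst (fixsub \<beta>) u * ge k"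
    have S: "?S \<in> carrier (fr \<beta>)"
      using u k by (simp add: free_alg_mult fixsub_closed klr_gens_carrier)
    have g: "g \<in> comp_gens n \<beta>" using Cons by simp
    have 3: "Poly_Mapping.single (g # w) 1 * ge k - var g * ?S \<in> ?I"
    proof -
      have "Poly_Mapping.single (g # w) 1 = var g * (Poly_Mapping.single w 1 :: ((nat \<Rightarrow> 'k) gen, 'f) free)"
        by (simp add: var_def mult_single plus_list_def)
      then show ?thesis
        using I.mem_left_diff[OF 1 free_alg_var[OF g]] by (simp add: mult.assoc)
    qed
    show ?case
    proof (cases g)
      case (E_gen l)
      then have l: "l \<in> tuples n \<beta>" using g by (auto simp: klr_gens_def)
      show ?thesis
      proof (cases "l = k'")
        case True
        then have "Poly_Mapping.single (g # w) 1 * ge k - ?S \<in> ?I"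
          using I.mem_trans[OF 3] 2 E_gen by simp
        then show ?thesis using u k' 2 by blast
      next
        case False
        have "ge l * ge k' * ?S \<in> ?I"
          using I.mem_right[OF comp_rel[OF klr_rels.idem_mult[OF l k', where lab = "\<lambda>k. k"]] S] False by simp
        moreover have "ge l * (ge k' * ?S) - ge l * ?S \<in> ?I"
          using I.mem_left_diff[OF 2] l by (simp add: klr_gens_carrier)
        ultimately have "ge l * ?S \<in> ?I"
          using I.mem_diff[of "ge l * (ge k' * ?S)" "ge l * (ge k' * ?S) - ge l * ?S"] by (simp add: mult.assoc)
        then have "Poly_Mapping.single (g # w) 1 * ge k \<in> ?I"
          using I.mem_add[OF 3, of "ge l * ?S"] E_gen by simp
        \<comment> \<open>The product vanishes, so the witness is 0, and the invariant holds for any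
          tuple; k is one at hand.\<close>
        then show ?thesis
          using k by (intro bexI[of _ 0] bexI[of _ k]) (simp_all add: I.mem_zero free_alg_zero)
      qed
    next
      case (Y_gen a)
      then have a: "a \<in> {1..n}" using g by (auto simp: klr_gens_def)
      have "gy a * ge k' * ?S - ge k' * gy a * ?S \<in> ?I"
        by (rule I.mem_right_diff[OF comp_rel[OF klr_rels.y_idem[OF k' a, where lab = "\<lambda>k. k"]] S])
      then have "ge k' * (gy a * ?S) - gy a * (ge k' * ?S) \<in> ?I"
        using I.mem_uminus by (fastforce simp: mult.assoc)
      moreover have "gy a * (ge k' * ?S) - gy a * ?S \<in> ?I"
        using I.mem_left_diff[OF 2] a by (simp add: klr_gens_carrier)
      ultimately have "ge k' * (gy a * ?S) - gy a * ?S \<in> ?I"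
        by (rule I.mem_trans)
      then show ?thesis
        using u k' 3 a Y_gen by (intro bexI[of _ "gy a * u"] bexI[of _ k'])
          (simp_all add: mult.assoc free_alg_mult FG_carrier)
    next
      case (Psi_gen a)
      then have a: "a \<in> {1..<n}" using g by (auto simp: klr_gens_def)
      let ?k = "swap a k'"
      have "gpsi a * ge k' * ?S - ge ?k * gpsi a * ?S \<in> ?I"
        by (rule I.mem_right_diff[OF comp_rel[OF klr_rels.psi_idem[OF k' a, where lab = "\<lambda>k. k"]] S])
      then have "ge ?k * (gpsi a * ?S) - gpsi a * (ge k' * ?S) \<in> ?I"
        using I.mem_uminus by (fastforce simp: mult.assoc)
      moreover have "gpsi a * (ge k' * ?S) - gpsi a * ?S \<in> ?I"
        using I.mem_left_diff[OF 2] a by (simp add: klr_gens_carrier)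
      ultimately have "ge ?k * (gpsi a * ?S) - gpsi a * ?S \<in> ?I"
        by (rule I.mem_trans)
      then show ?thesis
        using u swap_tuples[OF k' a] 3 a Psi_gen by (intro bexI[of _ "gpsi a * u"] bexI[of _ ?k])
          (simp_all add: mult.assoc free_alg_mult FG_carrier)
    qed
  }
qed

lemma elt_times_idem:
  assumes \<beta>: "\<beta> \<in> Orb" and k: "k \<in> tuples n \<beta>" and "x \<in> carrier (fr \<beta>)"
  shows "\<exists>u\<in>carrier FX. x * ge k - subst (fixsub \<beta>) u * ge k \<in> comp_ideal \<beta>"
  using assms(3)
proof (induction x rule: free_alg_induct_words)
  interpret I: free_ideal "comp_ideal \<beta> :: ((nat \<Rightarrow> 'k) gen, 'f) free set" "comp_gens n \<beta>"
    by (rule comp_ideal)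
  {
    case zero
    show ?case by (intro bexI[of _ 0]) (simp_all add: I.mem_zero free_alg_zero)
  next
    case (add x y)
    then obtain u u' where u: "u \<in> carrier FX" "x * ge k - subst (fixsub \<beta>) u * ge k \<in> comp_ideal \<beta>"
      and u': "u' \<in> carrier FX" "y * ge k - subst (fixsub \<beta>) u' * ge k \<in> comp_ideal \<beta>" by auto
    then show ?case
      using I.mem_add[OF u(2) u'(2)] by (intro bexI[of _ "u + u'"]) (simp_all add: free_alg_add algebra_simps)
  next
    case (word w c)
    let ?c = "Poly_Mapping.single [] c :: ((nat \<Rightarrow> 'k) gen, 'f) free"
    obtain u where u: "u \<in> carrier FX"
      "Poly_Mapping.single w 1 * ge k - subst (fixsub \<beta>) u * ge k \<in> (comp_ideal \<beta> :: ((nat \<Rightarrow> 'k) gen, 'f) free set)"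
      using word_times_idem[OF \<beta> k word] by blast
    have "Poly_Mapping.single w c = ?c * Poly_Mapping.single w 1"
      by (simp add: mult_single plus_list_def)
    moreover have "?c * (Poly_Mapping.single w 1 * ge k) - ?c * (subst (fixsub \<beta>) u * ge k) \<in> comp_ideal \<beta>"
      by (rule I.mem_left_diff[OF u(2)]) (simp add: free_alg_closed)
    ultimately show ?case
      using u(1) by (intro bexI[of _ "Poly_Mapping.single [] c * u"]) (simp_all add: mult.assoc free_alg_closed)
  }
qed

text \<open>e(k) is concentrated in the component of k, so a u found there serves in every other
  component, where both sides vanish.\<close>

lemma R_times_idem:
  assumes X: "X \<in> carrier R" and k: "k \<in> T"
  shows "\<exists>u\<in>carrier FX. X \<otimes>\<^bsub>R\<^esub> e k = phi u \<otimes>\<^bsub>R\<^esub> e k"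
proof -
  obtain z where z: "z \<in> families" "X = CL z"
    using X by (auto simp: carrier_R)
  obtain \<beta> where \<beta>: "\<beta> \<in> Orb" "k \<in> tuples n \<beta>"
    using k by (auto simp: orbit_tuples_def)
  obtain u where u: "u \<in> carrier FX" "z \<beta> * ge k - subst (fixsub \<beta>) u * ge k \<in> comp_ideal \<beta>"
    using elt_times_idem[OF \<beta> familiesD[OF z(1) \<beta>(1)]] by blast
  have "z \<beta>' * e_family k \<beta>' - subst (fixsub \<beta>') u * e_family k \<beta>' \<in> comp_ideal \<beta>'" for \<beta>'
    using u(2) tuples_unique[OF \<beta>(2), of \<beta>'] free_ideal.mem_zero[OF comp_ideal]
    by (cases "\<beta>' = \<beta>") (auto simp: e_family_def)
  then show ?thesis
    using u(1) z e_family[of k] phi_family[OF u(1)]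
    by (intro bexI[of _ u]) (simp_all add: e_eq phi_def CL_mult CL_eq_iff families_closed)
qed

text \<open>A fixed coset need not a priori contain a fixed element; here one is produced, of the
  form \<open>phi u\<close>. Stating it for an arbitrary stable ideal covers the cyclotomic quotient
  and \<open>R\<close> itself.\<close>

lemma aut_fixed_mod_ideal:
  assumes "ideal A R" and A: "aut ` A \<subseteq> A" and X: "X \<in> carrier R" and fixed: "aut X \<ominus>\<^bsub>R\<^esub> X \<in> A"
  shows "\<exists>u\<in>carrier FX. X \<ominus>\<^bsub>R\<^esub> phi u \<in> A"
proof -
  interpret A: ideal A R by fact
  have one_orbit: "\<exists>u\<in>carrier FX. X \<otimes>\<^bsub>R\<^esub> phi (ge (lab k)) \<ominus>\<^bsub>R\<^esub> phi u \<in> A" if k: "k \<in> T" for k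
  proof -
    obtain u where u: "u \<in> carrier FX" "X \<otimes>\<^bsub>R\<^esub> e k = phi u \<otimes>\<^bsub>R\<^esub> e k"
      using R_times_idem[OF X k] by blast
    have T: "(act_tup ^^ i) k \<in> T" for i
      using k lab_T[OF k] by (auto simp: cyc_orbit_def)
    \<comment> \<open>The u found for the single tuple k works for its whole orbit, since
      \<open>phi u\<close> is fixed and X is fixed modulo \<open>A\<close>.\<close>
    have "(X \<ominus>\<^bsub>R\<^esub> phi u) \<otimes>\<^bsub>R\<^esub> e ((act_tup ^^ i) k) \<in> A" for i
      using A.fixed_mod_ideal[OF alg_homE(6)[OF aut_hom] A X fixed, of "phi u" "\<lambda>i. e ((act_tup ^^ i) k)" i]
        u by (simp add: phi_simps(1) aut_phi e_closed aut_e[OF T])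
    then have mem: "(X \<ominus>\<^bsub>R\<^esub> phi u) \<otimes>\<^bsub>R\<^esub> e l \<in> A" if "l \<in> lab k" for l
      using that by (auto simp: cyc_orbit_def)
    have "(X \<ominus>\<^bsub>R\<^esub> phi u) \<otimes>\<^bsub>R\<^esub> (\<Oplus>\<^bsub>R\<^esub>l\<in>D. e l) \<in> A" if "finite D" "D \<subseteq> lab k" for D
      using that
    proof (induction D rule: finite_induct)
      case empty
      then show ?case
        using X u by (simp add: phi_simps(1) additive_subgroup.zero_closed[OF A.is_additive_subgroup])
    next
      case (insert l D)
      then have "(\<Oplus>\<^bsub>R\<^esub>l\<in>insert l D. e l) = e l \<oplus>\<^bsub>R\<^esub> (\<Oplus>\<^bsub>R\<^esub>l\<in>D. e l)"
        using e_closed by (intro R.finsum_insert) auto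
      then show ?case
        using insert mem[of l] X u
        by (simp add: R.r_distr phi_simps(1) e_closed R.finsum_closed
            additive_subgroup.a_closed[OF A.is_additive_subgroup])
    qed
    from this[OF finite_lab[OF k] order_refl]
    have "(X \<ominus>\<^bsub>R\<^esub> phi u) \<otimes>\<^bsub>R\<^esub> phi (ge (lab k)) \<in> A"
      using orb_idem_eq[OF k] by (simp add: orb_idem_def)
    \<comment> \<open>Multiplying u by the orbit idempotent confines its effect to this orbit, so
      that the contributions of different orbits can be added.\<close>
    moreover have "(X \<ominus>\<^bsub>R\<^esub> phi u) \<otimes>\<^bsub>R\<^esub> phi (ge (lab k)) =
        X \<otimes>\<^bsub>R\<^esub> phi (ge (lab k)) \<ominus>\<^bsub>R\<^esub> phi (u * ge (lab k))"
      using X u FG_carrier(1)[OF k, where 'a = 'f] by (simp add: phi_simps a_minus_def R.l_distr R.l_minus)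
    ultimately show ?thesis
      using u FG_carrier(1)[OF k] free_alg_mult by metis
  qed
  have "\<exists>u\<in>carrier FX. X \<otimes>\<^bsub>R\<^esub> phi (\<Sum>\<gamma>\<in>\<Gamma>. ge \<gamma>) \<ominus>\<^bsub>R\<^esub> phi u \<in> A" if "finite \<Gamma>" "\<Gamma> \<subseteq> lab ` T" for \<Gamma>
    using that
  proof (induction \<Gamma> rule: finite_induct)
    case empty
    have "phi 0 = \<zero>\<^bsub>R\<^esub>"
      by (simp add: phi_def CL_zero)
    then show ?case
      using X by (intro bexI[of _ 0])
        (simp_all add: free_alg_zero a_minus_def additive_subgroup.zero_closed[OF A.is_additive_subgroup])
  next
    case (insert \<gamma> \<Gamma>)
    then obtain u where u: "u \<in> carrier FX" "X \<otimes>\<^bsub>R\<^esub> phi (\<Sum>\<gamma>\<in>\<Gamma>. ge \<gamma>) \<ominus>\<^bsub>R\<^esub> phi u \<in> A" by auto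
    obtain k where k: "k \<in> T" "\<gamma> = lab k" using insert by auto
    then obtain u' where u': "u' \<in> carrier FX" "X \<otimes>\<^bsub>R\<^esub> phi (ge \<gamma>) \<ominus>\<^bsub>R\<^esub> phi u' \<in> A"
      using one_orbit by blast
    have G: "(\<Sum>\<gamma>\<in>\<Gamma>. ge \<gamma>) \<in> carrier FX" "ge \<gamma> \<in> carrier FX"
      using insert k by (auto intro!: free_alg_sum FG_carrier)
    have carr: "X \<otimes>\<^bsub>R\<^esub> phi (ge \<gamma>) \<in> carrier R" "X \<otimes>\<^bsub>R\<^esub> phi (\<Sum>\<gamma>\<in>\<Gamma>. ge \<gamma>) \<in> carrier R"
      "phi u \<in> carrier R" "phi u' \<in> carrier R"
      using X u u' G by (simp_all add: phi_simps)
    have "X \<otimes>\<^bsub>R\<^esub> phi (\<Sum>\<gamma>\<in>insert \<gamma> \<Gamma>. ge \<gamma>) \<ominus>\<^bsub>R\<^esub> phi (u' + u) =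
        (X \<otimes>\<^bsub>R\<^esub> phi (ge \<gamma>) \<ominus>\<^bsub>R\<^esub> phi u') \<oplus>\<^bsub>R\<^esub> (X \<otimes>\<^bsub>R\<^esub> phi (\<Sum>\<gamma>\<in>\<Gamma>. ge \<gamma>) \<ominus>\<^bsub>R\<^esub> phi u)"
      using insert X u u' G carr by (simp add: phi_simps R.r_distr a_minus_def R.minus_add R.a_ac)
    also have "\<dots> \<in> A"
      using u u' by (intro additive_subgroup.a_closed[OF A.is_additive_subgroup])
    finally show ?case
      using u u' free_alg_add by metis
  qed
  from this[OF finite_imageI[OF finite_T] order_refl]
  obtain u where u: "u \<in> carrier FX" "X \<otimes>\<^bsub>R\<^esub> phi (\<Sum>\<gamma>\<in>lab ` T. ge \<gamma>) \<ominus>\<^bsub>R\<^esub> phi u \<in> A" by blast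
  \<comment> \<open>Relation (F1): after summation over all orbits the factor next to X is
    1.\<close>
  have "phi (\<Sum>\<gamma>\<in>lab ` T. ge \<gamma>) = phi 1"
  proof -
    have "(\<Sum>\<gamma>\<in>lab ` T. ge \<gamma>) \<in> carrier FX"
      by (auto intro!: free_alg_sum FG_carrier)
    then show ?thesis
      unfolding phi_def
      by (simp only: CL_eq_iff phi_family free_alg_one) (intro ballI fixsub_rel[OF klr_rels.idem_sum])
  qed
  then have "phi (\<Sum>\<gamma>\<in>lab ` T. ge \<gamma>) = \<one>\<^bsub>R\<^esub>"
    by (simp add: phi_simps)
  then show ?thesis using u X by auto
qed

end

section \<open>Cyclotomic quotients\<close>

context quiver_klr
begin

abbreviation I :: "('k, 'f) klr_elt set"
  where "I \<equiv> cyc_ideal n E \<sigma> \<alpha> \<Lambda>"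
abbreviation RF :: "('f, ('k, 'f) klr_elt) module"
  where "RF \<equiv> klr_fixed n E \<sigma> \<alpha>"
abbreviation C :: "('f, ('k, 'f) klr_elt set) module"
  where "C \<equiv> cyc_klr n E \<sigma> \<alpha> \<Lambda>"
abbreviation CF :: "('f, ('k, 'f) klr_elt set) module"
  where "CF \<equiv> cyc_klr_fixed n E \<sigma> \<alpha> \<Lambda>"

definition cyc_gen :: "(nat \<Rightarrow> 'k) \<Rightarrow> ('k, 'f) klr_elt"
  where "cyc_gen k = orb_y n E \<sigma> \<alpha> 1 [^]\<^bsub>R\<^esub> \<Lambda> (k 1) \<otimes>\<^bsub>R\<^esub> e k"

lemma gy_family: "a \<in> {1..n} \<Longrightarrow> (\<lambda>\<beta>. gy a ^ m) \<in> families"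
  by (intro familiesI free_alg_power klr_gens_carrier)

lemma cyc_gen_eq: "cyc_gen k = CL (\<lambda>\<beta>. gy 1 ^ \<Lambda> (k 1) * e_family k \<beta>)"
  using n gy_family[of 1] gy_family[of 1 1]
  by (simp add: cyc_gen_def orb_y_eq e_eq CL_pow CL_mult e_family)

lemma cyc_gen_closed: "cyc_gen k \<in> carrier R"
  unfolding cyc_gen_eq using n by (intro CL_closed families_closed(2) gy_family e_family) simp

lemma cyc_ideal_eq: "I = Idl\<^bsub>R\<^esub> (cyc_gen ` T)"
  by (simp add: cyc_ideal_def cyc_gen_def Let_def image_def Setcompr_eq_image)

lemma cyc_ideal_ideal: "ideal I R"
  unfolding cyc_ideal_eq by (rule R.genideal_ideal) (auto simp: cyc_gen_closed)

lemma cyc_gen_mem: "k \<in> T \<Longrightarrow> cyc_gen k \<in> I"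
  unfolding cyc_ideal_eq using R.genideal_self[of "cyc_gen ` T"] cyc_gen_closed by blast

lemma cyc_ideal_carrier: "I \<subseteq> carrier R"
  using cyc_ideal_ideal by (simp add: additive_subgroup.a_subset ideal.axioms(1))

lemma aut_cyc_gen:
  assumes "k \<in> T"
  shows "aut (cyc_gen k) = cyc_gen (act_tup k)"
  unfolding cyc_gen_eq
proof (subst aut_CL)
  show "(\<lambda>\<beta>. gy 1 ^ \<Lambda> (k 1) * e_family k \<beta>) \<in> families"
    using n by (intro families_closed(2) gy_family e_family) simp
  show "CL (\<lambda>\<beta>. ren (gy 1 ^ \<Lambda> (k 1) * e_family k (inv_comp \<beta>)))
      = CL (\<lambda>\<beta>. gy 1 ^ \<Lambda> (act_tup k 1) * e_family (act_tup k) \<beta>)"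
    unfolding Lambda_act
    by (intro CL_cong) (simp add: e_family_def mem_tuples_inv[OF T_ext[OF assms]] rename_eq_subst)
qed

lemma aut_cyc_ideal: "aut ` I = I"
proof (rule aut_image_ideal[OF cyc_ideal_carrier])
  have "I \<subseteq> {X \<in> carrier R. aut X \<in> I}"
    unfolding cyc_ideal_eq
  proof (rule R.genideal_minimal)
    show "ideal {X \<in> carrier R. aut X \<in> Idl\<^bsub>R\<^esub> (cyc_gen ` T)} R"
      using R.ideal_preimage[OF R.ring_axioms alg_homE(6)[OF aut_hom] cyc_ideal_ideal]
      by (simp only: cyc_ideal_eq)
    show "cyc_gen ` T \<subseteq> {X \<in> carrier R. aut X \<in> Idl\<^bsub>R\<^esub> (cyc_gen ` T)}"
      using cyc_gen_mem[OF act_T] by (auto simp: cyc_gen_closed aut_cyc_gen cyc_ideal_eq)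
  qed
  then show "aut ` I \<subseteq> I" by blast
qed

text \<open>The classes of families of annihilating elements form an ideal of \<open>R\<close>. It
  contains the cyclotomic generators, hence all of \<open>I\<close>, so membership in
  \<open>I\<close> forces every component to act as zero.\<close>

lemma phi_mem_cyc_ideal:
  assumes x: "x \<in> carrier FX" and "phi x \<in> I"
  shows "x \<in> fix_ideal"
proof (rule mem_fix_ideal[OF x])
  let ?A = "CL ` {z. \<forall>\<beta>\<in>Orb. z \<beta> \<in> rep_ann \<beta>}"
  have ann: "free_ideal (rep_ann \<beta> :: ((nat \<Rightarrow> 'k) gen, 'f) free set) (comp_gens n \<beta>)" if "\<beta> \<in> Orb" for \<beta>
    using rep_ann_ideal[OF that] .
  have "I \<subseteq> ?A"
    unfolding cyc_ideal_eq
  proof (rule R.genideal_minimal)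
    show "ideal ?A R"
      by (rule ideal_CL) (rule ann)
    show "cyc_gen ` T \<subseteq> ?A"
    proof
      fix X assume "X \<in> cyc_gen ` T"
      then obtain k where k: "k \<in> T" "X = cyc_gen k" by blast
      have "gy 1 ^ \<Lambda> (k 1) * e_family k \<beta> \<in> rep_ann \<beta>" if "\<beta> \<in> Orb" for \<beta>
      proof (cases "k \<in> tuples n \<beta>")
        case True
        show ?thesis
          unfolding e_family_def if_P[OF True] by (rule cyc_ann[OF that True])
      qed (simp add: e_family_def free_ideal.mem_zero[OF ann[OF that]])
      then show "X \<in> ?A"
        unfolding k(2) cyc_gen_eq by (intro imageI CollectI ballI)
    qed
  qed
  then obtain z where z: "\<forall>\<beta>\<in>Orb. z \<beta> \<in> rep_ann \<beta>" "phi x = CL z"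
    using assms(2) by blast
  fix \<beta> assume \<beta>: "\<beta> \<in> Orb"
  interpret A: free_ideal "rep_ann \<beta> :: ((nat \<Rightarrow> 'k) gen, 'f) free set" "comp_gens n \<beta>"
    by (rule ann[OF \<beta>])
  have "z \<in> families"
    using z(1) free_ideal.mem_carrier[OF ann] by (intro familiesI) blast
  \<comment> \<open>The annihilating representative z need not be the one coming from x. The two
    differ by relations, which annihilate as well.\<close>
  then have "subst (fixsub \<beta>) x - z \<beta> \<in> comp_ideal \<beta>"
    using z(2) \<beta> CL_eq_iff[OF phi_family[OF x]] by (simp add: phi_def)
  then have "subst (fixsub \<beta>) x - z \<beta> \<in> rep_ann \<beta>"
    using comp_ideal_ann[OF \<beta>] by blast
  then show "subst (fixsub \<beta>) x \<in> rep_ann \<beta>"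
    using A.mem_add[of "subst (fixsub \<beta>) x - z \<beta>" "z \<beta>"] z(1) \<beta> by simp
qed

section \<open>The fixed algebra and its cyclotomic ideal\<close>

lemma scalar_ring_RF: "scalar_ring RF"
  unfolding klr_fixed_def by (rule scalar_ring_fixed[OF scalar_ring_R aut_hom])

lemma carrier_RF: "carrier RF = {X \<in> carrier R. aut X = X}"
  by (simp add: klr_fixed_def fixed_subalg_def)

lemma RF_ops:
  "mult RF = mult R" "one RF = one R" "add RF = add R" "zero RF = zero R" "smult RF = smult R"
  by (simp_all add: klr_fixed_def fixed_subalg_def)

lemma RF_pow: "x [^]\<^bsub>RF\<^esub> (m::nat) = x [^]\<^bsub>R\<^esub> m"
  by (simp add: nat_pow_def RF_ops)

lemma phi_hom_RF: "phi \<in> alg_hom FX RF"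
  using phi_hom aut_phi by (auto simp: alg_hom_def ring_hom_def carrier_RF RF_ops)

definition fix_gen :: "(nat \<Rightarrow> 'k) \<Rightarrow> ('k, 'f) klr_elt"
  where "fix_gen k = phi (gy 1 ^ \<Lambda> (k 1) * ge (lab k))"

definition J :: "('k, 'f) klr_elt set"
  where "J = Idl\<^bsub>RF\<^esub> (fix_gen ` T)"

lemma fix_gen_eq:
  assumes "k \<in> T"
  shows "orb_y n E \<sigma> \<alpha> 1 [^]\<^bsub>RF\<^esub> \<Lambda> (k 1) \<otimes>\<^bsub>RF\<^esub> orb_idem n E \<sigma> \<alpha> (lab k) = fix_gen k"
proof -
  have 1: "gy 1 \<in> carrier FX" using n by (simp add: FG_carrier)
  have "phi (gy 1) [^]\<^bsub>R\<^esub> m = phi (gy 1 ^ m)" for m :: nat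
    unfolding phi_def using CL_pow[OF phi_family[OF 1]] by simp
  then show ?thesis
    using 1 assms by (simp add: fix_gen_def RF_ops RF_pow phi_y[symmetric] orb_idem_eq
        phi_simps(2) free_alg_power FG_carrier)
qed

lemma fix_gen_closed: "k \<in> T \<Longrightarrow> fix_gen k \<in> carrier RF"
  unfolding fix_gen_def using n by (intro alg_homE(1)[OF phi_hom_RF] free_alg_mult free_alg_power FG_carrier) auto

lemma klr_fixed_cyc_eq: "klr_fixed_cyc n E \<sigma> \<alpha> \<Lambda> = quot_alg RF J"
proof -
  have "{orb_y n E \<sigma> \<alpha> 1 [^]\<^bsub>RF\<^esub> \<Lambda> (k 1) \<otimes>\<^bsub>RF\<^esub> orb_idem n E \<sigma> \<alpha> (lab k) | k. k \<in> T} = fix_gen ` T"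
    using fix_gen_eq by force
  then show ?thesis
    unfolding klr_fixed_cyc_def J_def Let_def by simp
qed

lemma J_ideal: "ideal J RF"
proof -
  interpret RF: scalar_ring RF by (rule scalar_ring_RF)
  show ?thesis
    unfolding J_def by (rule RF.genideal_ideal) (auto simp: fix_gen_closed)
qed

text \<open>A generator attached to an orbit is the sum of the cyclotomic generators of its tuples,
  because the exponent is constant along the orbit.\<close>

lemma J_sub: "J \<subseteq> I"
proof -
  interpret RF: scalar_ring RF by (rule scalar_ring_RF)
  interpret C: ideal I R by (rule cyc_ideal_ideal)
  have gen: "fix_gen k \<in> I" if k: "k \<in> T" for k
  proof -
    have "CL (\<lambda>\<beta>. gy 1 ^ \<Lambda> (k 1) * (\<Sum>l\<in>D \<inter> tuples n \<beta>. ge l)) \<in> I" if "finite D" "D \<subseteq> lab k" for D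
      using that
    proof (induction D rule: finite_induct)
      case empty
      then show ?case
        using additive_subgroup.zero_closed[OF C.is_additive_subgroup] by (simp add: CL_zero)
    next
      case (insert l D)
      have y: "(\<lambda>\<beta>. gy 1 ^ \<Lambda> (k 1)) \<in> families"
        using n by (intro gy_family) simp
      have f: "(\<lambda>\<beta>. \<Sum>l\<in>D \<inter> tuples n \<beta>. ge l) \<in> families"
        by (auto intro!: familiesI free_alg_sum klr_gens_carrier)
      have "CL (\<lambda>\<beta>. gy 1 ^ \<Lambda> (k 1) * (\<Sum>l\<in>insert l D \<inter> tuples n \<beta>. ge l)) =
        CL (\<lambda>\<beta>. gy 1 ^ \<Lambda> (k 1) * e_family l \<beta> + gy 1 ^ \<Lambda> (k 1) * (\<Sum>l\<in>D \<inter> tuples n \<beta>. ge l))"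
        using insert by (intro CL_cong) (simp add: e_family_def Int_insert_left distrib_left)
      also have "\<dots> = cyc_gen l \<oplus>\<^bsub>R\<^esub> CL (\<lambda>\<beta>. gy 1 ^ \<Lambda> (k 1) * (\<Sum>l\<in>D \<inter> tuples n \<beta>. ge l))"
        unfolding cyc_gen_eq Lambda_lab[OF subsetD[OF insert.prems insertI1]]
        by (rule CL_add[symmetric]) (intro families_closed(2) y f e_family)+
      also have "\<dots> \<in> I"
        using insert lab_T[OF k] cyc_gen_mem[of l]
        by (intro additive_subgroup.a_closed[OF C.is_additive_subgroup]) auto
      finally show ?case .
    qed
    from this[OF finite_lab[OF k] order_refl] show ?thesis
      by (simp add: fix_gen_def phi_def)
  qed
  \<comment> \<open>Contracting \<open>I\<close> along the inclusion of the fixed algebra gives an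
    ideal there, to which minimality of \<open>J\<close> applies.\<close>
  have "id \<in> ring_hom RF R"
    by (auto simp: ring_hom_def carrier_RF RF_ops)
  then have "ideal {X \<in> carrier RF. id X \<in> I} RF"
    by (rule RF.ideal_preimage[OF R.ring_axioms _ cyc_ideal_ideal])
  then have "J \<subseteq> {X \<in> carrier RF. id X \<in> I}"
    unfolding J_def using gen fix_gen_closed by (intro RF.genideal_minimal) auto
  then show ?thesis by auto
qed

text \<open>Relations (F1) to (F11) already hold in the fixed algebra and go to zero; only (FC)
  lands among the generators of \<open>J\<close>.\<close>

lemma phi_fix_ideal:
  assumes "x \<in> fix_ideal"
  shows "phi x \<in> J"
proof -
  interpret RF: scalar_ring RF by (rule scalar_ring_RF)
  interpret J: ideal J RF by (rule J_ideal)
  interpret FX: scalar_ring FX by (rule scalar_ring_free)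
  have "fix_ideal \<subseteq> {x \<in> carrier FX. phi x \<in> J}"
  proof (rule pres_ideal_minimal)
    show "ideal {x \<in> carrier FX. phi x \<in> J} FX"
      by (rule FX.ideal_preimage[OF RF.ring_axioms alg_homE(6)[OF phi_hom_RF] J_ideal])
    fix l r :: "((nat \<Rightarrow> 'k) set gen, 'f) free"
    assume lr: "(l, r) \<in> FR"
    have carr: "l \<in> carrier FX" "r \<in> carrier FX"
      using lr rels_closed_fix by (auto simp: rels_closed_def)
    have "phi (l - r) \<in> J"
    proof (cases "(l, r) \<in> klr_rels n E T lab")
      case True
      have "CL (\<lambda>\<beta>. subst (fixsub \<beta>) (l - r)) = CL (\<lambda>_. 0)"
        using fixsub_rel[OF True] phi_family[OF free_alg_diff[OF carr]] phi_family[OF free_alg_zero]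
        by (subst CL_eq_iff) simp_all
      then have "phi (l - r) = \<zero>\<^bsub>RF\<^esub>"
        by (simp only: phi_def CL_zero RF_ops)
      then show ?thesis
        using additive_subgroup.zero_closed[OF J.is_additive_subgroup] by simp
    next
      case False
      then obtain k where k: "k \<in> T" "l = gy 1 ^ \<Lambda> (k 1) * ge (lab k)" "r = 0"
        using lr by (auto simp: fix_rels_def)
      have "fix_gen k \<in> J"
        unfolding J_def using RF.genideal_self[of "fix_gen ` T"] fix_gen_closed k(1) by blast
      then show ?thesis using k by (simp add: fix_gen_def)
    qed
    then show "l - r \<in> {x \<in> carrier FX. phi x \<in> J}"
      using carr by (simp add: free_alg_diff)
  qed
  then show ?thesis using assms by blast
qed

section \<open>Fixed points of the cyclotomic quotient\<close>

lemma C_eq: "C = quot_alg R I"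
  by (simp add: cyc_klr_def)

lemma scalar_ring_C: "scalar_ring C"
  unfolding C_eq by (rule R.scalar_ring_quot[OF cyc_ideal_ideal])

lemma C_hom: "(+>\<^bsub>R\<^esub>) I \<in> alg_hom R C"
  unfolding C_eq by (rule R.quot_alg_hom[OF cyc_ideal_ideal])

lemma aut_coset: "X \<in> carrier R \<Longrightarrow> aut ` (I +>\<^bsub>R\<^esub> X) = I +>\<^bsub>R\<^esub> aut X"
  by (rule R.image_coset[OF scalar_ring_R aut_hom cyc_ideal_ideal cyc_ideal_ideal aut_cyc_ideal])

lemma aut_image_hom: "(\<lambda>X. aut ` X) \<in> alg_hom C C"
proof (rule alg_homI)
  show "aut ` \<one>\<^bsub>C\<^esub> = \<one>\<^bsub>C\<^esub>"
    by (simp add: alg_homE(4)[OF C_hom, symmetric] aut_coset alg_homE(4)[OF aut_hom])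
  fix X Y c
  assume "X \<in> carrier C"
  then obtain x where x: "x \<in> carrier R" "X = I +>\<^bsub>R\<^esub> x"
    unfolding C_eq R.carrier_quot_alg by blast
  note ax = alg_homE(1)[OF aut_hom x(1)]
  show "aut ` X \<in> carrier C"
    using alg_homE(1)[OF C_hom ax] x by (simp add: aut_coset)
  show "aut ` (c \<odot>\<^bsub>C\<^esub> X) = c \<odot>\<^bsub>C\<^esub> aut ` X"
    using x ax by (simp add: alg_homE(5)[OF C_hom, symmetric] aut_coset R.smult_closed alg_homE(5)[OF aut_hom])
  assume "Y \<in> carrier C"
  then obtain y where y: "y \<in> carrier R" "Y = I +>\<^bsub>R\<^esub> y"
    unfolding C_eq R.carrier_quot_alg by blast
  note ay = alg_homE(1)[OF aut_hom y(1)]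
  show "aut ` (X \<otimes>\<^bsub>C\<^esub> Y) = aut ` X \<otimes>\<^bsub>C\<^esub> aut ` Y" "aut ` (X \<oplus>\<^bsub>C\<^esub> Y) = aut ` X \<oplus>\<^bsub>C\<^esub> aut ` Y"
    using x y ax ay
    by (simp_all add: alg_homE(2,3)[OF C_hom, symmetric] aut_coset alg_homE(2,3)[OF aut_hom])
qed

lemma CF_eq: "CF = fixed_subalg C (\<lambda>X. aut ` X)"
  by (simp add: cyc_klr_fixed_def)

lemma scalar_ring_CF: "scalar_ring CF"
  unfolding CF_eq by (rule scalar_ring_fixed[OF scalar_ring_C aut_image_hom])

lemma CF_ops:
  "mult CF = mult C" "one CF = one C" "add CF = add C" "zero CF = zero C" "smult CF = smult C"
  by (simp_all add: CF_eq fixed_subalg_def)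

definition to_CF :: "((nat \<Rightarrow> 'k) set gen, 'f) free \<Rightarrow> ('k, 'f) klr_elt set"
  where "to_CF x = I +>\<^bsub>R\<^esub> phi x"

lemma to_CF_hom: "to_CF \<in> alg_hom FX CF"
proof -
  have hom: "to_CF \<in> alg_hom FX C"
    unfolding to_CF_def[abs_def] using alg_hom_trans[OF phi_hom C_hom] by (simp add: comp_def)
  moreover have "to_CF x \<in> carrier CF" if "x \<in> carrier FX" for x
    using alg_homE(1)[OF hom that] that
    by (simp add: CF_eq fixed_subalg_def to_CF_def aut_coset phi_simps(1) aut_phi)
  ultimately show ?thesis
    by (simp add: alg_hom_def ring_hom_def CF_ops)
qed

lemma to_CF_surj: "to_CF ` carrier FX = carrier CF"
proof
  show "to_CF ` carrier FX \<subseteq> carrier CF"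
    using alg_homE(1)[OF to_CF_hom] by blast
  show "carrier CF \<subseteq> to_CF ` carrier FX"
  proof
    fix Y assume "Y \<in> carrier CF"
    then have Y: "Y \<in> carrier C" "aut ` Y = Y"
      by (auto simp: CF_eq fixed_subalg_def)
    then obtain X where X: "X \<in> carrier R" "Y = I +>\<^bsub>R\<^esub> X"
      unfolding C_eq R.carrier_quot_alg by blast
    note aX = alg_homE(1)[OF aut_hom X(1)]
    have "aut X \<ominus>\<^bsub>R\<^esub> X \<in> I"
      using Y(2) X aX by (simp add: aut_coset R.quot_alg_eq_iff[OF cyc_ideal_ideal, symmetric])
    then obtain u where u: "u \<in> carrier FX" "X \<ominus>\<^bsub>R\<^esub> phi u \<in> I"
      using aut_fixed_mod_ideal[OF cyc_ideal_ideal _ X(1)] aut_cyc_ideal by blast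
    then have "Y = to_CF u"
      using X by (simp add: to_CF_def R.quot_alg_eq_iff[OF cyc_ideal_ideal] phi_simps(1))
    then show "Y \<in> to_CF ` carrier FX"
      using u(1) by blast
  qed
qed

text \<open>Being fixed is being fixed modulo the zero ideal, which \<open>aut\<close>
  preserves.\<close>

lemma phi_surj: "phi ` carrier FX = carrier RF"
proof
  show "phi ` carrier FX \<subseteq> carrier RF"
    using alg_homE(1)[OF phi_hom_RF] by blast
  show "carrier RF \<subseteq> phi ` carrier FX"
  proof
    fix X assume "X \<in> carrier RF"
    then have X: "X \<in> carrier R" "aut X = X"
      by (auto simp: carrier_RF)
    have "aut \<zero>\<^bsub>R\<^esub> = \<zero>\<^bsub>R\<^esub>"
      using aut_phi[OF free_alg_zero] by (simp add: phi_def CL_zero)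
    then have "aut ` {\<zero>\<^bsub>R\<^esub>} \<subseteq> {\<zero>\<^bsub>R\<^esub>}"
      by simp
    moreover have "aut X \<ominus>\<^bsub>R\<^esub> X \<in> {\<zero>\<^bsub>R\<^esub>}"
      using X by (simp add: R.minus_eq R.r_neg)
    ultimately obtain u where u: "u \<in> carrier FX" "X \<ominus>\<^bsub>R\<^esub> phi u = \<zero>\<^bsub>R\<^esub>"
      using aut_fixed_mod_ideal[OF R.zeroideal _ X(1)] by blast
    have "X = (X \<ominus>\<^bsub>R\<^esub> phi u) \<oplus>\<^bsub>R\<^esub> phi u"
      using X(1) u(1) by (simp add: R.minus_eq R.a_assoc R.l_neg phi_simps(1))
    then have "X = phi u"
      using u phi_simps(1) by simp
    then show "X \<in> phi ` carrier FX"
      using u(1) by blast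
  qed
qed

section \<open>Equality of the kernels and the resulting isomorphisms\<close>

lemma fix_ideal_ideal: "ideal fix_ideal FX"
  using fix_ideal by (simp add: free_ideal_def)

lemma coset_eq_zero_iff:
  assumes "scalar_ring A" and K: "ideal K A" and x: "x \<in> carrier A"
  shows "K +>\<^bsub>A\<^esub> x = \<zero>\<^bsub>quot_alg A K\<^esub> \<longleftrightarrow> x \<in> K"
proof -
  interpret scalar_ring A by fact
  interpret ideal K A by fact
  have "\<zero>\<^bsub>quot_alg A K\<^esub> = K"
    by (simp add: quot_alg_def FactRing_def)
  then show ?thesis
    using a_rcos_const[of x] rcos_const_imp_mem[OF x] by auto
qed

text \<open>The kernel comes from a circle of implications: x in \<open>fix_ideal\<close> gives
  \<open>phi x\<close> in \<open>J\<close>, hence in \<open>I\<close>, and this returns x to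
  \<open>fix_ideal\<close>. The same circle shows that the map to the quotient by \<open>J\<close>
  has the same kernel.\<close>

lemma iso_CF:
  "\<exists>h\<in>alg_iso (pres_alg FG FR) CF. \<forall>x\<in>carrier FX. h (fix_ideal +>\<^bsub>FX\<^esub> x) = to_CF x"
  unfolding pres_alg_def
proof (rule scalar_ring.first_iso[OF scalar_ring_free scalar_ring_CF to_CF_hom to_CF_surj fix_ideal_ideal])
  fix x assume x: "x \<in> carrier FX"
  have "to_CF x = \<zero>\<^bsub>CF\<^esub> \<longleftrightarrow> phi x \<in> I"
    unfolding to_CF_def CF_ops C_eq
    by (rule coset_eq_zero_iff[OF scalar_ring_R cyc_ideal_ideal phi_simps(1)]) (rule x)
  then show "to_CF x = \<zero>\<^bsub>CF\<^esub> \<longleftrightarrow> x \<in> fix_ideal"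
    using phi_mem_cyc_ideal[OF x] phi_fix_ideal[of x] J_sub by blast
qed

lemma iso_fixed_cyc: "\<exists>h. h \<in> alg_iso (pres_alg FG FR) (klr_fixed_cyc n E \<sigma> \<alpha> \<Lambda> :: ('f, ('k, 'f) klr_elt set) module)"
proof -
  interpret RF: scalar_ring RF by (rule scalar_ring_RF)
  let ?g = "\<lambda>x. J +>\<^bsub>RF\<^esub> phi x"
  have "\<exists>h\<in>alg_iso (quot_alg FX fix_ideal) (quot_alg RF J). \<forall>x\<in>carrier FX. h (fix_ideal +>\<^bsub>FX\<^esub> x) = ?g x"
  proof (rule scalar_ring.first_iso[OF scalar_ring_free])
    show "scalar_ring (quot_alg RF J)"
      by (rule RF.scalar_ring_quot[OF J_ideal])
    show "?g \<in> alg_hom FX (quot_alg RF J)"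
      using alg_hom_trans[OF phi_hom_RF RF.quot_alg_hom[OF J_ideal]] by (simp add: comp_def)
    show "?g ` carrier FX = carrier (quot_alg RF J)"
      by (simp add: RF.carrier_quot_alg phi_surj[symmetric] image_image)
    show "ideal fix_ideal FX"
      by (rule fix_ideal_ideal)
    fix x assume x: "x \<in> carrier FX"
    have "?g x = \<zero>\<^bsub>quot_alg RF J\<^esub> \<longleftrightarrow> phi x \<in> J"
      by (rule coset_eq_zero_iff[OF scalar_ring_RF J_ideal alg_homE(1)[OF phi_hom_RF]]) (rule x)
    then show "?g x = \<zero>\<^bsub>quot_alg RF J\<^esub> \<longleftrightarrow> x \<in> fix_ideal"
      using phi_mem_cyc_ideal[OF x] phi_fix_ideal[of x] J_sub by blast
  qed
  then show ?thesis
    unfolding klr_fixed_cyc_eq pres_alg_def by blast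
qed

lemma scalar_ring_pres: "scalar_ring (pres_alg FG FR :: ('f, _) module)"
  unfolding pres_alg_def by (rule scalar_ring.scalar_ring_quot[OF scalar_ring_free fix_ideal_ideal])

theorem presentation:
  "(\<exists>f. f \<in> alg_iso CF (klr_fixed_cyc n E \<sigma> \<alpha> \<Lambda> :: ('f, ('k, 'f) klr_elt set) module)) \<and>
   (\<exists>h. h \<in> alg_iso (pres_alg FG FR) CF \<and>
      (\<forall>\<gamma>\<in>tuple_orbits n \<sigma> \<alpha>. h (pres_gen FG FR (E_gen \<gamma>)) = cyc_class n E \<sigma> \<alpha> \<Lambda> (orb_idem n E \<sigma> \<alpha> \<gamma>)) \<and>
      (\<forall>a\<in>{1..n}. h (pres_gen FG FR (Y_gen a)) = cyc_class n E \<sigma> \<alpha> \<Lambda> (orb_y n E \<sigma> \<alpha> a)) \<and>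
      (\<forall>a\<in>{1..<n}. h (pres_gen FG FR (Psi_gen a)) = cyc_class n E \<sigma> \<alpha> \<Lambda> (orb_psi n E \<sigma> \<alpha> a)))"
proof
  obtain h where h: "h \<in> alg_iso (pres_alg FG FR) CF" "\<forall>x\<in>carrier FX. h (fix_ideal +>\<^bsub>FX\<^esub> x) = to_CF x"
    using iso_CF by blast
  obtain h' where h': "h' \<in> alg_iso (pres_alg FG FR) (klr_fixed_cyc n E \<sigma> \<alpha> \<Lambda> :: ('f, ('k, 'f) klr_elt set) module)"
    using iso_fixed_cyc by blast
  show "\<exists>f. f \<in> alg_iso CF (klr_fixed_cyc n E \<sigma> \<alpha> \<Lambda> :: ('f, ('k, 'f) klr_elt set) module)"
    \<comment> \<open>The isomorphism between the two algebras passes through the presented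
      algebra.\<close>
    using alg_iso_trans[OF scalar_ring.alg_iso_sym[OF scalar_ring_pres h(1)] h'] by blast
  show "\<exists>h. h \<in> alg_iso (pres_alg FG FR) CF \<and>
      (\<forall>\<gamma>\<in>tuple_orbits n \<sigma> \<alpha>. h (pres_gen FG FR (E_gen \<gamma>)) = cyc_class n E \<sigma> \<alpha> \<Lambda> (orb_idem n E \<sigma> \<alpha> \<gamma>)) \<and>
      (\<forall>a\<in>{1..n}. h (pres_gen FG FR (Y_gen a)) = cyc_class n E \<sigma> \<alpha> \<Lambda> (orb_y n E \<sigma> \<alpha> a)) \<and>
      (\<forall>a\<in>{1..<n}. h (pres_gen FG FR (Psi_gen a)) = cyc_class n E \<sigma> \<alpha> \<Lambda> (orb_psi n E \<sigma> \<alpha> a))"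
    using h by (intro exI[of _ h] conjI)
      (auto simp: pres_gen_def cyc_class_def tuple_orbits_eq FG_carrier to_CF_def orb_idem_eq phi_y phi_psi)
qed

end

theorem theorem2p43:
  fixes n p :: nat
    and E :: "('k \<times> 'k) set"
    and \<sigma> :: "'k \<Rightarrow> 'k"
    and \<alpha> \<Lambda> :: "'k \<Rightarrow> nat"
  assumes "n \<ge> 1" and "p \<ge> 1"
    and "\<not> CHAR('f::field) dvd p"
    and "irrefl E"
    and "bij \<sigma>"
    and "\<And>k k'. (k, k') \<in> E \<Longrightarrow> (\<sigma> k, \<sigma> k') \<in> E"
    and "\<And>k. (\<sigma> ^^ p) k = k"
    and "\<And>k p1. 1 \<le> p1 \<Longrightarrow> p1 \<le> p - 1 \<Longrightarrow> (\<sigma> ^^ p1) k \<noteq> k"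
    and "composition n \<alpha>"
    and "finite {k. \<Lambda> k \<noteq> 0}"
    and "\<And>k. \<Lambda> (\<sigma> k) = \<Lambda> k"
  shows
    "(\<exists>f. f \<in> alg_iso (cyc_klr_fixed n E \<sigma> \<alpha> \<Lambda> :: ('f, ('k, 'f) klr_elt set) module)
                     (klr_fixed_cyc n E \<sigma> \<alpha> \<Lambda> :: ('f, ('k, 'f) klr_elt set) module)) \<and>
     (\<exists>h. h \<in> alg_iso (pres_alg (fix_gens n \<sigma> \<alpha>) (fix_rels n E \<sigma> \<alpha> \<Lambda>))
                     (cyc_klr_fixed n E \<sigma> \<alpha> \<Lambda> :: ('f, ('k, 'f) klr_elt set) module) \<and>
        (\<forall>\<gamma>\<in>tuple_orbits n \<sigma> \<alpha>.
           h (pres_gen (fix_gens n \<sigma> \<alpha>) (fix_rels n E \<sigma> \<alpha> \<Lambda>) (E_gen \<gamma>))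
             = cyc_class n E \<sigma> \<alpha> \<Lambda> (orb_idem n E \<sigma> \<alpha> \<gamma>)) \<and>
        (\<forall>a\<in>{1..n}.
           h (pres_gen (fix_gens n \<sigma> \<alpha>) (fix_rels n E \<sigma> \<alpha> \<Lambda>) (Y_gen a))
             = cyc_class n E \<sigma> \<alpha> \<Lambda> (orb_y n E \<sigma> \<alpha> a)) \<and>
        (\<forall>a\<in>{1..<n}.
           h (pres_gen (fix_gens n \<sigma> \<alpha>) (fix_rels n E \<sigma> \<alpha> \<Lambda>) (Psi_gen a))
             = cyc_class n E \<sigma> \<alpha> \<Lambda> (orb_psi n E \<sigma> \<alpha> a)))"
proof -
  interpret quiver_klr n p E \<sigma> \<alpha> \<Lambda> "TYPE('f)"
    by unfold_locales (use assms in \<open>auto simp: composition_def\<close>)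
  show ?thesis
    by (rule presentation)
qed

end
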